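(* The space of smooth nondegenerate fibrations of $\mathbb R^3$ by oriented lines deformation retracts onto its subspace of Hopf fibrations.
   Context: A smooth fibration of $\mathbb R^3$ by oriented lines is a smooth unit vector field $V:\mathbb R^3\to S^2$ all of whose integral curves are oriented straight lines; it is nondegenerate if at every point $p$, $\nabla V$ at $p$ vanishes only in the direction of $V(p)$. The space of such fibrations is topologized as a subset of the space of continuous maps $\mathbb R^3\to S^2$. A Hopf fibration is one of the following form: choose an oriented affine plane $P\subset\mathbb R^3$ through a point $o$, with oriented unit normal $V_0$, and let $J$ denote rotation by $+\pi/2$ in $P-o$ (a linear plane); the fibers are the lines through $p\in P$ with direction $\varepsilon J(p-o)+V_0$, for a fixed sign $\varepsilon\in\{+1,-1\}$ (positively or negatively oriented Hopf fibration). *)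

theory Defs
  imports "HOL-Analysis.Analysis"
begin

text \<open>C^k and C^infinity maps between real normed vector spaces, via iterated
  directional (Frechet) derivatives (in finite dimensions this is the usual notion).\<close>
primrec Ck :: "nat \<Rightarrow> ('a::real_normed_vector \<Rightarrow> 'b::real_normed_vector) \<Rightarrow> bool" where
  "Ck 0 f = continuous_on UNIV f"
| "Ck (Suc k) f = (\<exists>f'. (\<forall>x. (f has_derivative f' x) (at x)) \<and> (\<forall>v. Ck k (\<lambda>x. f' x v)))"

definition smooth_map :: "('a::real_normed_vector \<Rightarrow> 'b::real_normed_vector) \<Rightarrow> bool" where
  "smooth_map f \<longleftrightarrow> (\<forall>k. Ck k f)"

text \<open>Integral curves of a vector field on R^3 (all of them are global for a
  bounded smooth field).\<close>
definition integral_curve :: "(real^3 \<Rightarrow> real^3) \<Rightarrow> (real \<Rightarrow> real^3) \<Rightarrow> bool" where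
  "integral_curve V \<gamma> \<longleftrightarrow> (\<forall>t. (\<gamma> has_vector_derivative V (\<gamma> t)) (at t))"

text \<open>Smooth fibration of R^3 by oriented lines: a smooth unit vector field
  all of whose integral curves are oriented straight lines (traversed at unit speed
  in the direction of V, since V is a unit field).\<close>
definition line_fibration :: "(real^3 \<Rightarrow> real^3) \<Rightarrow> bool" where
  "line_fibration V \<longleftrightarrow>
     smooth_map V \<and> (\<forall>p. norm (V p) = 1) \<and>
     (\<forall>\<gamma>. integral_curve V \<gamma> \<longrightarrow> (\<forall>t. \<gamma> t = \<gamma> 0 + t *\<^sub>R V (\<gamma> 0)))"

definition nondegenerate :: "(real^3 \<Rightarrow> real^3) \<Rightarrow> bool" where
  "nondegenerate V \<longleftrightarrow>
     (\<forall>p D. (V has_derivative D) (at p) \<longrightarrow> (\<forall>w. D w = 0 \<longrightarrow> (\<exists>c. w = c *\<^sub>R V p)))"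

definition nondeg_fibrations :: "(real^3 \<Rightarrow> real^3) set" where
  "nondeg_fibrations = {V. line_fibration V \<and> nondegenerate V}"

text \<open>Hopf fibrations: plane P through o with unit normal V0, J = rotation by +pi/2
  in P - o (i.e. w \<mapsto> V0 \<times> w), fibers through p \<in> P with direction
  eps J(p - o) + V0; V is the unit tangent field of these oriented lines.\<close>
definition hopf_fibration :: "(real^3 \<Rightarrow> real^3) \<Rightarrow> bool" where
  "hopf_fibration V \<longleftrightarrow>
     (\<exists>(o'::real^3) (V0::real^3) (eps::real). norm V0 = 1 \<and> eps \<in> {1, -1} \<and>
        (\<forall>p. (p - o') \<bullet> V0 = 0 \<longrightarrow>
           (\<forall>t. V (p + t *\<^sub>R (eps *\<^sub>R (cross3 V0 (p - o')) + V0))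
                 = sgn (eps *\<^sub>R (cross3 V0 (p - o')) + V0))))"

definition compact_open :: "('a::topological_space \<Rightarrow> 'b::topological_space) topology" where
  "compact_open = topology_generated_by {{f. f ` K \<subseteq> U} | K U. compact K \<and> open U}"

end

theory Submission
  imports Defs "HOL-Probability.Distributions"
begin

unbundle cross3_syntax

text \<open>An oriented line with unit direction \<open>u\<close> through \<open>q\<close> is encoded by the pair
  \<open>(u - \<epsilon> q \<times> u, u + \<epsilon> q \<times> u)\<close> of vectors of equal norm. Nondegeneracy makes any two fibers skew
  with a constant sign \<open>\<epsilon>\<close>, and skewness with that sign says that the fibration is the graph, over an
  open cone, of a positively homogeneous, norm-preserving, nonexpansive map \<open>G\<close> of \<open>\<real>\<^sup>3\<close>; off the
  cone \<open>G\<close> is \<open>- x\<close>. Conversely, every smooth strict contraction \<open>h\<close> of the sphere defines a fibration: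
  the fiber through a point is found as a fixed point of a contraction, and depends smoothly on the
  point by the implicit function theorem. Constant \<open>h\<close> are the Hopf fibrations centered at the origin.

  The averages of \<open>z \<mapsto> G ((1 - s) x + s z)\<close> against a Gaussian, normalized, are smooth strict
  contractions for \<open>0 < s \<le> 1\<close>, reproduce \<open>G\<close> at \<open>s = 0\<close>, are constant in \<open>x\<close> at \<open>s = 1\<close>, and leave
  constant maps unchanged. This deforms every fibration into a Hopf fibration, but fixes only the Hopf
  fibrations centered at the origin. The center is a continuous function on the closed set of
  Hopf fibrations, so by Tietze it extends to a continuous function \<open>b\<close> on all fibrations; averaging
  \<open>V\<close> about \<open>b V\<close> instead of the origin fixes all Hopf fibrations.\<close>

section \<open>Integral curves\<close>

text \<open>Two numbers decide whether the normalized average is a strict contraction.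
  \<open>mollify s G\<close> has Lipschitz constant \<open>1 - s\<close> times the Gaussian mass, so
  its norm on the unit sphere must exceed that same number. Its inner product with
  \<open>G x\<close> does, provided \<open>y \<bullet> x < G y \<bullet> G x\<close> for at least
  one \<open>y\<close>. This is where openness of the cone enters: if
  \<open>G y \<bullet> G x = y \<bullet> x\<close> held throughout the cone, the cone would lie on
  one line. The cone varies with the fibration, so the extension by \<open>- x\<close> has to be
  nonexpansive and also to depend continuously on the fibration. The second point rests on the fact
  that of \<open>x\<close> and \<open>- x\<close>, for nonzero \<open>x\<close>, at least one lies
  in the cone: a point outside can then be placed between two frontier points. The center of a Hopf
  fibration has no evident analogue for a general fibration, which is why it is extended by Tietze.
  The price is normality of the space of fibrations, closedness of the Hopf fibrations, and a bound
  on the centers of the Hopf fibrations near a given fibration.\<close>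

lemma antiderivative_line:
  fixes g :: "real \<Rightarrow> 'a::banach"
  assumes "continuous_on UNIV g"
  obtains G where "G 0 = 0" "\<And>t. (G has_vector_derivative g t) (at t)"
proof -
  define G where "G t = (if 0 \<le> t then integral {0..t} g else - integral {t..0} g)" for t
  have cont: "continuous_on S g" for S
    using assms continuous_on_subset by blast
  have G: "G t = integral {-n..t} g - integral {-n..0} g" if "-n \<le> t" "0 \<le> n" for n t
  proof (cases "0 \<le> t")
    case True
    have "integral {-n..0} g + integral {0..t} g = integral {-n..t} g"
      using that True by (intro Henstock_Kurzweil_Integration.integral_combine integrable_continuous_interval cont) auto
    then show ?thesis using True by (simp add: G_def algebra_simps)
  next
    case False
    have "integral {-n..t} g + integral {t..0} g = integral {-n..0} g"
      using that False by (intro Henstock_Kurzweil_Integration.integral_combine integrable_continuous_interval cont) auto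
    then show ?thesis using False by (simp add: G_def algebra_simps)
  qed
  have "(G has_vector_derivative g t) (at t)" for t
  proof -
    define n where "n = \<bar>t\<bar> + 1"
    have n: "-n < t" "t < n" "0 \<le> n" by (auto simp: n_def)
    have "((\<lambda>t. integral {-n..t} g) has_vector_derivative g t) (at t within {-n..n})"
      using n by (intro integral_has_vector_derivative cont) auto
    then have "((\<lambda>t. integral {-n..t} g) has_vector_derivative g t) (at t)"
      using n at_within_Icc_at by metis
    then have "((\<lambda>t. integral {-n..t} g - integral {-n..0} g) has_vector_derivative g t) (at t)"
      by (auto intro!: derivative_eq_intros)
    then show ?thesis
      by (rule has_vector_derivative_transform_within_open[of _ _ _ "{-n<..}"]) (use n G[of n] in auto)
  qed
  moreover have "G 0 = 0" by (simp add: G_def)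
  ultimately show ?thesis using that by blast
qed

text \<open>Applied repeatedly to differences of Picard iterates: each integration raises the power
  of \<open>\<bar>t\<bar>\<close> by one, and the denominators build up a factorial. Negative times
  reduce to positive ones by reflection.\<close>

lemma norm_le_power_of_derivative_le:
  fixes h :: "real \<Rightarrow> 'a::real_normed_vector"
  assumes "h 0 = 0" and der: "\<And>t. (h has_vector_derivative h' t) (at t)"
    and bound: "\<And>t. \<bar>t\<bar> \<le> T \<Longrightarrow> norm (h' t) \<le> c * \<bar>t\<bar> ^ k" and t: "\<bar>t\<bar> \<le> T"
  shows "norm (h t) \<le> c * \<bar>t\<bar> ^ Suc k / Suc k"
proof -
  have pos: "norm (g s) \<le> c * s ^ Suc k / Suc k"
    if g: "g 0 = 0" "\<And>t. (g has_vector_derivative g' t) (at t)"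
      and b: "\<And>t. \<bar>t\<bar> \<le> T \<Longrightarrow> norm (g' t) \<le> c * \<bar>t\<bar> ^ k" and s: "0 < s" "s \<le> T"
    for g g' s
  proof -
    have "norm (g s - g 0) \<le> c * s ^ Suc k / Suc k - c * 0 ^ Suc k / Suc k"
    proof (rule differentiable_bound_general[OF s(1), where f'=g' and \<phi>'="\<lambda>t. c * t ^ k"])
      show "continuous_on {0..s} g"
        by (intro continuous_at_imp_continuous_on ballI has_vector_derivative_continuous[OF g(2)])
      show "continuous_on {0..s} (\<lambda>t. c * t ^ Suc k / Suc k)"
        by (intro continuous_intros) auto
      show "((\<lambda>t. c * t ^ Suc k / Suc k) has_vector_derivative c * x ^ k) (at x)" for x
      proof -
        have "((\<lambda>t. c * t ^ Suc k / Suc k) has_field_derivative c * (real (Suc k) * x ^ k) / Suc k) (at x)"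
          by (rule derivative_eq_intros refl | simp)+
        then show ?thesis
          by (simp add: has_real_derivative_iff_has_vector_derivative del: of_nat_Suc)
      qed
      show "norm (g' x) \<le> c * x ^ k" if "0 < x" "x < s" for x
        using b[of x] that s by simp
    qed (use g in auto)
    then show ?thesis using g by simp
  qed
  consider "t = 0" | "0 < t" | "t < 0" by linarith
  then show ?thesis
  proof cases
    case 3
    have "((\<lambda>t. h (- t)) has_vector_derivative - h' (- s)) (at s)" for s
      using vector_diff_chain_at[of uminus "-1" s h "h' (-s)"] der[of "-s"]
        has_vector_derivative_minus[OF has_vector_derivative_id, of "at s"]
      by (simp add: o_def)
    then have "norm (h (- (- t))) \<le> c * (- t) ^ Suc k / Suc k"
      by (rule pos[of "\<lambda>t. h (- t)" "\<lambda>t. - h' (- t)" "-t", rotated]) (use assms bound[of "- _"] 3 in auto)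
    then show ?thesis using 3 by simp
  qed (use assms pos[of h h' t] in auto)
qed

text \<open>On the compact ball the operator norm of the derivative is bounded by the sum of the
  norms of the partial derivatives, whose continuity is what \<open>Ck\<close> records.\<close>

lemma C1_lipschitz_cball:
  fixes V :: "'a::euclidean_space \<Rightarrow> 'b::real_normed_vector"
  assumes "Ck (Suc 0) V"
  obtains L where "0 < L" "\<And>x y. x \<in> cball p T \<Longrightarrow> y \<in> cball p T \<Longrightarrow> norm (V x - V y) \<le> L * norm (x - y)"
proof -
  obtain V' where der: "\<And>x. (V has_derivative V' x) (at x)"
    and cont: "\<And>v. continuous_on UNIV (\<lambda>x. V' x v)"
    using assms by auto
  have "continuous_on (cball p T) (\<lambda>x. \<Sum>i\<in>Basis. norm (V' x i))"
    by (intro continuous_intros continuous_on_subset[OF cont]) auto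
  then have "bounded ((\<lambda>x. \<Sum>i\<in>Basis. norm (V' x i)) ` cball p T)"
    by (intro compact_imp_bounded compact_continuous_image) auto
  then obtain L where "0 < L" and "\<forall>x\<in>(\<lambda>x. \<Sum>i\<in>Basis. norm (V' x i)) ` cball p T. norm x \<le> L"
    unfolding bounded_pos by blast
  then have L: "norm (\<Sum>i\<in>Basis. norm (V' x i)) \<le> L" "0 < L" if "x \<in> cball p T" for x
    using that by blast+
  have "norm (V x - V y) \<le> L * norm (x - y)" if "x \<in> cball p T" "y \<in> cball p T" for x y
  proof (rule differentiable_bound[OF convex_cball _ _ that, where f'=V'])
    fix z assume z: "z \<in> cball p T"
    show "(V has_derivative V' z) (at z within cball p T)"
      using der has_derivative_at_withinI by blast
    interpret bounded_linear "V' z" using der has_derivative_bounded_linear by blast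
    show "onorm (V' z) \<le> L"
    proof (rule onorm_le)
      fix v
      have "norm (V' z v) = norm (\<Sum>i\<in>Basis. (v \<bullet> i) *\<^sub>R V' z i)"
        by (metis (no_types, lifting) euclidean_representation scale sum sum.cong)
      also have "\<dots> \<le> (\<Sum>i\<in>Basis. norm v * norm (V' z i))"
        by (intro sum_norm_le) (simp add: Basis_le_norm mult_right_mono)
      also have "\<dots> \<le> norm v * L"
        using L(1)[OF z] by (simp flip: sum_distrib_left add: mult_left_mono)
      finally show "norm (V' z v) \<le> L * norm v" by (simp add: mult.commute)
    qed
  qed
  with \<open>0 < L\<close> that show ?thesis by blast
qed

text \<open>The definition of a line fibration constrains integral curves without asserting that
  there are any; Picard iteration supplies one through every point. As \<open>V\<close> has norm at
  most 1, the iterates stay in \<open>cball p T\<close> up to time \<open>T\<close>, so one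
  Lipschitz constant controls all of them there and the solution is global.\<close>

lemma integral_curve_exists:
  fixes V :: "real^3 \<Rightarrow> real^3"
  assumes C1: "Ck (Suc 0) V" and unit: "\<And>x. norm (V x) \<le> 1"
  obtains \<gamma> where "integral_curve V \<gamma>" "\<gamma> 0 = p"
proof -
  have cV: "continuous_on UNIV V"
    using C1 by (auto intro: continuous_at_imp_continuous_on has_derivative_continuous)
  \<comment> \<open>A fixed antiderivative operator, vanishing at 0, so that the Picard operator is
    a function that can be iterated.\<close>
  define A where "A g = (SOME G. G 0 = (0::real^3) \<and> (\<forall>t. (G has_vector_derivative g t) (at t)))" for g
  have A: "A g 0 = 0" "(A g has_vector_derivative g t) (at t)" if "continuous_on UNIV g" for g t
  proof -
    have "\<exists>G. G 0 = (0::real^3) \<and> (\<forall>t. (G has_vector_derivative g t) (at t))"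
      using antiderivative_line[OF that] by blast
    from someI_ex[OF this] show "A g 0 = 0" "(A g has_vector_derivative g t) (at t)"
      unfolding A_def by auto
  qed
  define c where "c n = ((\<lambda>\<gamma> t. p + A (V \<circ> \<gamma>) t) ^^ n) (\<lambda>t. p)" for n
  have c_Suc: "c (Suc n) = (\<lambda>t. p + A (V \<circ> c n) t)" for n
    by (simp add: c_def)
  have cc: "continuous_on UNIV (c n)" for n
  proof (induction n)
    case 0 then show ?case by (simp add: c_def)
  next
    case (Suc n)
    have "continuous_on UNIV (V \<circ> c n)"
      using Suc cV by (meson continuous_on_compose continuous_on_subset subset_UNIV)
    then have "isCont (A (V \<circ> c n)) t" for t
      by (rule has_vector_derivative_continuous[OF A(2)])
    then show ?case unfolding c_Suc
      by (intro continuous_on_add continuous_on_const continuous_at_imp_continuous_on) auto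
  qed
  have cVc: "continuous_on UNIV (V \<circ> c n)" for n
    using cc cV by (meson continuous_on_compose continuous_on_subset subset_UNIV)
  have c0: "c n 0 = p" for n
    by (cases n) (use A(1)[OF cVc] in \<open>auto simp: c_Suc, simp add: c_def\<close>)
  have dc: "(c (Suc n) has_vector_derivative V (c n t)) (at t)" for n t
    unfolding c_Suc using A(2)[OF cVc, of n t] by (auto intro!: derivative_eq_intros)
  have near: "norm (c n t - p) \<le> \<bar>t\<bar>" for n t
  proof (cases n)
    case (Suc m)
    have "norm (c (Suc m) t - p) \<le> 1 * \<bar>t\<bar> ^ Suc 0 / Suc 0"
      by (rule norm_le_power_of_derivative_le[where T="\<bar>t\<bar>" and h'="\<lambda>t. V (c m t)"])
        (use c0[of "Suc m"] dc[of m] unit in \<open>auto intro!: derivative_eq_intros\<close>)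
    then show ?thesis using Suc by simp
  qed (simp add: c_def)
  have main: "\<exists>g. \<forall>t\<in>{-T..T}. (\<lambda>n. c n t) \<longlonglongrightarrow> g t \<and> (g has_vector_derivative V (g t)) (at t within {-T..T})"
    if T: "T > 0" for T
  proof -
    obtain L where L: "0 < L" and lip: "\<And>x y. x \<in> cball p T \<Longrightarrow> y \<in> cball p T \<Longrightarrow> norm (V x - V y) \<le> L * norm (x - y)"
      using C1_lipschitz_cball[OF C1] by blast
    have cT: "c n t \<in> cball p T" if "\<bar>t\<bar> \<le> T" for n t
      using near[of n t] that by (simp add: dist_norm norm_minus_commute)
    have step: "norm (c (Suc n) t - c n t) \<le> L ^ n / fact n * \<bar>t\<bar> ^ Suc n" if "\<bar>t\<bar> \<le> T" for n t
      using that
    proof (induction n arbitrary: t)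
      case 0
      then show ?case using near[of "Suc 0" t] by (simp add: c_def)
    next
      case (Suc n)
      let ?a = "L ^ Suc n / fact n"
      have "norm (c (Suc (Suc n)) t - c (Suc n) t) \<le> ?a * \<bar>t\<bar> ^ Suc (Suc n) / Suc (Suc n)"
      proof (rule norm_le_power_of_derivative_le[where T=T])
        show "((\<lambda>t. c (Suc (Suc n)) t - c (Suc n) t) has_vector_derivative V (c (Suc n) t) - V (c n t)) (at t)" for t
          by (intro has_vector_derivative_diff dc)
        show "norm (V (c (Suc n) t) - V (c n t)) \<le> ?a * \<bar>t\<bar> ^ Suc n" if "\<bar>t\<bar> \<le> T" for t
        proof -
          have "norm (V (c (Suc n) t) - V (c n t)) \<le> L * norm (c (Suc n) t - c n t)"
            by (intro lip cT that)
          also have "\<dots> \<le> L * (L ^ n / fact n * \<bar>t\<bar> ^ Suc n)"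
            using Suc.IH[OF that] L by (intro mult_left_mono) auto
          finally show ?thesis by simp
        qed
      qed (use c0 Suc.prems in auto)
      \<comment> \<open>Integration yields the denominator \<open>Suc (Suc n)\<close>; the smaller
        \<open>Suc n\<close> is what turns \<open>fact n\<close> into
        \<open>fact (Suc n)\<close>.\<close>
      also have "\<dots> \<le> ?a * \<bar>t\<bar> ^ Suc (Suc n) / Suc n"
        using L by (intro divide_left_mono mult_nonneg_nonneg) auto
      also have "\<dots> = L ^ Suc n / fact (Suc n) * \<bar>t\<bar> ^ Suc (Suc n)"
        by (simp add: field_simps)
      finally show ?case .
    qed
    have sumc: "(\<Sum>i<n. c (Suc i) t - c i t) = c n t - p" for n t
      by (subst sum_lessThan_telescope) (simp add: c_def)
    have "uniform_limit {-T..T} (\<lambda>n t. \<Sum>i<n. c (Suc i) t - c i t) (\<lambda>t. \<Sum>i. c (Suc i) t - c i t) sequentially"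
    proof (rule Weierstrass_m_test)
      show "norm (c (Suc n) t - c n t) \<le> T * (inverse (fact n) * (L * T) ^ n)" if "t \<in> {-T..T}" for n t
      proof -
        have "norm (c (Suc n) t - c n t) \<le> L ^ n / fact n * \<bar>t\<bar> ^ Suc n"
          using that by (intro step) auto
        also have "\<dots> \<le> L ^ n / fact n * T ^ Suc n"
          using that L by (intro mult_left_mono power_mono) auto
        finally show ?thesis by (simp add: field_simps power_mult_distrib)
      qed
      show "summable (\<lambda>n. T * (inverse (fact n) * (L * T) ^ n))"
        by (intro summable_mult summable_exp)
    qed
    then have ul0: "uniform_limit {-T..T} (\<lambda>n t. c n t - p) (\<lambda>t. \<Sum>i. c (Suc i) t - c i t) sequentially"
      by (simp add: sumc)
    define g where "g t = p + (\<Sum>i. c (Suc i) t - c i t)" for t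
    have ul: "uniform_limit {-T..T} c g sequentially"
      using ul0 by (simp add: uniform_limit_iff dist_norm g_def algebra_simps)
    have lim: "(\<lambda>n. c n t) \<longlonglongrightarrow> g t" if "t \<in> {-T..T}" for t
      using tendsto_uniform_limitI[OF ul that] .
    have gT: "g t \<in> cball p T" if "t \<in> {-T..T}" for t
      by (rule Lim_in_closed_set[OF closed_cball _ _ lim[OF that]]) (use cT that in auto)
    have unif: "\<forall>\<^sub>F n in sequentially. \<forall>t\<in>{-T..T}. \<forall>h. norm (h *\<^sub>R V (c n t) - h *\<^sub>R V (g t)) \<le> e * norm h"
      if e: "e > 0" for e
    proof -
      have "\<forall>\<^sub>F n in sequentially. \<forall>t\<in>{-T..T}. dist (c n t) (g t) < e / L"
        using ul e L unfolding uniform_limit_iff by simp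
      then show ?thesis
      proof (rule eventually_mono, intro ballI allI)
        fix n t and h :: real
        assume *: "\<forall>t\<in>{-T..T}. dist (c n t) (g t) < e / L" and t: "t \<in> {-T..T}"
        have "norm (V (c n t) - V (g t)) \<le> L * norm (c n t - g t)"
          using t by (intro lip cT gT) auto
        also have "\<dots> \<le> L * (e / L)"
          using * t L by (intro mult_left_mono) (auto simp: dist_norm intro: less_imp_le)
        finally have "norm (V (c n t) - V (g t)) \<le> e" using L by simp
        then show "norm (h *\<^sub>R V (c n t) - h *\<^sub>R V (g t)) \<le> e * norm h"
          by (simp flip: scaleR_diff_right add: mult.commute[of e] mult_left_mono)
      qed
    qed
    \<comment> \<open>Shifted by one because the derivative of \<open>c (Suc n)\<close> is
      \<open>V\<close> along \<open>c n\<close>. The limit \<open>g1\<close> is identified with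
      \<open>g\<close> afterwards.\<close>
    have "\<exists>g1. \<forall>t\<in>{-T..T}. (\<lambda>n. c (Suc n) t) \<longlonglongrightarrow> g1 t \<and> (g1 has_derivative (\<lambda>h. h *\<^sub>R V (g t))) (at t within {-T..T})"
    proof (rule has_derivative_sequence[where ?x0.0=0 and l=p])
      show "(c (Suc n) has_derivative (\<lambda>h. h *\<^sub>R V (c n t))) (at t within {-T..T})" for n t
        using dc[of n t] unfolding has_vector_derivative_def by (rule has_derivative_at_withinI)
      show "\<forall>\<^sub>F n in sequentially. \<forall>t\<in>{-T..T}. \<forall>h. norm (h *\<^sub>R V (c n t) - h *\<^sub>R V (g t)) \<le> e * norm h"
        if "e > 0" for e using unif[OF that] .
      show "(\<lambda>n. c (Suc n) 0) \<longlonglongrightarrow> p" by (simp only: c0 tendsto_const)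
    qed (use T in auto)
    then obtain g1 where g1: "\<And>t. t \<in> {-T..T} \<Longrightarrow> (\<lambda>n. c (Suc n) t) \<longlonglongrightarrow> g1 t"
      "\<And>t. t \<in> {-T..T} \<Longrightarrow> (g1 has_derivative (\<lambda>h. h *\<^sub>R V (g t))) (at t within {-T..T})"
      by blast
    have eq: "g t = g1 t" if "t \<in> {-T..T}" for t
      using LIMSEQ_unique[OF LIMSEQ_Suc[OF lim[OF that]] g1(1)[OF that]] .
    have "(g has_vector_derivative V (g t)) (at t within {-T..T})" if "t \<in> {-T..T}" for t
      unfolding has_vector_derivative_def
      by (rule has_derivative_transform[OF that eq g1(2)[OF that]])
    then show ?thesis using lim by blast
  qed
  \<comment> \<open>The solutions on different intervals are limits of the same sequence, so the
    pointwise limit glues them.\<close>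
  define \<gamma> where "\<gamma> t = lim (\<lambda>n. c n t)" for t
  have "(\<gamma> has_vector_derivative V (\<gamma> t)) (at t)" for t
  proof -
    define T where "T = \<bar>t\<bar> + 1"
    have T: "T > 0" "-T < t" "t < T" by (auto simp: T_def)
    obtain g where g: "\<And>t. t \<in> {-T..T} \<Longrightarrow> (\<lambda>n. c n t) \<longlonglongrightarrow> g t"
       "\<And>t. t \<in> {-T..T} \<Longrightarrow> (g has_vector_derivative V (g t)) (at t within {-T..T})"
      using main[OF T(1)] by blast
    have eq: "\<gamma> s = g s" if "s \<in> {-T..T}" for s
      unfolding \<gamma>_def using g(1)[OF that] by (rule limI)
    have "(\<gamma> has_vector_derivative V (\<gamma> t)) (at t within {-T..T})"
      using g(2)[of t] eq T by (intro has_vector_derivative_transform[of t _ \<gamma> g]) auto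
    then show ?thesis using T by (simp add: at_within_Icc_at)
  qed
  moreover have "\<gamma> 0 = p" by (simp add: \<gamma>_def c0)
  ultimately show ?thesis using that unfolding integral_curve_def by blast
qed

section \<open>Skewness of the fibers\<close>

text \<open>Up to the factor on the left, the vectors paired with \<open>x\<close> form the dual
  basis of the frame \<open>u\<close>, \<open>v\<close>, \<open>u \<times> v\<close>.\<close>

lemma cross_frame_expansion:
  fixes u v x :: "real^3"
  shows "((u \<times> v) \<bullet> (u \<times> v)) *\<^sub>R x
    = (x \<bullet> (v \<times> (u \<times> v))) *\<^sub>R u + (x \<bullet> ((u \<times> v) \<times> u)) *\<^sub>R v + (x \<bullet> (u \<times> v)) *\<^sub>R (u \<times> v)"
  unfolding vec_eq_iff forall_3
  by (simp add: cross_components inner_vec_def sum_3 algebra_simps)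

lemma triple_double_cross:
  fixes u v x :: "real^3"
  shows "x \<times> (u \<times> v) = (x \<bullet> v) *\<^sub>R u - (x \<bullet> u) *\<^sub>R v"
  unfolding vec_eq_iff forall_3 by (simp add: cross3_def inner_vec_def sum_3 algebra_simps)

lemma triple_flip:
  fixes a b x :: "real^3"
  shows "x \<bullet> (a \<times> b) = - (a \<bullet> (x \<times> b))"
  by (simp add: cross3_simps)

lemma triple_swap:
  fixes q q' a b :: "real^3"
  shows "(q - q') \<bullet> (a \<times> b) = (q' - q) \<bullet> (b \<times> a)"
  by (simp add: cross_skew[of b a] inner_diff_left)

lemma unit_parallel:
  fixes u v :: "real^3"
  assumes "norm u = 1" "norm v = 1" "u \<times> v = 0"
  shows "u = v \<or> u = - v"
proof -
  have "(u \<bullet> v)\<^sup>2 = 1" using norm_cross_dot[of u v] assms by simp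
  then have "u \<bullet> v = 1 \<or> u \<bullet> v = -1" by (simp add: power2_eq_1_iff)
  moreover have "u \<bullet> u = 1" "v \<bullet> v = 1" using assms by (simp_all add: norm_eq_1)
  ultimately have "(u - v) \<bullet> (u - v) = 0 \<or> (u + v) \<bullet> (u + v) = 0"
    by (auto simp: inner_diff inner_add inner_commute)
  then show ?thesis by (auto simp: add_eq_0_iff)
qed

lemma exists_nonparallel:
  fixes u :: "real^3"
  assumes "u \<noteq> 0"
  obtains e where "e \<times> u \<noteq> 0"
proof -
  have "axis 1 1 \<times> u \<noteq> 0 \<or> axis 2 1 \<times> u \<noteq> 0"
    using assms by (auto simp: cross3_def axis_def vec_eq_iff forall_3)
  then show ?thesis using that by blast
qed

lemma parallel_imp_multiple:
  fixes u w :: "real^3"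
  assumes "norm u = 1" "w \<times> u = 0"
  shows "w = (w \<bullet> u) *\<^sub>R u"
proof -
  have "u \<times> (u \<times> w) = (u \<bullet> w) *\<^sub>R u - (u \<bullet> u) *\<^sub>R w" by (rule triple_double_cross)
  moreover have "u \<times> w = 0" using assms(2) cross_skew[of u w] by simp
  ultimately show ?thesis using assms(1) by (simp add: norm_eq_1 inner_commute)
qed

section \<open>First-order behavior of a nondegenerate fibration\<close>

lemma smooth_map_C1: "smooth_map V \<Longrightarrow> Ck (Suc 0) V"
  unfolding smooth_map_def by blast

lemma nondeg_unit: "V \<in> nondeg_fibrations \<Longrightarrow> norm (V q) = 1"
  by (simp add: nondeg_fibrations_def line_fibration_def)

lemma nondeg_inner_self: "V \<in> nondeg_fibrations \<Longrightarrow> V q \<bullet> V q = 1"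
  using nondeg_unit norm_eq_1 by blast

lemma nondeg_C1: "V \<in> nondeg_fibrations \<Longrightarrow> Ck (Suc 0) V"
  using smooth_map_C1 by (auto simp add: nondeg_fibrations_def line_fibration_def simp del: Ck.simps)

lemma nondeg_continuous:
  assumes "V \<in> nondeg_fibrations" shows "continuous_on S V"
proof -
  obtain V' where "\<And>x. (V has_derivative V' x) (at x)" using nondeg_C1[OF assms] by auto
  then have "isCont V x" for x using has_derivative_continuous by blast
  then show ?thesis by (simp add: continuous_at_imp_continuous_on)
qed

text \<open>The integral curve through \<open>q\<close> is a straight line, so its velocity at time
  \<open>t\<close> is both the value of \<open>V\<close> there and the constant
  \<open>V q\<close>.\<close>

lemma nondeg_const:
  assumes V: "V \<in> nondeg_fibrations"
  shows "V (q + t *\<^sub>R V q) = V q"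
proof -
  obtain \<gamma> where \<gamma>: "integral_curve V \<gamma>" "\<gamma> 0 = q"
    using integral_curve_exists[OF nondeg_C1[OF V], of q] nondeg_unit[OF V] by auto
  then have eq: "\<gamma> = (\<lambda>t. q + t *\<^sub>R V q)"
    using V by (auto simp: nondeg_fibrations_def line_fibration_def)
  have "(\<gamma> has_vector_derivative V (\<gamma> t)) (at t)"
    using \<gamma>(1) by (simp add: integral_curve_def)
  moreover have "(\<gamma> has_vector_derivative V q) (at t)"
    unfolding eq by (auto intro!: derivative_eq_intros)
  ultimately have "V (\<gamma> t) = V q" by (rule vector_derivative_unique_at)
  then show ?thesis by (simp add: eq)
qed

lemma nondeg_derivative:
  assumes V: "V \<in> nondeg_fibrations"
  obtains D where "(V has_derivative D) (at q)" "bounded_linear D" "D (V q) = 0"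
    "\<And>w. D w \<bullet> V q = 0" "\<And>w. D w = 0 \<Longrightarrow> \<exists>c. w = c *\<^sub>R V q"
proof -
  obtain D where D: "(V has_derivative D) (at q)" using nondeg_C1[OF V] by auto
  have lin: "bounded_linear D" using D has_derivative_bounded_linear by blast
  have "((\<lambda>t. V (q + t *\<^sub>R V q)) has_derivative (\<lambda>t. D (t *\<^sub>R V q))) (at 0)"
    by (rule has_derivative_compose[of "\<lambda>t. q + t *\<^sub>R V q" "\<lambda>t. t *\<^sub>R V q"])
      (use D in \<open>auto intro!: derivative_eq_intros\<close>)
  moreover have "((\<lambda>t::real. V (q + t *\<^sub>R V q)) has_derivative (\<lambda>t. 0)) (at 0)"
    by (simp add: nondeg_const[OF V])
  ultimately have "(\<lambda>t. D (t *\<^sub>R V q)) = (\<lambda>t::real. 0)" by (rule has_derivative_unique)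
  then have 1: "D (V q) = 0" by (metis scaleR_one)
  have "((\<lambda>p. V p \<bullet> V p) has_derivative (\<lambda>w. V q \<bullet> D w + D w \<bullet> V q)) (at q)"
    by (intro has_derivative_inner D)
  moreover have "((\<lambda>p. V p \<bullet> V p) has_derivative (\<lambda>w. 0)) (at q)"
    by (simp add: nondeg_inner_self[OF V])
  ultimately have "(\<lambda>w. V q \<bullet> D w + D w \<bullet> V q) = (\<lambda>w. 0)" by (rule has_derivative_unique)
  then have "D w \<bullet> V q = 0" for w by (simp add: fun_eq_iff inner_commute)
  moreover have "\<And>w. D w = 0 \<Longrightarrow> \<exists>c. w = c *\<^sub>R V q"
    using V D by (auto simp: nondeg_fibrations_def nondegenerate_def)
  ultimately show ?thesis using that D lin 1 by blast
qed

text \<open>Neighboring fibers cannot focus. Otherwise the component \<open>y\<close> of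
  \<open>w\<close> normal to the fiber would satisfy \<open>D y = k y\<close> with
  \<open>k \<noteq> 0\<close>. The map \<open>p + (- 1 / k) V p\<close> preserves \<open>V\<close>,
  but its derivative at \<open>q\<close> kills \<open>y\<close>, so \<open>D y\<close> would be
  0.\<close>

lemma nondeg_definite:
  assumes V: "V \<in> nondeg_fibrations" and D: "(V has_derivative D) (at q)"
    and w: "w \<bullet> (V q \<times> D w) = 0"
  shows "\<exists>c. w = c *\<^sub>R V q"
proof (rule ccontr)
  assume neg: "\<not> ?thesis"
  obtain D' where D': "(V has_derivative D') (at q)" "bounded_linear D'" "D' (V q) = 0"
    "\<And>w. D' w \<bullet> V q = 0" "\<And>w. D' w = 0 \<Longrightarrow> \<exists>c. w = c *\<^sub>R V q"
    using nondeg_derivative[OF V, of q] by blast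
  have [simp]: "D' = D" using D' D has_derivative_unique by blast
  interpret D: bounded_linear D using D'(2) by simp
  define u where "u = V q"
  have uu: "u \<bullet> u = 1" using nondeg_inner_self[OF V] by (simp add: u_def)
  define y where "y = w - (w \<bullet> u) *\<^sub>R u"
  have yu: "y \<bullet> u = 0" by (simp add: y_def inner_diff_left uu)
  have y0: "y \<noteq> 0" using neg by (auto simp: y_def u_def)
  have Dy: "D y = D w" using D'(3) by (simp add: y_def u_def D.diff D.scaleR)
  have Du: "D y \<bullet> u = 0" using D'(4) by (simp add: u_def)
  have "u \<bullet> (u \<times> D w) = 0" by (simp add: dot_cross_self)
  then have yD: "y \<bullet> (u \<times> D y) = 0" using w by (simp add: y_def Dy[symmetric] inner_diff_left u_def[symmetric] Dy)
  define k where "k = (D y \<bullet> y) / (y \<bullet> y)"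
  \<comment> \<open>\<open>D y\<close> is perpendicular to \<open>u\<close>, and the hypothesis
    makes it perpendicular to \<open>u \<times> y\<close>; only the component along \<open>y\<close>
    is left.\<close>
  have "D y - k *\<^sub>R y = 0"
  proof -
    let ?e = "D y - k *\<^sub>R y"
    have eu: "?e \<bullet> u = 0" using Du yu by (simp add: inner_diff_left)
    have ey: "?e \<bullet> y = 0" using y0 by (simp add: inner_diff_left k_def)
    have en: "?e \<bullet> (u \<times> y) = 0"
    proof -
      have "D y \<bullet> (u \<times> y) = - (y \<bullet> (u \<times> D y))"
        by (simp add: cross3_simps)
      then show ?thesis using yD by (simp add: inner_diff_left dot_cross_self)
    qed
    have "((u \<times> y) \<bullet> (u \<times> y)) *\<^sub>R ?e = 0"
      unfolding cross_frame_expansion[of u y ?e] using eu ey en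
      by (simp add: triple_double_cross cross_skew[of "u \<times> y" u] inner_diff_right)
    moreover have "(u \<times> y) \<bullet> (u \<times> y) = y \<bullet> y"
      using norm_cross_dot[of u y] yu uu by (simp add: dot_square_norm inner_commute norm_eq_1 power_mult_distrib)
    ultimately show ?thesis using y0 by simp
  qed
  then have Dk: "D y = k *\<^sub>R y" by simp
  have "k \<noteq> 0"
  proof
    assume "k = 0"
    then obtain c where "y = c *\<^sub>R u" using D'(5)[of y] Dk by (auto simp: u_def)
    then show False using yu uu y0 by simp
  qed
  obtain D2 where D2: "(V has_derivative D2) (at (q + (- 1 / k) *\<^sub>R V q))"
    using nondeg_C1[OF V] by auto
  have "((\<lambda>p. V (p + (- 1 / k) *\<^sub>R V p)) has_derivative (\<lambda>w. D2 (w + (- 1 / k) *\<^sub>R D w))) (at q)"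
    by (rule has_derivative_compose[of "\<lambda>p. p + (- 1 / k) *\<^sub>R V p" _ _ _ V, OF _ D2]) (auto intro!: derivative_eq_intros D)
  then have "(V has_derivative (\<lambda>w. D2 (w + (- 1 / k) *\<^sub>R D w))) (at q)"
    by (simp only: nondeg_const[OF V])
  then have "D = (\<lambda>w. D2 (w + (- 1 / k) *\<^sub>R D w))" using D has_derivative_unique by blast
  then have "D y = D2 (y + (- 1 / k) *\<^sub>R D y)" by metis
  also have "y + (- 1 / k) *\<^sub>R D y = 0" using \<open>k \<noteq> 0\<close> by (simp add: Dk)
  also have "D2 0 = 0"
    using has_derivative_bounded_linear[OF D2] linear_simps(3) by blast
  finally show False using Dk \<open>k \<noteq> 0\<close> y0 by simp
qed

text \<open>Adding the projection onto \<open>V z\<close> to the derivative gives an injective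
  linear map, hence one bounded below. On the plane normal to \<open>V z\<close> it agrees with the
  derivative, which therefore dominates the remainder.\<close>

lemma nondeg_locally_injective:
  assumes V: "V \<in> nondeg_fibrations"
  obtains r where "0 < r" "\<And>p. (p - z) \<bullet> V z = 0 \<Longrightarrow> p \<noteq> z \<Longrightarrow> norm (p - z) < r \<Longrightarrow> V p \<noteq> V z"
proof -
  obtain D where D: "(V has_derivative D) (at z)" "bounded_linear D" "D (V z) = 0"
    "\<And>w. D w \<bullet> V z = 0" "\<And>w. D w = 0 \<Longrightarrow> \<exists>c. w = c *\<^sub>R V z"
    using nondeg_derivative[OF V, of z] by blast
  interpret D: bounded_linear D by fact
  define L where "L w = D w + (w \<bullet> V z) *\<^sub>R V z" for w
  have "linear L"
    by (auto simp: L_def D.add D.scaleR algebra_simps inner_add intro!: linearI)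
  moreover have "inj L"
  proof -
    have "w = 0" if "L w = 0" for w
    proof -
      have "L w \<bullet> V z = w \<bullet> V z"
        using D(4) by (simp add: L_def inner_add_left nondeg_inner_self[OF V])
      then have "w \<bullet> V z = 0" using that by simp
      moreover from this have "D w = 0" using that by (simp add: L_def)
      ultimately show ?thesis using D(5)[of w] nondeg_inner_self[OF V] by auto
    qed
    then show ?thesis using \<open>linear L\<close> linear_injective_0 by blast
  qed
  ultimately obtain B where B: "B > 0" "\<And>x. B * norm x \<le> norm (L x)"
    using linear_inj_bounded_below_pos[of L] by blast
  obtain r where r: "r > 0" "\<And>p. norm (p - z) < r \<Longrightarrow> norm (V p - V z - D (p - z)) \<le> B / 2 * norm (p - z)"
    using D(1) B(1) unfolding has_derivative_at_alt by (meson half_gt_zero)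
  have "V p \<noteq> V z" if "(p - z) \<bullet> V z = 0" "p \<noteq> z" "norm (p - z) < r" for p
  proof
    assume "V p = V z"
    then have "norm (D (p - z)) \<le> B / 2 * norm (p - z)" using r(2)[OF that(3)] by simp
    moreover have "B * norm (p - z) \<le> norm (D (p - z))"
      using B(2)[of "p - z"] that(1) by (simp add: L_def)
    moreover have "B / 2 * norm (p - z) < B * norm (p - z)" using B(1) that(2) by simp
    ultimately show False by linarith
  qed
  then show ?thesis using that r(1) by blast
qed

text \<open>A vanishing determinant makes the two lines coplanar. If their directions were
  independent, the lines would meet, and \<open>V\<close> would take both values at the common
  point.\<close>

lemma coplanar_imp_parallel:
  assumes V: "V \<in> nondeg_fibrations" and 0: "(q - q') \<bullet> (V q \<times> V q') = 0"
  shows "V q = V q' \<or> V q = - V q'"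
proof (cases "V q \<times> V q' = 0")
  case True
  then show ?thesis using unit_parallel nondeg_unit[OF V] by blast
next
  case False
  let ?n = "(V q \<times> V q') \<bullet> (V q \<times> V q')"
  obtain a b where ab: "?n *\<^sub>R (q - q') = a *\<^sub>R V q + b *\<^sub>R V q'"
    unfolding cross_frame_expansion[of "V q" "V q'" "q - q'"] using 0 by auto
  have "q - q' = inverse ?n *\<^sub>R (?n *\<^sub>R (q - q'))" using False by simp
  also have "\<dots> = (inverse ?n * a) *\<^sub>R V q + (inverse ?n * b) *\<^sub>R V q'"
    unfolding ab by (simp add: scaleR_add_right)
  finally have "q + (- (inverse ?n * a)) *\<^sub>R V q = q' + (inverse ?n * b) *\<^sub>R V q'"
    by (simp add: algebra_simps)
  then show ?thesis using nondeg_const[OF V] by metis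
qed

text \<open>If a fiber were (anti)parallel to the fiber through \<open>q\<close>, the determinant
  \<open>\<lambda>p. (p - q) \<bullet> (V p \<times> V q)\<close> would change sign across it, hence vanish at a second point of
  every small circle around it; but its zeros are parallel fibers, which are isolated.\<close>
lemma parallel_imp_same_fiber:
  assumes V: "V \<in> nondeg_fibrations" and par: "V z = V q \<or> V z = - V q"
  shows "(z - q) \<times> V q = 0"
proof (rule ccontr)
  assume ne: "\<not> ?thesis"
  define u where "u = V q"
  have uu: "u \<bullet> u = 1" using nondeg_inner_self[OF V] by (simp add: u_def)
  \<comment> \<open>The foot of the perpendicular from \<open>q\<close> to the fiber through
    \<open>z\<close>.\<close>
  define z' where "z' = z - ((z - q) \<bullet> u) *\<^sub>R u"
  obtain s where s: "s = 1 \<or> s = -1" "V z = s *\<^sub>R u" using par by (force simp: u_def)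
  have "z' = z + (- (s * ((z - q) \<bullet> u))) *\<^sub>R V z" using s by (auto simp: z'_def)
  then have Vz': "V z' = s *\<^sub>R u" using nondeg_const[OF V] s by metis
  define y where "y = z' - q"
  have yu: "y \<bullet> u = 0" by (simp add: y_def z'_def inner_diff_left uu)
  have y0: "y \<noteq> 0"
  proof
    assume "y = 0"
    then have "z - q = ((z - q) \<bullet> u) *\<^sub>R u" by (simp add: y_def z'_def algebra_simps)
    then have "(z - q) \<times> u = ((z - q) \<bullet> u) *\<^sub>R (u \<times> u)" by (metis cross_mult_left)
    then show False using ne by (simp add: u_def)
  qed
  obtain D where D: "(V has_derivative D) (at z')" using nondeg_C1[OF V] by auto
  have "y \<bullet> (V z' \<times> D y) \<noteq> 0"
  proof
    assume "y \<bullet> (V z' \<times> D y) = 0"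
    then obtain c where "y = c *\<^sub>R (s *\<^sub>R u)" using nondeg_definite[OF V D] Vz' by metis
    then show False using yu y0 uu s by auto
  qed
  moreover define d where "d = y \<bullet> (D y \<times> u)"
  ultimately have d0: "d \<noteq> 0"
    using s by (auto simp: Vz' cross_mult_left cross_skew[of u])
  \<comment> \<open>The factor \<open>d\<close> normalizes the sign: in the radial direction
    \<open>y\<close> the derivative of \<open>g\<close> at \<open>z'\<close> becomes
    \<open>d * d\<close>, which is positive.\<close>
  define g where "g p = d * ((p - q) \<bullet> (V p \<times> u))" for p
  have gc: "continuous_on UNIV g" unfolding g_def
    by (intro continuous_intros continuous_on_cross nondeg_continuous V)
  have g0: "g z' = 0" by (simp add: g_def Vz' cross_mult_left)
  have Vc: "((\<lambda>h. V (z' + h *\<^sub>R y)) has_derivative (\<lambda>h. D (h *\<^sub>R y))) (at 0)"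
    by (rule has_derivative_compose[of "\<lambda>h. z' + h *\<^sub>R y" "\<lambda>h. h *\<^sub>R y"])
      (use D in \<open>auto intro!: derivative_eq_intros\<close>)
  interpret D: bounded_linear D using D has_derivative_bounded_linear by blast
  have bl: "bounded_linear (\<lambda>x. y \<bullet> (x \<times> u))"
    unfolding linear_conv_bounded_linear[symmetric]
    by (intro linearI) (simp_all add: cross_add_left cross_mult_left inner_add_right)
  have "((\<lambda>h. (1 + h) * (y \<bullet> (V (z' + h *\<^sub>R y) \<times> u))) has_derivative
      (\<lambda>h. (1 + 0) * (y \<bullet> (D (h *\<^sub>R y) \<times> u)) + h * (y \<bullet> (V (z' + 0 *\<^sub>R y) \<times> u)))) (at 0)"
    by (intro has_derivative_mult bounded_linear.has_derivative[OF bl Vc])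
      (auto intro!: derivative_eq_intros)
  moreover have "(1 + h) * (y \<bullet> (V (z' + h *\<^sub>R y) \<times> u)) = (z' + h *\<^sub>R y - q) \<bullet> (V (z' + h *\<^sub>R y) \<times> u)" for h
    by (simp add: y_def algebra_simps inner_add_left inner_diff_left)
  moreover have "(1 + 0) * (y \<bullet> (D (h *\<^sub>R y) \<times> u)) + h * (y \<bullet> (V (z' + 0 *\<^sub>R y) \<times> u)) = h * d" for h
    by (simp add: Vz' cross_mult_left d_def D.scaleR)
  ultimately have "((\<lambda>h. (z' + h *\<^sub>R y - q) \<bullet> (V (z' + h *\<^sub>R y) \<times> u)) has_derivative (\<lambda>h. h * d)) (at 0)"
    by simp
  then have "((\<lambda>h. g (z' + h *\<^sub>R y)) has_derivative (\<lambda>h. d * (h * d))) (at 0)"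
    unfolding g_def by (rule has_derivative_mult_right)
  then have der: "((\<lambda>h. g (z' + h *\<^sub>R y)) has_real_derivative d * d) (at 0)"
    unfolding has_field_derivative_def by (rule has_derivative_eq_rhs) auto
  have dd: "0 < d * d" using d0 by (simp add: zero_less_mult_iff) (metis linorder_neqE_linordered_idom)
  obtain e1 where e1: "e1 > 0" "\<And>h. 0 < h \<Longrightarrow> h < e1 \<Longrightarrow> 0 < g (z' + h *\<^sub>R y)"
    using has_real_derivative_pos_inc_right[OF der dd] g0 by auto
  obtain e2 where e2: "e2 > 0" "\<And>h. 0 < h \<Longrightarrow> h < e2 \<Longrightarrow> g (z' + (- h) *\<^sub>R y) < 0"
    using has_real_derivative_pos_inc_left[OF der dd] g0 by auto
  obtain r where r: "0 < r" "\<And>p. (p - z') \<bullet> V z' = 0 \<Longrightarrow> p \<noteq> z' \<Longrightarrow> norm (p - z') < r \<Longrightarrow> V p \<noteq> V z'"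
    using nondeg_locally_injective[OF V, of z'] by blast
  obtain r2 where r2: "0 < r2" "\<And>p. dist p z' < r2 \<Longrightarrow> dist (V p) (V z') < 1"
    using nondeg_continuous[OF V, of UNIV] unfolding continuous_on_iff by (metis UNIV_I zero_less_one)
  \<comment> \<open>The circle must be small enough to see the sign change at both of its points on
    the radial line, to stay where \<open>V\<close> differs from \<open>V z'\<close> on the normal
    plane, and to stay where \<open>V\<close> is far from \<open>- V z'\<close>.\<close>
  have "0 < min (min e1 e2) (min (r / norm y) (r2 / norm y))"
    using e1(1) e2(1) r(1) r2(1) y0 by simp
  then obtain t where "0 < t" "t < min (min e1 e2) (min (r / norm y) (r2 / norm y))"
    using dense by blast
  then have t: "0 < t" "t < e1" "t < e2" "t * norm y < r" "t * norm y < r2"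
    using y0 by (auto simp: field_simps)
  define c where "c \<theta> = z' + t *\<^sub>R (cos \<theta> *\<^sub>R y + sin \<theta> *\<^sub>R (u \<times> y))" for \<theta>
  have "\<exists>\<theta>. 0 \<le> \<theta> \<and> \<theta> \<le> pi \<and> g (c \<theta>) = 0"
  proof (rule IVT2')
    show "g (c pi) \<le> 0" "0 \<le> g (c 0)"
      using e1(2)[OF t(1,2)] e2(2)[OF t(1,3)] by (simp_all add: c_def)
    show "continuous_on {0..pi} (\<lambda>\<theta>. g (c \<theta>))"
      unfolding c_def
      by (intro continuous_on_compose2[OF gc] continuous_intros) auto
  qed auto
  then obtain \<theta> where \<theta>: "g (c \<theta>) = 0" by blast
  have cz: "norm (c \<theta> - z') = t * norm y"
  proof -
    have n1: "y \<bullet> (u \<times> y) = 0" by (simp add: dot_cross_self)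
    have n2: "(u \<times> y) \<bullet> (u \<times> y) = y \<bullet> y"
      using norm_cross_dot[of u y] yu uu by (simp add: dot_square_norm inner_commute norm_eq_1 power_mult_distrib)
    let ?v = "cos \<theta> *\<^sub>R y + sin \<theta> *\<^sub>R (u \<times> y)"
    have "?v \<bullet> ?v = ((cos \<theta>)\<^sup>2 + (sin \<theta>)\<^sup>2) * (y \<bullet> y)"
      by (simp add: inner_add n1 n2 inner_commute[of "u \<times> y" y] power2_eq_square distrib_right mult.assoc
          del: sin_cos_squared_add sin_cos_squared_add2 sin_cos_squared_add3)
    then have "norm ?v = norm y" by (simp add: norm_eq)
    then show ?thesis using t(1) by (simp add: c_def)
  qed
  have "(c \<theta> - q) \<bullet> (V (c \<theta>) \<times> V q) = 0" using \<theta> d0 by (simp add: g_def u_def)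
  then have "V (c \<theta>) = V q \<or> V (c \<theta>) = - V q" by (rule coplanar_imp_parallel[OF V])
  then have "V (c \<theta>) = V z' \<or> V (c \<theta>) = - V z'" using s(1) Vz' by (auto simp: u_def)
  moreover have "V (c \<theta>) \<noteq> - V z'"
  proof
    assume "V (c \<theta>) = - V z'"
    then have "dist (V (c \<theta>)) (V z') = norm (- (2 *\<^sub>R V z'))"
      unfolding dist_norm scaleR_2 by simp
    also have "\<dots> = 2" using nondeg_unit[OF V] by simp
    finally show False using r2(2)[of "c \<theta>"] cz t(5) by (simp add: dist_norm)
  qed
  ultimately have "V (c \<theta>) = V z'" by blast
  moreover have "(c \<theta> - z') \<bullet> V z' = 0"
    using yu by (simp add: c_def Vz' inner_add_left dot_cross_self inner_commute[of "u \<times> y"])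
  moreover have "c \<theta> \<noteq> z'" using cz t(1) y0 by auto
  ultimately show False using r(2)[of "c \<theta>"] cz t(4) by simp
qed

section \<open>Skewness and handedness of distinct fibers\<close>

lemma nondeg_skew:
  assumes V: "V \<in> nondeg_fibrations" and "(q - q') \<bullet> (V q \<times> V q') = 0"
  shows "\<exists>t. q = q' + t *\<^sub>R V q'"
proof -
  have "(q - q') \<times> V q' = 0"
    using coplanar_imp_parallel[OF assms] parallel_imp_same_fiber[OF V] by blast
  from parallel_imp_multiple[OF nondeg_unit[OF V] this]
  have "q = q' + ((q - q') \<bullet> V q') *\<^sub>R V q'" by (simp add: algebra_simps)
  then show ?thesis by blast
qed

lemma same_fiber_sym:
  assumes V: "V \<in> nondeg_fibrations" and "q = q' + t *\<^sub>R V q'"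
  shows "V q = V q'" "q' = q + (- t) *\<^sub>R V q"
  using nondeg_const[OF V, of q' t] assms(2) by auto

text \<open>The determinant against the fiber through \<open>q\<close> vanishes only on that fiber,
  and the complement of a line is connected. \<open>Y\<close> is an affine function vanishing
  exactly on the fiber, so a straight segment serves as a path unless its image under
  \<open>Y\<close> passes through 0.\<close>

lemma nondeg_sign_fixed_fiber:
  assumes V: "V \<in> nondeg_fibrations"
    and 1: "(q1 - q) \<bullet> (V q1 \<times> V q) \<noteq> 0" and 2: "(q2 - q) \<bullet> (V q2 \<times> V q) \<noteq> 0"
  shows "0 < ((q1 - q) \<bullet> (V q1 \<times> V q)) * ((q2 - q) \<bullet> (V q2 \<times> V q))"
proof -
  define g where "g p = (p - q) \<bullet> (V p \<times> V q)" for p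
  define Y where "Y p = (p - q) \<times> V q" for p
  have gc: "continuous_on UNIV g" unfolding g_def
    by (intro continuous_intros continuous_on_cross nondeg_continuous V)
  have g0: "Y p = 0" if "g p = 0" for p
    using nondeg_skew[OF V, of p q] that by (auto simp: g_def Y_def cross_mult_left)
  have Y0: "g p = 0" if "Y p = 0" for p
    using that triple_flip[of "p - q" "V p" "V q"] by (simp add: g_def Y_def)
  have seg: "0 < g a * g b" if "g a \<noteq> 0" "g b \<noteq> 0"
    and miss: "\<And>t. 0 \<le> t \<Longrightarrow> t \<le> 1 \<Longrightarrow> (1 - t) *\<^sub>R Y a + t *\<^sub>R Y b \<noteq> 0" for a b
  proof (rule ccontr)
    assume "\<not> ?thesis"
    then have neg: "g a * g b < 0" using that(1,2) by (simp add: less_le not_less)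
    define h where "h t = g a * g ((1 - t) *\<^sub>R a + t *\<^sub>R b)" for t
    have "\<exists>t. 0 \<le> t \<and> t \<le> 1 \<and> h t = 0"
    proof (rule IVT2')
      show "continuous_on {0..1} h" unfolding h_def
        by (intro continuous_intros continuous_on_compose2[OF gc]) auto
    qed (use neg that(1) in \<open>auto simp: h_def\<close>)
    then obtain t where t: "0 \<le> t" "t \<le> 1" "h t = 0" by blast
    then have gt: "g ((1 - t) *\<^sub>R a + t *\<^sub>R b) = 0" using \<open>g a \<noteq> 0\<close> by (simp add: h_def)
    have "Y ((1 - t) *\<^sub>R a + t *\<^sub>R b) = (1 - t) *\<^sub>R Y a + t *\<^sub>R Y b"
      by (simp add: Y_def flip: cross_mult_left cross_add_left) (simp add: algebra_simps)
    then show False using g0[OF gt] miss t by simp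
  qed
  have Yn: "Y p \<bullet> V q = 0" for p by (simp add: Y_def dot_cross_self)
  show ?thesis
  proof (cases "\<exists>t. 0 \<le> t \<and> t \<le> 1 \<and> (1 - t) *\<^sub>R Y q1 + t *\<^sub>R Y q2 = 0")
    case False
    then show ?thesis using seg[of q1 q2] 1 2 by (auto simp: g_def)
  next
    case True
    then obtain t where t: "0 \<le> t" "t \<le> 1" "(1 - t) *\<^sub>R Y q1 + t *\<^sub>R Y q2 = 0" by blast
    have Y1: "Y q1 \<noteq> 0" "Y q2 \<noteq> 0" using Y0 1 2 by (auto simp: g_def)
    then have t01: "t \<noteq> 0" "t \<noteq> 1" using t(3) by auto
    \<comment> \<open>A detour: \<open>Y q3\<close> is perpendicular to \<open>Y q1\<close> and to
      its negative multiple \<open>Y q2\<close>, so the segments from \<open>q1\<close> and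
      \<open>q2\<close> to \<open>q3\<close> miss the fiber.\<close>
    define q3 where "q3 = q + Y q1"
    have Y3: "Y q3 = Y q1 \<times> V q" by (simp add: q3_def Y_def)
    have o1: "Y q1 \<bullet> Y q3 = 0" by (simp add: Y3 dot_cross_self)
    have "t *\<^sub>R Y q2 = - ((1 - t) *\<^sub>R Y q1)" using t(3) by (simp add: add_eq_0_iff2)
    then have "t * (Y q2 \<bullet> Y q3) = 0"
      by (metis inner_minus_left inner_scaleR_left mult_zero_right neg_equal_0_iff_equal o1)
    then have o2: "Y q2 \<bullet> Y q3 = 0" using t01 by simp
    have Y3n: "Y q3 \<noteq> 0"
    proof
      assume "Y q3 = 0"
      then have "Y q1 = (Y q1 \<bullet> V q) *\<^sub>R V q"
        using parallel_imp_multiple[OF nondeg_unit[OF V]] Y3 by metis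
      then show False using Yn Y1 by simp
    qed
    then have g3: "g q3 \<noteq> 0" using g0 by blast
    have miss: "(1 - s) *\<^sub>R A + s *\<^sub>R Y q3 \<noteq> 0" if A: "A \<noteq> 0" "A \<bullet> Y q3 = 0" for A s
    proof
      assume "(1 - s) *\<^sub>R A + s *\<^sub>R Y q3 = 0"
      then have 0: "((1 - s) *\<^sub>R A + s *\<^sub>R Y q3) \<bullet> A = 0" "((1 - s) *\<^sub>R A + s *\<^sub>R Y q3) \<bullet> Y q3 = 0"
        by simp_all
      then have "(1 - s) * (A \<bullet> A) = 0" "s * (Y q3 \<bullet> Y q3) = 0"
        using A by (simp_all add: inner_add_left inner_commute[of "Y q3" A])
      then show False using A Y3n by simp
    qed
    have "0 < g q1 * g q3" "0 < g q2 * g q3"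
      using seg[of q1 q3] seg[of q2 q3] miss Y1 o1 o2 g3 1 2 by (auto simp: g_def)
    then show ?thesis by (auto simp: g_def zero_less_mult_iff)
  qed
qed

text \<open>The determinant is symmetric in the two fibers, so constancy of the sign with one fiber
  fixed propagates: from the pair \<open>q, q'\<close> to \<open>p0, q'\<close> and on to
  \<open>p1, p0\<close>. If \<open>p0\<close> lies on the fiber of \<open>q'\<close>, the chain
  passes through \<open>p1\<close> instead.\<close>

lemma nondeg_handed:
  assumes V: "V \<in> nondeg_fibrations"
  obtains \<epsilon> :: real where "\<epsilon> = 1 \<or> \<epsilon> = -1" "\<And>q q'. 0 \<le> \<epsilon> * ((q - q') \<bullet> (V q \<times> V q'))"
proof -
  define g where "g q q' = (q - q') \<bullet> (V q \<times> V q')" for q q'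
  have sym: "g q q' = g q' q" for q q' unfolding g_def by (rule triple_swap)
  have fixq: "0 < g a q * g b q" if "g a q \<noteq> 0" "g b q \<noteq> 0" for a b q
    using nondeg_sign_fixed_fiber[OF V] that by (simp add: g_def)
  define p0 :: "real^3" where "p0 = 0"
  have "V p0 \<noteq> 0" using nondeg_unit[OF V, of p0] by auto
  then obtain e where e: "e \<times> V p0 \<noteq> 0" using exists_nonparallel by blast
  define p1 where "p1 = p0 + e"
  have p01: "g p1 p0 \<noteq> 0"
  proof
    assume "g p1 p0 = 0"
    then obtain t where "p1 = p0 + t *\<^sub>R V p0" using nondeg_skew[OF V, of p1 p0] unfolding g_def by blast
    then have "e = t *\<^sub>R V p0" by (simp add: p1_def)
    then show False using e by (simp add: cross_mult_left)
  qed
  define \<epsilon> where "\<epsilon> = sgn (g p1 p0)"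
  have "0 \<le> \<epsilon> * g q q'" for q q'
  proof (cases "g q q' = 0")
    case False
    have pos: "0 < g q q' * g p1 p0"
    proof (cases "g p0 q' = 0")
      case False
      have "0 < g q q' * g p0 q'" by (rule fixq[OF \<open>g q q' \<noteq> 0\<close> False])
      moreover have "0 < g q' p0 * g p1 p0"
        by (rule fixq[OF _ p01]) (use False sym[of q' p0] in simp)
      ultimately have "0 < g q q' * g p0 q'" "0 < g q' p0 * g p1 p0" by auto
      then show ?thesis unfolding sym[of q' p0] zero_less_mult_iff by linarith
    next
      case True
      then obtain t where t: "p0 = q' + t *\<^sub>R V q'" using nondeg_skew[OF V, of p0 q'] unfolding g_def by blast
      have "g p1 q' \<noteq> 0"
      proof
        assume "g p1 q' = 0"
        then obtain s where s: "p1 = q' + s *\<^sub>R V q'" using nondeg_skew[OF V, of p1 q'] unfolding g_def by blast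
        have "p1 = p0 + (s - t) *\<^sub>R V p0"
          unfolding same_fiber_sym(1)[OF V t] s by (simp add: t algebra_simps)
        then show False using p01 by (simp add: g_def cross_mult_left cross_mult_right dot_cross_self)
      qed
      then have "0 < g q q' * g p1 q'" "0 < g q' p1 * g p0 p1"
        using fixq[OF \<open>g q q' \<noteq> 0\<close>, of p1] fixq[of q' p1 p0] p01 sym[of q' p1] sym[of p1 p0] by simp_all
      then show ?thesis unfolding sym[of q' p1] sym[of p1 p0] zero_less_mult_iff by linarith
    qed
    then show ?thesis by (auto simp: \<epsilon>_def zero_less_mult_iff sgn_real_def)
  qed simp
  moreover have "\<epsilon> = 1 \<or> \<epsilon> = -1" using p01 by (auto simp: \<epsilon>_def sgn_real_def)
  ultimately show ?thesis using that by (simp add: g_def)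
qed

section \<open>The nonexpansive map of a fibration\<close>

text \<open>For the two signs these are the self-dual and anti-self-dual halves of the Pluecker
  coordinates \<open>(V q, q \<times> V q)\<close>. The point enters only through the moment, so it
  may be moved along the line.\<close>

definition ray :: "real \<Rightarrow> (real^3 \<Rightarrow> real^3) \<Rightarrow> real^3 \<Rightarrow> real^3" where
  "ray \<epsilon> V q = V q + \<epsilon> *\<^sub>R (q \<times> V q)"

definition ray_cone :: "real \<Rightarrow> (real^3 \<Rightarrow> real^3) \<Rightarrow> (real^3) set" where
  "ray_cone \<epsilon> V = {c *\<^sub>R ray (- \<epsilon>) V q | c q. 0 < c}"

text \<open>The values on the cone tend to \<open>- x\<close> at its boundary, so the extension by \<open>- x\<close> is continuous.\<close>
definition cone_map :: "real \<Rightarrow> (real^3 \<Rightarrow> real^3) \<Rightarrow> real^3 \<Rightarrow> real^3" where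
  "cone_map \<epsilon> V x = (if x \<in> ray_cone \<epsilon> V
     then (SOME y. \<exists>c q. 0 < c \<and> x = c *\<^sub>R ray (- \<epsilon>) V q \<and> y = c *\<^sub>R ray \<epsilon> V q) else - x)"

text \<open>For a norm-preserving map, not decreasing inner products is the same as not increasing
  distances. The inner product form is linear in each value of \<open>G\<close> and can therefore be
  averaged.\<close>

definition conic_nonexpansive :: "('a::real_inner \<Rightarrow> 'a) \<Rightarrow> bool" where
  "conic_nonexpansive G \<longleftrightarrow> (\<forall>x. norm (G x) = norm x) \<and> (\<forall>x y. x \<bullet> y \<le> G x \<bullet> G y)
     \<and> (\<forall>c x. 0 \<le> c \<longrightarrow> G (c *\<^sub>R x) = c *\<^sub>R G x)"

text \<open>The fibers of \<open>V\<close> are exactly the oriented lines lying on the graph of \<open>G\<close>.\<close>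
definition fibers_of :: "real \<Rightarrow> (real^3 \<Rightarrow> real^3) \<Rightarrow> (real^3 \<Rightarrow> real^3) \<Rightarrow> bool" where
  "fibers_of \<epsilon> G V \<longleftrightarrow> (\<forall>q u. norm u = 1 \<longrightarrow>
     (u + \<epsilon> *\<^sub>R (q \<times> u) = G (u - \<epsilon> *\<^sub>R (q \<times> u)) \<longleftrightarrow> u = V q)) \<and> (\<forall>q. norm (V q) = 1)"

text \<open>Products of two directions and of two moments cancel; the mixed ones add up to the
  determinant of the two lines. Thus handedness is exactly the inner product inequality between the
  two halves.\<close>

lemma ray_inner_diff:
  "ray \<epsilon> V q \<bullet> ray \<epsilon> V q' - ray (- \<epsilon>) V q \<bullet> ray (- \<epsilon>) V q' = 2 * (\<epsilon> * ((q - q') \<bullet> (V q \<times> V q')))"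
proof -
  have "V q \<bullet> (q' \<times> V q') = - (q' \<bullet> (V q \<times> V q'))" by (rule triple_flip)
  moreover have "(q \<times> V q) \<bullet> V q' = q \<bullet> (V q \<times> V q')"
    by (simp add: cross3_simps)
  ultimately show ?thesis
    by (simp add: ray_def inner_add_left inner_add_right inner_diff_left algebra_simps)
qed

lemma conic_nonexpansiveD:
  assumes "conic_nonexpansive G"
  shows "norm (G x) = norm x" "x \<bullet> y \<le> G x \<bullet> G y" "0 \<le> c \<Longrightarrow> G (c *\<^sub>R x) = c *\<^sub>R G x"
  using assms by (auto simp: conic_nonexpansive_def)

lemma conic_nonexpansive_lipschitz:
  assumes "conic_nonexpansive G" shows "norm (G x - G y) \<le> norm (x - y)"
proof -
  have "(norm (G x - G y))\<^sup>2 \<le> (norm (x - y))\<^sup>2"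
    using conic_nonexpansiveD(2)[OF assms, of x y]
    unfolding dot_norm_neg conic_nonexpansiveD(1)[OF assms] by simp
  then show ?thesis using power2_le_imp_le norm_ge_zero by blast
qed

lemma conic_nonexpansive_continuous:
  assumes "conic_nonexpansive G" shows "continuous_on S G"
  unfolding continuous_on_iff dist_norm
  using conic_nonexpansive_lipschitz[OF assms] by (meson le_less_trans)

section \<open>The cone of a handed fibration and the map on it\<close>

locale handed_fibration =
  fixes V :: "real^3 \<Rightarrow> real^3" and \<epsilon> :: real
  assumes V: "V \<in> nondeg_fibrations" and eps: "\<epsilon> = 1 \<or> \<epsilon> = -1"
    and handed: "\<And>q q'. 0 \<le> \<epsilon> * ((q - q') \<bullet> (V q \<times> V q'))"
begin

abbreviation "C \<equiv> ray_cone \<epsilon> V"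
abbreviation "G \<equiv> cone_map \<epsilon> V"

lemma eps2 [simp]: "\<epsilon> * \<epsilon> = 1" using eps by auto

lemma ray_self: "ray \<epsilon> V q \<bullet> ray \<epsilon> V q = 1 + (norm (q \<times> V q))\<^sup>2"
  "ray (- \<epsilon>) V q \<bullet> ray (- \<epsilon>) V q = 1 + (norm (q \<times> V q))\<^sup>2"
  using eps by (auto simp: ray_def inner_add inner_diff dot_cross_self nondeg_inner_self[OF V]
      power2_norm_eq_inner)

lemma norm_ray_eq: "norm (ray (- \<epsilon>) V q) = norm (ray \<epsilon> V q)"
  by (simp add: norm_eq ray_self)

lemma norm_ray_ge: "1 \<le> norm (ray (- \<epsilon>) V q)"
proof -
  have "1\<^sup>2 \<le> (norm (ray (- \<epsilon>) V q))\<^sup>2"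
    unfolding power2_norm_eq_inner ray_self by simp
  then show ?thesis using power2_le_imp_le norm_ge_zero by blast
qed

lemma ray_fiber: "ray e V (q + t *\<^sub>R V q) = ray e V q"
  by (simp add: ray_def nondeg_const[OF V] cross_add_left cross_mult_left)

lemma ray_inner_le: "ray (- \<epsilon>) V q \<bullet> ray (- \<epsilon>) V q' \<le> ray \<epsilon> V q \<bullet> ray \<epsilon> V q'"
  using ray_inner_diff[of \<epsilon> V q q'] handed[of q q'] by linarith

text \<open>The two halves of a line have equal norms, so for proportional vectors Cauchy-Schwarz
  gives the inequality opposite to handedness, and the determinant vanishes. This makes the choice
  in \<open>cone_map\<close> immaterial.\<close>

lemma same_ray:
  assumes "a *\<^sub>R ray (- \<epsilon>) V q = b *\<^sub>R ray (- \<epsilon>) V q'" "0 < a" "0 < b"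
  shows "\<exists>t. q = q' + t *\<^sub>R V q'"
proof (rule nondeg_skew[OF V])
  let ?b = "ray (- \<epsilon>) V q" and ?b' = "ray (- \<epsilon>) V q'"
  have "(1 / a) *\<^sub>R (a *\<^sub>R ?b) = (1 / a) *\<^sub>R (b *\<^sub>R ?b')" using assms(1) by simp
  then have e: "?b = (b / a) *\<^sub>R ?b'" using assms(2) by simp
  have "ray \<epsilon> V q \<bullet> ray \<epsilon> V q' \<le> norm ?b * norm ?b'"
    unfolding norm_ray_eq by (rule norm_cauchy_schwarz)
  also have "\<dots> = ?b \<bullet> ?b'"
    using assms by (simp add: e dot_square_norm power2_eq_square)
  finally have "\<epsilon> * ((q - q') \<bullet> (V q \<times> V q')) \<le> 0"
    using ray_inner_diff[of \<epsilon> V q q'] by linarith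
  then show "(q - q') \<bullet> (V q \<times> V q') = 0" using handed[of q q'] eps by auto
qed

text \<open>The representative is the point of the fiber closest to the origin, which ties the norm
  of the ray to the distance of the fiber.\<close>

lemma coneE:
  assumes "x \<in> C"
  obtains c q where "0 < c" "x = c *\<^sub>R ray (- \<epsilon>) V q" "q \<bullet> V q = 0"
proof -
  obtain c q where cq: "0 < c" "x = c *\<^sub>R ray (- \<epsilon>) V q" using assms by (auto simp: ray_cone_def)
  let ?q = "q + (- (q \<bullet> V q)) *\<^sub>R V q"
  have "V ?q = V q" by (rule nondeg_const[OF V])
  then have "?q \<bullet> V ?q = 0" by (simp add: inner_add_left inner_diff_left nondeg_inner_self[OF V])
  moreover have "x = c *\<^sub>R ray (- \<epsilon>) V ?q" using cq ray_fiber by metis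
  ultimately show ?thesis using that cq(1) by blast
qed

lemma cone_scale: "x \<in> C \<Longrightarrow> 0 < c \<Longrightarrow> c *\<^sub>R x \<in> C"
  unfolding ray_cone_def by (auto, metis mult_pos_pos scaleR_scaleR)

lemma cone_scale_iff: "0 < c \<Longrightarrow> c *\<^sub>R x \<in> C \<longleftrightarrow> x \<in> C"
  using cone_scale[of "c *\<^sub>R x" "1 / c"] cone_scale[of x c] by auto

lemma zero_notin_cone: "0 \<notin> C"
proof
  assume "0 \<in> C"
  then obtain c q where cq: "0 < c" "0 = c *\<^sub>R ray (- \<epsilon>) V q" by (rule coneE)
  then have "ray (- \<epsilon>) V q = 0" by simp
  then show False using norm_ray_ge[of q] by simp
qed

lemma ray_in_cone: "0 < c \<Longrightarrow> c *\<^sub>R ray (- \<epsilon>) V q \<in> C"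
  by (auto simp: ray_cone_def)

lemma G_ray:
  assumes "0 < c" shows "G (c *\<^sub>R ray (- \<epsilon>) V q) = c *\<^sub>R ray \<epsilon> V q"
proof -
  let ?x = "c *\<^sub>R ray (- \<epsilon>) V q"
  have "\<exists>y d p. 0 < d \<and> ?x = d *\<^sub>R ray (- \<epsilon>) V p \<and> y = d *\<^sub>R ray \<epsilon> V p" using assms by blast
  from someI_ex[OF this] ray_in_cone[OF assms, of q]
  obtain d p where dp: "0 < d" "?x = d *\<^sub>R ray (- \<epsilon>) V p" "G ?x = d *\<^sub>R ray \<epsilon> V p"
    unfolding cone_map_def by auto
  obtain t where t: "q = p + t *\<^sub>R V p" using same_ray[OF dp(2) assms dp(1)] by blast
  have same: "ray e V q = ray e V p" for e unfolding t by (rule ray_fiber)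
  have "c *\<^sub>R ray (- \<epsilon>) V p = d *\<^sub>R ray (- \<epsilon>) V p" using dp(2) same by simp
  moreover have "ray (- \<epsilon>) V p \<noteq> 0" using norm_ray_ge[of p] by auto
  ultimately have "c = d" by simp
  then show ?thesis using dp(3) same by simp
qed

lemma G_outside: "x \<notin> C \<Longrightarrow> G x = - x"
  by (simp add: cone_map_def)

lemma norm_G: "norm (G x) = norm x"
proof (cases "x \<in> C")
  case True
  then obtain c q where cq: "0 < c" "x = c *\<^sub>R ray (- \<epsilon>) V q" by (rule coneE)
  show ?thesis unfolding cq(2) G_ray[OF cq(1)] by (simp add: norm_ray_eq)
qed (simp add: G_outside)

lemma G_scale:
  assumes "0 \<le> a" shows "G (a *\<^sub>R x) = a *\<^sub>R G x"
proof (cases "a = 0")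
  case True
  then show ?thesis using norm_G[of 0] by simp
next
  case False
  then have a: "0 < a" using assms by simp
  show ?thesis
  proof (cases "x \<in> C")
    case True
    then obtain c q where cq: "0 < c" "x = c *\<^sub>R ray (- \<epsilon>) V q" by (rule coneE)
    show ?thesis using G_ray[of "a * c" q] G_ray[of c q] a cq by simp
  next
    case F: False
    then have "a *\<^sub>R x \<notin> C" using cone_scale_iff[OF a] by blast
    then show ?thesis using F by (simp add: G_outside)
  qed
qed

lemma G_inner_le_cone:
  assumes "x \<in> C" "y \<in> C" shows "x \<bullet> y \<le> G x \<bullet> G y"
proof -
  obtain c q where cq: "0 < c" "x = c *\<^sub>R ray (- \<epsilon>) V q" using assms(1) by (rule coneE)
  obtain d p where dp: "0 < d" "y = d *\<^sub>R ray (- \<epsilon>) V p" using assms(2) by (rule coneE)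
  have "c * d * (ray (- \<epsilon>) V q \<bullet> ray (- \<epsilon>) V p) \<le> c * d * (ray \<epsilon> V q \<bullet> ray \<epsilon> V p)"
    using cq(1) dp(1) ray_inner_le by (intro mult_left_mono) auto
  then show ?thesis unfolding cq(2) dp(2) G_ray[OF cq(1)] G_ray[OF dp(1)]
    by (simp add: mult.assoc mult.left_commute[of d c])
qed

text \<open>Equality means a vanishing determinant, which happens only within a single
  fiber.\<close>

lemma G_inner_eq_cone:
  assumes "x \<in> C" "y \<in> C" and eq: "x \<bullet> y = G x \<bullet> G y"
  shows "\<exists>c>0. x = c *\<^sub>R y"
proof -
  obtain c q where cq: "0 < c" "x = c *\<^sub>R ray (- \<epsilon>) V q" using assms(1) by (rule coneE)
  obtain d p where dp: "0 < d" "y = d *\<^sub>R ray (- \<epsilon>) V p" using assms(2) by (rule coneE)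
  have "ray (- \<epsilon>) V q \<bullet> ray (- \<epsilon>) V p = ray \<epsilon> V q \<bullet> ray \<epsilon> V p"
    using eq cq(1) dp(1) unfolding cq(2) dp(2) G_ray[OF cq(1)] G_ray[OF dp(1)] by simp
  then have "(q - p) \<bullet> (V q \<times> V p) = 0" using ray_inner_diff[of \<epsilon> V q p] eps by auto
  then obtain t where t: "q = p + t *\<^sub>R V p" using nondeg_skew[OF V] by blast
  have "ray (- \<epsilon>) V q = ray (- \<epsilon>) V p" unfolding t by (rule ray_fiber)
  then have "x = (c / d) *\<^sub>R y" using dp cq by simp
  moreover have "0 < c / d" using cq(1) dp(1) by simp
  ultimately show ?thesis by blast
qed

text \<open>Near a given ray the cone has three continuous coordinates: the point where the fiber
  crosses a plane normal to \<open>u\<close>, and a scale. They determine the vector injectively, so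
  invariance of domain applies.\<close>

lemma open_cone: "open C"
  unfolding open_contains_ball
proof
  fix x assume "x \<in> C"
  then obtain c q0 where cq: "0 < c" "x = c *\<^sub>R ray (- \<epsilon>) V q0" by (rule coneE)
  define u where "u = V q0"
  have uu: "u \<bullet> u = 1" using nondeg_inner_self[OF V] by (simp add: u_def)
  define Q where "Q p = q0 + (p - (p \<bullet> u) *\<^sub>R u)" for p
  have Qc: "continuous_on UNIV Q" unfolding Q_def by (intro continuous_intros)
  \<comment> \<open>Here the fibers cross the plane transversally, so each meets it only
    once.\<close>
  define S where "S = {p. 0 < V (Q p) \<bullet> u}"
  \<comment> \<open>The coordinate of \<open>p\<close> along \<open>u\<close>, which
    \<open>Q\<close> forgets, acts as the logarithm of the scale.\<close>
  define \<Psi> where "\<Psi> p = (c * exp (p \<bullet> u)) *\<^sub>R ray (- \<epsilon>) V (Q p)" for p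
  have VQ: "continuous_on UNIV (\<lambda>p. V (Q p))"
    by (rule continuous_on_compose2[OF nondeg_continuous[OF V, of UNIV] Qc]) simp
  have "open S" unfolding S_def
    by (intro open_Collect_less continuous_intros VQ)
  moreover have "continuous_on S \<Psi>"
    unfolding \<Psi>_def ray_def
    by (intro continuous_intros continuous_on_cross continuous_on_subset[OF VQ] continuous_on_subset[OF Qc]) auto
  moreover have "inj_on \<Psi> S"
  proof (rule inj_onI)
    fix p p' assume p: "p \<in> S" "p' \<in> S" and eq: "\<Psi> p = \<Psi> p'"
    obtain t where t: "Q p = Q p' + t *\<^sub>R V (Q p')"
      using same_ray[OF eq[unfolded \<Psi>_def]] cq(1) by auto
    have Qu: "Q r \<bullet> u = q0 \<bullet> u" for r by (simp add: Q_def inner_add_left inner_diff_left uu)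
    have "t * (V (Q p') \<bullet> u) = 0"
      using arg_cong[OF t, of "\<lambda>x. x \<bullet> u"] by (simp add: Qu inner_add_left)
    then have "t = 0" using p(2) by (simp add: S_def)
    then have Qe: "Q p = Q p'" using t by simp
    have "ray (- \<epsilon>) V (Q p) \<noteq> 0" using norm_ray_ge[of "Q p"] by auto
    then have "exp (p \<bullet> u) = exp (p' \<bullet> u)" using eq cq(1) by (simp add: \<Psi>_def Qe)
    then have "p \<bullet> u = p' \<bullet> u" by simp
    then show "p = p'" using Qe by (simp add: Q_def)
  qed
  ultimately have op: "open (\<Psi> ` S)" by (intro invariance_of_domain)
  have "\<Psi> 0 = x" by (simp add: \<Psi>_def Q_def cq(2))
  moreover have "0 \<in> S" by (simp add: S_def Q_def uu flip: u_def)
  ultimately have "x \<in> \<Psi> ` S" by force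
  then obtain e where "e > 0" "ball x e \<subseteq> \<Psi> ` S" using op open_contains_ball by blast
  moreover have "\<Psi> ` S \<subseteq> C" using cq(1) by (auto simp: \<Psi>_def intro!: ray_in_cone)
  ultimately show "\<exists>e>0. ball x e \<subseteq> C" by blast
qed

text \<open>The rays at points of \<open>cball 0 R\<close> have a compact set of directions, so a
  vector of the cone close to a direction outside the cone comes from a fiber at distance more than
  \<open>R\<close>. There the moment dominates, while \<open>G y + y\<close> is only twice the
  scaled unit direction.\<close>

lemma G_near_antipodal:
  assumes x: "x \<notin> C" "x \<noteq> 0" and R: "0 < R"
  shows "\<forall>\<^sub>F y in nhds x. norm (G y + y) \<le> 2 * norm y / R"
proof -
  define K where "K = (\<lambda>q. sgn (ray (- \<epsilon>) V q)) ` cball 0 R"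
  have r0: "ray (- \<epsilon>) V q \<noteq> 0" for q using norm_ray_ge[of q] by auto
  have "continuous_on (cball 0 R) (\<lambda>q. sgn (ray (- \<epsilon>) V q))"
    unfolding ray_def sgn_div_norm divide_inverse_commute[symmetric]
    using r0[unfolded ray_def]
    by (intro continuous_intros continuous_on_cross nondeg_continuous[OF V]) auto
  then have "closed K" unfolding K_def by (intro compact_imp_closed compact_continuous_image) auto
  moreover have "sgn x \<notin> K"
  proof
    assume "sgn x \<in> K"
    then obtain q where q: "sgn x = sgn (ray (- \<epsilon>) V q)" by (auto simp: K_def)
    have "x = norm x *\<^sub>R sgn x" using x(2) by (simp add: sgn_div_norm)
    then have "x = (norm x * inverse (norm (ray (- \<epsilon>) V q))) *\<^sub>R ray (- \<epsilon>) V q"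
      unfolding q by (simp add: sgn_div_norm divide_inverse)
    moreover have "0 < norm x * inverse (norm (ray (- \<epsilon>) V q))" using x(2) r0 by simp
    ultimately show False using x(1) ray_in_cone by metis
  qed
  ultimately have "\<forall>\<^sub>F z in nhds (sgn x). z \<notin> K"
    using eventually_nhds_in_open[of "- K" "sgn x"] by auto
  moreover have "filterlim sgn (nhds (sgn x)) (nhds x)"
    by (rule tendsto_sgn[OF filterlim_ident x(2)])
  ultimately have "\<forall>\<^sub>F y in nhds x. sgn y \<notin> K" unfolding filterlim_iff by blast
  then show ?thesis
  proof (rule eventually_mono)
    fix y assume y: "sgn y \<notin> K"
    show "norm (G y + y) \<le> 2 * norm y / R"
    proof (cases "y \<in> C")
      case True
      then obtain c q where cq: "0 < c" "y = c *\<^sub>R ray (- \<epsilon>) V q" "q \<bullet> V q = 0" by (rule coneE)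
      have "sgn y = sgn (ray (- \<epsilon>) V q)" using cq by (simp add: sgn_scaleR)
      then have q: "R < norm q" using y by (force simp: K_def)
      have "(norm (q \<times> V q))\<^sup>2 = (norm q)\<^sup>2"
        using norm_cross_dot[of q "V q"] cq(3) nondeg_unit[OF V] by simp
      then have "(norm q)\<^sup>2 \<le> (norm (ray (- \<epsilon>) V q))\<^sup>2"
        using ray_self(2)[of q] by (simp add: power2_norm_eq_inner)
      then have "norm q \<le> norm (ray (- \<epsilon>) V q)" using power2_le_imp_le norm_ge_zero by blast
      then have "R \<le> norm (ray (- \<epsilon>) V q)" using q by simp
      then have "R * c \<le> norm y" using cq by simp
      have "G y + y = (2 * c) *\<^sub>R V q" unfolding cq(2) G_ray[OF cq(1)]
        by (simp add: ray_def algebra_simps flip: scaleR_2)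
      then have "norm (G y + y) = 2 * c" using cq(1) nondeg_unit[OF V] by simp
      then show ?thesis using \<open>R * c \<le> norm y\<close> R by (simp add: field_simps)
    qed (use R in \<open>simp add: G_outside\<close>)
  qed
qed

lemma G_lipschitz_cone:
  assumes "x \<in> C" "y \<in> C" shows "norm (G x - G y) \<le> norm (x - y)"
proof -
  have "(norm (G x - G y))\<^sup>2 \<le> (norm (x - y))\<^sup>2"
    using G_inner_le_cone[OF assms] unfolding dot_norm_neg norm_G by simp
  then show ?thesis using power2_le_imp_le norm_ge_zero by blast
qed

lemma isCont_G: "isCont G x"
proof (cases "x \<in> C")
  case True
  have "continuous_on C G"
    unfolding continuous_on_iff dist_norm using G_lipschitz_cone by (meson le_less_trans)
  then show ?thesis using open_cone True by (simp add: continuous_on_eq_continuous_at)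
next
  case F: False
  have "\<forall>\<^sub>F y in nhds x. dist (G y) (G x) < e" if e: "0 < e" for e
  proof (cases "x = 0")
    case True
    have G0: "G 0 = 0" using norm_G[of 0] by simp
    have "\<forall>\<^sub>F y in nhds x. dist y x < e" using e by (rule eventually_nhds_metric[THEN iffD2, OF exI, OF conjI]) auto
    then show ?thesis
      by (rule eventually_mono) (use norm_G[of 0] in \<open>simp add: True dist_norm norm_G G0\<close>)
  next
    case False
    \<comment> \<open>Makes \<open>2 * (norm x + 1) / R\<close> equal to \<open>e / 2\<close>;
      \<open>norm x + 1\<close> bounds \<open>norm y\<close> for \<open>y\<close> within distance
      1.\<close>
    define R where "R = 4 * (norm x + 1) / e"
    have R: "0 < R" using e by (simp add: R_def add_nonneg_pos)
    have "\<forall>\<^sub>F y in nhds x. dist y x < min 1 (e / 2)"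
      using e by (intro eventually_nhds_metric[THEN iffD2, OF exI[of _ "min 1 (e/2)"]]) auto
    with G_near_antipodal[OF F False R] show ?thesis
    proof eventually_elim
      case (elim y)
      have y: "norm y \<le> norm x + 1" using elim(2) norm_triangle_ineq2[of y x] by (simp add: dist_norm)
      have "dist (G y) (G x) = norm ((G y + y) - (y - x))" by (simp add: dist_norm G_outside[OF F])
      also have "\<dots> \<le> norm (G y + y) + norm (y - x)" by (rule norm_triangle_ineq4)
      also have "\<dots> < 2 * norm y / R + e / 2" using elim by (simp add: dist_norm)
      also have "2 * norm y / R \<le> 2 * (norm x + 1) / R" using y R by (simp add: divide_right_mono)
      also have "\<dots> = e / 2" using e by (simp add: R_def add_nonneg_pos divide_simps) (smt (verit) norm_ge_zero)
      finally show ?case by simp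
    qed
  qed
  then have "(G \<longlongrightarrow> G x) (nhds x)" by (simp add: tendsto_iff)
  then show ?thesis unfolding isCont_def by (rule tendsto_mono[rotated]) (simp add: at_within_def)
qed

text \<open>A segment leaving the cone is cut at its first exit point. Up to there the estimate on
  the cone passes to the limit; the exit point and the far end are both outside, where
  \<open>G\<close> is \<open>- x\<close>. The two lengths add up along the segment.\<close>

lemma G_lipschitz: "norm (G x - G y) \<le> norm (x - y)"
proof -
  have mixed: "norm (G x - G y) \<le> norm (x - y)" if x: "x \<in> C" and y: "y \<notin> C" for x y
  proof -
    define s where "s t = x + t *\<^sub>R (y - x)" for t
    have sc: "continuous_on UNIV s" unfolding s_def by (intro continuous_intros)
    have "closed (s -` (- C))" using open_cone sc by (simp add: closed_vimage closed_Compl continuous_on_eq_continuous_at)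
    then have "compact ({0..1} \<inter> s -` (- C))" by (simp add: compact_Int_closed)
    moreover have "1 \<in> {0..1} \<inter> s -` (- C)" using y by (simp add: s_def)
    ultimately obtain t0 where t0: "t0 \<in> {0..1} \<inter> s -` (- C)"
      and min: "\<And>t. t \<in> {0..1} \<inter> s -` (- C) \<Longrightarrow> t0 \<le> t"
      using compact_attains_inf[of "{0..1} \<inter> s -` (- C)"] by blast
    have "t0 \<noteq> 0" using t0 x by (auto simp: s_def)
    then have t0p: "0 < t0" "t0 \<le> 1" using t0 by auto
    have inC: "s t \<in> C" if "t \<in> {0..<t0}" for t using min[of t] that t0p by fastforce
    have "norm (G x - G (s t0)) - norm (x - s t0) \<le> 0"
    proof (rule continuous_le_on_closure[where S="{0..<t0}" and f="\<lambda>t. norm (G x - G (s t)) - norm (x - s t)"])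
      have "continuous_on UNIV G" using isCont_G by (simp add: continuous_at_imp_continuous_on)
      then have "continuous_on UNIV (\<lambda>t. G (s t))" using sc by (rule continuous_on_compose2) simp
      then have "continuous_on UNIV (\<lambda>t. norm (G x - G (s t)) - norm (x - s t))"
        using sc by (intro continuous_on_diff continuous_on_norm continuous_on_const)
      then show "continuous_on (closure {0..<t0}) (\<lambda>t. norm (G x - G (s t)) - norm (x - s t))"
        by (rule continuous_on_subset) simp
      show "t0 \<in> closure {0..<t0}" using t0p by simp
      show "norm (G x - G (s t)) - norm (x - s t) \<le> 0" if "t \<in> {0..<t0}" for t
        using G_lipschitz_cone[OF x inC[OF that]] by simp
    qed
    then have 1: "norm (G x - G (s t0)) \<le> norm (x - s t0)" by simp
    have 2: "norm (G (s t0) - G y) = norm (s t0 - y)"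
      using t0 y by (simp add: G_outside norm_minus_commute)
    have "x - s t0 = t0 *\<^sub>R (x - y)" "s t0 - y = (1 - t0) *\<^sub>R (x - y)"
      by (simp_all add: s_def algebra_simps)
    then have "norm (x - s t0) = t0 * norm (x - y)" "norm (s t0 - y) = (1 - t0) * norm (x - y)"
      using t0p by simp_all
    then have "norm (x - s t0) + norm (s t0 - y) = norm (x - y)"
      by (simp add: left_diff_distrib)
    then show ?thesis using 1 2 norm_triangle_ineq[of "G x - G (s t0)" "G (s t0) - G y"] by simp
  qed
  consider "x \<in> C" "y \<in> C" | "x \<in> C" "y \<notin> C" | "x \<notin> C" "y \<in> C" | "x \<notin> C" "y \<notin> C" by blast
  then show ?thesis
  proof cases
    case 1
    then show ?thesis by (rule G_lipschitz_cone)
  next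
    case 2
    then show ?thesis by (rule mixed)
  next
    case 3
    then show ?thesis using mixed[of y x] unfolding norm_minus_commute[of x y] norm_minus_commute[of "G x" "G y"] by blast
  next
    case 4
    then have "G x - G y = - (x - y)" by (simp add: G_outside)
    then show ?thesis unfolding norm_minus_cancel by (simp only: norm_minus_cancel order_refl)
  qed
qed

end

lemma half_sum:
  fixes a b :: "'a::real_vector"
  shows "(1/2) *\<^sub>R ((a - b) + (a + b)) = a" "(1/2) *\<^sub>R ((a + b) - (a - b)) = b"
proof -
  have "(a - b) + (a + b) = a + a" "(a + b) - (a - b) = b + b" by (simp_all add: algebra_simps)
  then show "(1/2) *\<^sub>R ((a - b) + (a + b)) = a" "(1/2) *\<^sub>R ((a + b) - (a - b)) = b"
    by (simp_all only: scaleR_half_double)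
qed

context handed_fibration begin

lemma conic_G: "conic_nonexpansive G"
proof -
  have "x \<bullet> y \<le> G x \<bullet> G y" for x y
  proof -
    have "(norm (G x - G y))\<^sup>2 \<le> (norm (x - y))\<^sup>2"
      using G_lipschitz[of x y] by (intro power_mono) auto
    then show ?thesis unfolding dot_norm_neg norm_G by (simp add: divide_right_mono)
  qed
  then show ?thesis by (simp add: conic_nonexpansive_def norm_G G_scale)
qed

text \<open>Moving \<open>y\<close> by \<open>b x\<close> inside the cone would move
  \<open>G y\<close> at least as far, which is the equality case and puts \<open>y\<close> and
  \<open>y + b x\<close> on one ray. Then every vector of the cone would be parallel to
  \<open>x\<close>, impossible for a nonempty open set. Used with \<open>x' = G x\<close> and with
  \<open>x' = - x\<close>.\<close>

lemma cone_rigid: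
  assumes x: "x \<noteq> 0" and x': "norm x' = norm x"
  shows "\<exists>y\<in>C. G y \<bullet> x' \<noteq> y \<bullet> x"
proof (rule ccontr)
  assume "\<not> ?thesis"
  then have eq: "\<And>y. y \<in> C \<Longrightarrow> G y \<bullet> x' = y \<bullet> x" by blast
  have par: "y \<times> x = 0" if y: "y \<in> C" for y
  proof -
    obtain r where r: "r > 0" "ball y r \<subseteq> C" using open_cone y open_contains_ball by blast
    define b where "b = r / (2 * norm x)"
    have b: "0 < b" using r(1) x by (simp add: b_def)
    have "y + b *\<^sub>R x \<in> ball y r" using x r(1) by (simp add: dist_norm b_def)
    then have y2: "y + b *\<^sub>R x \<in> C" using r(2) by blast
    have "(G (y + b *\<^sub>R x) - G y) \<bullet> x' = b * (x \<bullet> x)"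
      using eq[OF y] eq[OF y2] by (simp add: inner_diff_left inner_add_left)
    then have "b * (norm x)\<^sup>2 \<le> norm (G (y + b *\<^sub>R x) - G y) * norm x"
      using norm_cauchy_schwarz[of "G (y + b *\<^sub>R x) - G y" x'] x' by (simp add: power2_norm_eq_inner)
    then have "norm (y + b *\<^sub>R x - y) \<le> norm (G (y + b *\<^sub>R x) - G y)"
      using x b by (simp add: power2_eq_square)
    then have "norm (y + b *\<^sub>R x - y) = norm (G (y + b *\<^sub>R x) - G y)"
      using G_lipschitz[of "y + b *\<^sub>R x" y] by simp
    then have "(y + b *\<^sub>R x) \<bullet> y = G (y + b *\<^sub>R x) \<bullet> G y"
      unfolding dot_norm_neg norm_G by simp
    then obtain c where "y + b *\<^sub>R x = c *\<^sub>R y" using G_inner_eq_cone[OF y2 y] by blast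
    then have "b *\<^sub>R x = (c - 1) *\<^sub>R y" by (simp add: algebra_simps)
    then have "y \<times> (b *\<^sub>R x) = y \<times> ((c - 1) *\<^sub>R y)" by simp
    then have "b *\<^sub>R (y \<times> x) = 0" by (simp add: cross_mult_right)
    then show ?thesis using b by simp
  qed
  define y where "y = ray (- \<epsilon>) V 0"
  have y: "y \<in> C" using ray_in_cone[of 1] by (simp add: y_def)
  obtain r where r: "r > 0" "ball y r \<subseteq> C" using open_cone y open_contains_ball by blast
  obtain e where e: "e \<times> x \<noteq> 0" using exists_nonparallel[OF x] .
  define b where "b = r / (2 * norm e)"
  have "e \<noteq> 0" using e by auto
  then have b: "0 < b" using r(1) by (simp add: b_def)
  have "y + b *\<^sub>R e \<in> ball y r" using \<open>e \<noteq> 0\<close> r(1) by (simp add: dist_norm b_def)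
  then have "(y + b *\<^sub>R e) \<times> x = 0" using par r(2) by blast
  then show False using par[OF y] e b by (simp add: cross_add_left cross_mult_left)
qed

lemma G_strict:
  assumes "x \<noteq> 0" shows "\<exists>y. y \<bullet> x < G y \<bullet> G x"
  using cone_rigid[OF assms norm_G] conic_nonexpansiveD(2)[OF conic_G] by (metis less_eq_real_def)

text \<open>With both outside, the inequalities for \<open>x\<close> and for \<open>- x\<close>
  would pinch \<open>G y \<bullet> (- x)\<close> to \<open>y \<bullet> x\<close> for all
  \<open>y\<close>, against \<open>cone_rigid\<close>.\<close>

lemma complement_pointed:
  assumes "x \<notin> C" "- x \<notin> C" shows "x = 0"
proof (rule ccontr)
  assume "x \<noteq> 0"
  then obtain y where y: "y \<in> C" "G y \<bullet> (- x) \<noteq> y \<bullet> x" using cone_rigid[of x "- x"] by auto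
  have "y \<bullet> x \<le> G y \<bullet> G x" "y \<bullet> (- x) \<le> G y \<bullet> G (- x)"
    using conic_nonexpansiveD(2)[OF conic_G] by blast+
  then show False using y assms by (simp add: G_outside)
qed

text \<open>Half sum and half difference of the two halves recover direction and moment, hence the
  line. An argument outside the cone would give \<open>2 u = 0\<close>.\<close>

lemma fibers_of_G: "fibers_of \<epsilon> G V"
proof -
  have "(u + \<epsilon> *\<^sub>R (q \<times> u) = G (u - \<epsilon> *\<^sub>R (q \<times> u))) = (u = V q)" if u: "norm u = 1" for u q
  proof
    assume "u = V q"
    then show "u + \<epsilon> *\<^sub>R (q \<times> u) = G (u - \<epsilon> *\<^sub>R (q \<times> u))"
      using G_ray[of 1 q] by (simp add: ray_def)
  next
    let ?x = "u - \<epsilon> *\<^sub>R (q \<times> u)"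
    assume eq: "u + \<epsilon> *\<^sub>R (q \<times> u) = G ?x"
    have "?x \<in> C"
    proof (rule ccontr)
      assume "?x \<notin> C"
      then have "u + \<epsilon> *\<^sub>R (q \<times> u) = - ?x" using eq G_outside by simp
      then have "2 *\<^sub>R u = 0" by (simp add: scaleR_2 algebra_simps)
      then show False using u by simp
    qed
    then obtain c p where cp: "0 < c" "?x = c *\<^sub>R ray (- \<epsilon>) V p" by (rule coneE)
    have Gx: "u + \<epsilon> *\<^sub>R (q \<times> u) = c *\<^sub>R ray \<epsilon> V p" using eq cp G_ray by simp
    have uc: "u = c *\<^sub>R V p"
    proof -
      have "(1/2) *\<^sub>R (?x + (u + \<epsilon> *\<^sub>R (q \<times> u))) = (1/2) *\<^sub>R (c *\<^sub>R ray (- \<epsilon>) V p + c *\<^sub>R ray \<epsilon> V p)"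
        by (simp only: cp(2) Gx)
      then show ?thesis unfolding ray_def
        by (simp only: scaleR_minus_left half_sum scaleR_right_distrib[symmetric] diff_conv_add_uminus[symmetric] scaleR_left_commute[of "1/2" c])
    qed
    then have "c = 1" using u cp(1) nondeg_unit[OF V] by simp
    then have uV: "u = V p" using uc by simp
    have "\<epsilon> *\<^sub>R (q \<times> u) = \<epsilon> *\<^sub>R (p \<times> u)"
    proof -
      have "(1/2) *\<^sub>R ((u + \<epsilon> *\<^sub>R (q \<times> u)) - ?x) = (1/2) *\<^sub>R (ray \<epsilon> V p - ray (- \<epsilon>) V p)"
        using \<open>c = 1\<close> by (simp only: cp(2) Gx scaleR_one)
      then show ?thesis unfolding ray_def uV[symmetric]
        by (simp only: scaleR_minus_left half_sum diff_conv_add_uminus[symmetric])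
    qed
    then have "q \<times> u = p \<times> u" using eps by auto
    then have "(q - p) \<times> u = 0" by (simp add: Cross3.left_diff_distrib)
    from parallel_imp_multiple[OF u this] have "q = p + ((q - p) \<bullet> u) *\<^sub>R V p"
      using uV by (simp add: algebra_simps)
    then show "u = V q" using nondeg_const[OF V, of p "(q - p) \<bullet> u"] uV by simp
  qed
  then show ?thesis by (auto simp: fibers_of_def nondeg_unit[OF V])
qed

lemma cone_nonempty: "C \<noteq> {}"
  using ray_in_cone[of 1] by (metis empty_iff zero_less_one)

text \<open>Punctured space is connected, so the cone has a nonzero frontier point \<open>c\<close>.
  It is not in the open cone, hence \<open>- c\<close> is, and a vector of the cone close enough to
  \<open>c\<close> has its negative in the cone as well.\<close>

lemma exists_two_sided_direction:
  assumes "x \<notin> C" "x \<noteq> 0"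
  obtains w where "w \<in> C" "- w \<in> C"
proof -
  have "connected (- {0::real^3})" by (intro connected_punctured_universe) (simp add: DIM_cart)
  moreover have "- {0} \<inter> C \<noteq> {}"
  proof -
    obtain y where "y \<in> C" using cone_nonempty by auto
    then show ?thesis using zero_notin_cone by (metis ComplI IntI empty_iff singletonD)
  qed
  moreover have "- {0} - C \<noteq> {}" using assms by blast
  ultimately have "- {0} \<inter> frontier C \<noteq> {}" by (rule connected_Int_frontier)
  then obtain c where c: "c \<noteq> 0" "c \<in> closure C" "c \<notin> C"
    using open_cone by (auto simp: frontier_def interior_open)
  then have "- c \<in> C" using complement_pointed by blast
  have "open (uminus -` C)" using open_cone by (intro open_vimage continuous_intros)
  moreover have "uminus -` C \<inter> closure C \<noteq> {}" using c(2) \<open>- c \<in> C\<close> by auto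
  ultimately have "uminus -` C \<inter> C \<noteq> {}" using open_Int_closure_eq_empty by blast
  then show ?thesis using that by auto
qed

text \<open>Divided by a large \<open>t\<close>, the vector \<open>x + t w\<close> is a small
  perturbation of \<open>w\<close>, so the half-line ends up in the open cone.\<close>

lemma reach_frontier:
  assumes "x \<notin> C" "w \<in> C"
  obtains t where "0 \<le> t" "x + t *\<^sub>R w \<in> closure C" "x + t *\<^sub>R w \<notin> C"
proof -
  let ?S = "(\<lambda>t. x + t *\<^sub>R w) ` {0..}"
  have "connected ?S" by (intro connected_continuous_image continuous_intros) simp
  moreover have "?S \<inter> C \<noteq> {}"
  proof -
    obtain r where r: "r > 0" "ball w r \<subseteq> C" using open_cone assms(2) open_contains_ball by blast
    define t where "t = 2 * (norm x + 1) / r"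
    have t: "0 < t" using r(1) by (simp add: t_def add_nonneg_pos)
    have "norm ((1 / t) *\<^sub>R x) < r"
    proof -
      have "norm x < t * r" using r(1) by (simp add: t_def) (smt (verit) norm_ge_zero)
      then show ?thesis using t by (simp add: divide_less_eq mult.commute)
    qed
    then have "w + (1 / t) *\<^sub>R x \<in> ball w r" by (simp add: dist_norm)
    then have "t *\<^sub>R (w + (1 / t) *\<^sub>R x) \<in> C" using r(2) cone_scale t by blast
    then have "x + t *\<^sub>R w \<in> C" using t by (simp add: scaleR_right_distrib add.commute)
    moreover have "x + t *\<^sub>R w \<in> ?S" by (rule imageI) (use t in simp)
    ultimately show ?thesis by blast
  qed
  moreover have "?S - C \<noteq> {}"
  proof -
    have "x + 0 *\<^sub>R w \<in> ?S" by (rule imageI) simp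
    then have "x \<in> ?S" by simp
    then show ?thesis using assms(1) by blast
  qed
  ultimately have "?S \<inter> frontier C \<noteq> {}" by (rule connected_Int_frontier)
  then show ?thesis using that open_cone by (auto simp: frontier_def interior_open)
qed

end

section \<open>Convergence\<close>

text \<open>Pointwise convergence on the cone \<open>C\<close> is immediate; it extends to the closure by
  equicontinuity, and to the rest because nonexpansiveness forces a map that is almost \<open>- x\<close> at two
  points to be almost \<open>- x\<close> on the segment between them.\<close>
lemma cone_map_tendsto:
  assumes "handed_fibration V \<epsilon>" and ev: "\<forall>\<^sub>F i in F. handed_fibration (W i) \<epsilon>"
    and lim: "\<And>q. ((\<lambda>i. W i q) \<longlongrightarrow> V q) F"
  shows "((\<lambda>i. cone_map \<epsilon> (W i) x) \<longlongrightarrow> cone_map \<epsilon> V x) F"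
proof -
  interpret handed_fibration V \<epsilon> by fact
  let ?G = "\<lambda>i. cone_map \<epsilon> (W i)"
  have ray_lim: "((\<lambda>i. ray e (W i) q) \<longlongrightarrow> ray e V q) F" for e q
  proof -
    have "((\<lambda>i. q \<times> W i q) \<longlongrightarrow> q \<times> V q) F"
      using lim bilinear_conv_bounded_bilinear[THEN iffD1, OF bilinear_cross]
      by (rule bounded_bilinear.tendsto[OF _ tendsto_const, rotated])
    then show ?thesis unfolding ray_def by (intro tendsto_intros lim)
  qed
  have lip: "\<forall>\<^sub>F i in F. \<forall>x y. norm (?G i x - ?G i y) \<le> norm (x - y)"
    using ev by eventually_elim (use handed_fibration.G_lipschitz in blast)
  have 1: "((\<lambda>i. ?G i x) \<longlongrightarrow> G x) F" if x: "x \<in> C" for x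
  proof -
    obtain c q where cq: "0 < c" "x = c *\<^sub>R ray (- \<epsilon>) V q" using x by (rule coneE)
    let ?y = "\<lambda>i. c *\<^sub>R ray (- \<epsilon>) (W i) q" and ?z = "\<lambda>i. c *\<^sub>R ray \<epsilon> (W i) q"
    have Gx: "G x = c *\<^sub>R ray \<epsilon> V q" using G_ray[OF cq(1)] cq(2) by simp
    have "((\<lambda>i. norm (x - ?y i) + norm (?z i - G x)) \<longlongrightarrow> norm (x - x) + norm (G x - G x)) F"
      unfolding Gx by (intro tendsto_intros ray_lim) (simp only: cq(2), intro tendsto_intros ray_lim)
    then have "((\<lambda>i. norm (x - ?y i) + norm (?z i - G x)) \<longlongrightarrow> 0) F" by simp
    moreover have "\<forall>\<^sub>F i in F. norm (?G i x - G x) \<le> norm (x - ?y i) + norm (?z i - G x)"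
      using lip ev
    proof eventually_elim
      case (elim i)
      have "?G i (?y i) = ?z i" using handed_fibration.G_ray[OF elim(2) cq(1)] .
      then have "norm (?G i x - ?z i) \<le> norm (x - ?y i)" using elim(1) by metis
      then show ?case using norm_triangle_ineq[of "?G i x - ?z i" "?z i - G x"] by simp
    qed
    ultimately have "((\<lambda>i. ?G i x - G x) \<longlongrightarrow> 0) F" by (rule Lim_null_comparison[rotated])
    then show ?thesis by (rule LIM_zero_cancel)
  qed
  have 2: "((\<lambda>i. ?G i x) \<longlongrightarrow> G x) F" if x: "x \<in> closure C" for x
  proof (rule tendstoI)
    fix e :: real assume e: "0 < e"
    obtain z where z: "z \<in> C" "dist z x < e / 3"
      using x e closure_approachable by (meson divide_pos_pos zero_less_numeral)
    have "\<forall>\<^sub>F i in F. dist (?G i z) (G z) < e / 3" using tendstoD[OF 1[OF z(1)], of "e/3"] e by simp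
    with lip show "\<forall>\<^sub>F i in F. dist (?G i x) (G x) < e"
    proof eventually_elim
      case (elim i)
      have "norm (?G i x - ?G i z) \<le> norm (x - z)" "norm (G z - G x) \<le> norm (z - x)"
        using elim(1) G_lipschitz by blast+
      then have "dist (?G i x) (?G i z) < e / 3" "dist (G z) (G x) < e / 3"
        using z(2) by (simp_all add: dist_norm norm_minus_commute)
      then show ?case using elim(2) dist_triangle[of "?G i x" "G x" "?G i z"]
          dist_triangle[of "?G i z" "G x" "G z"] by linarith
    qed
  qed
  show ?thesis
  proof (cases "x \<in> C \<or> x = 0")
    case True
    moreover have "\<forall>\<^sub>F i in F. ?G i 0 = 0"
      using ev by eventually_elim (use handed_fibration.norm_G[of _ _ 0] in simp)
    moreover have "G 0 = 0" using norm_G[of 0] by simp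
    ultimately show ?thesis using 1 by (auto intro: tendsto_eventually)
  next
    case False
    then have x: "x \<notin> C" "x \<noteq> 0" by auto
    obtain w where w: "w \<in> C" "- w \<in> C" using exists_two_sided_direction[OF x] .
    obtain t1 where t1: "0 \<le> t1" "x + t1 *\<^sub>R w \<in> closure C" "x + t1 *\<^sub>R w \<notin> C"
      using reach_frontier[OF x(1) w(1)] .
    obtain t2 where t2: "0 \<le> t2" "x + t2 *\<^sub>R (- w) \<in> closure C" "x + t2 *\<^sub>R (- w) \<notin> C"
      using reach_frontier[OF x(1) w(2)] .
    show ?thesis
    proof (cases "t1 + t2 = 0")
      case True
      then have "t1 = 0" using t1 t2 by simp
      then show ?thesis using 2[OF t1(2)] by simp
    next
      case False
      then have T: "0 < t1 + t2" using t1 t2 by simp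
      \<comment> \<open>Frontier points on both sides of \<open>x\<close> on the line in direction
        \<open>w\<close>, with the weights that express \<open>x\<close> as their convex
        combination.\<close>
      define c1 where "c1 = x + t1 *\<^sub>R w"
      define c2 where "c2 = x + t2 *\<^sub>R (- w)"
      define a1 where "a1 = t2 / (t1 + t2)"
      define a2 where "a2 = t1 / (t1 + t2)"
      have a: "0 \<le> a1" "0 \<le> a2" using t1 t2 by (simp_all add: a1_def a2_def)
      have "a1 + a2 = 1" using T by (simp add: a1_def a2_def add_divide_distrib[symmetric] add.commute)
      moreover have "a1 * t1 = a2 * t2" by (simp add: a1_def a2_def)
      moreover have "a1 *\<^sub>R c1 + a2 *\<^sub>R c2 = (a1 + a2) *\<^sub>R x + (a1 * t1 - a2 * t2) *\<^sub>R w"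
        by (simp add: c1_def c2_def algebra_simps)
      ultimately have xc: "x = a1 *\<^sub>R c1 + a2 *\<^sub>R c2" by simp
      have l1: "((\<lambda>i. ?G i c1) \<longlongrightarrow> - c1) F" and l2: "((\<lambda>i. ?G i c2) \<longlongrightarrow> - c2) F"
        using 2[OF t1(2)] 2[OF t2(2)] G_outside t1 t2 by (simp_all add: c1_def c2_def)
      let ?b = "\<lambda>i. 2 * norm x * (a1 * norm (c1 + ?G i c1) + a2 * norm (c2 + ?G i c2))"
      have "(?b \<longlongrightarrow> 2 * norm x * (a1 * norm (c1 + (- c1)) + a2 * norm (c2 + (- c2)))) F"
        by (intro tendsto_intros l1 l2)
      then have "(?b \<longlongrightarrow> 0) F" by simp
      moreover have "\<forall>\<^sub>F i in F. norm ((norm (?G i x + x))\<^sup>2) \<le> ?b i"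
        using ev
      proof eventually_elim
        case (elim i)
        interpret Wi: handed_fibration "W i" \<epsilon> by fact
        \<comment> \<open>Nonexpansiveness tested against a \<open>c\<close> with
          \<open>?G i c\<close> close to \<open>- c\<close> bounds \<open>?G i x \<bullet> c\<close>
          from above by nearly \<open>- (x \<bullet> c)\<close>. Combining this for
          \<open>c1\<close> and \<open>c2\<close> pushes \<open>?G i x\<close> towards
          \<open>- x\<close>.\<close>
        have bound: "?G i x \<bullet> c \<le> norm x * norm (c + ?G i c) - x \<bullet> c" for c
        proof -
          have "?G i x \<bullet> (c + ?G i c) \<le> norm x * norm (c + ?G i c)"
            using norm_cauchy_schwarz[of "?G i x" "c + ?G i c"] Wi.norm_G by simp
          moreover have "x \<bullet> c \<le> ?G i x \<bullet> ?G i c" using conic_nonexpansiveD(2)[OF Wi.conic_G] .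
          ultimately show ?thesis by (simp add: inner_add_right)
        qed
        have "?G i x \<bullet> x = a1 * (?G i x \<bullet> c1) + a2 * (?G i x \<bullet> c2)"
          by (subst xc) (simp add: inner_add_right)
        also have "\<dots> \<le> a1 * (norm x * norm (c1 + ?G i c1) - x \<bullet> c1) + a2 * (norm x * norm (c2 + ?G i c2) - x \<bullet> c2)"
          by (intro add_mono mult_left_mono bound a)
        also have "\<dots> = norm x * (a1 * norm (c1 + ?G i c1) + a2 * norm (c2 + ?G i c2)) - x \<bullet> (a1 *\<^sub>R c1 + a2 *\<^sub>R c2)"
          by (simp add: inner_add_right algebra_simps)
        finally have "?G i x \<bullet> x \<le> norm x * (a1 * norm (c1 + ?G i c1) + a2 * norm (c2 + ?G i c2)) - x \<bullet> x"
          using xc by simp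
        moreover have "norm ((norm (?G i x + x))\<^sup>2) = 2 * (?G i x \<bullet> x) + 2 * (x \<bullet> x)"
          using dot_norm[of "?G i x" x] Wi.norm_G[of x] by (simp add: power2_norm_eq_inner)
        ultimately show ?case unfolding mult.assoc by linarith
      qed
      ultimately have "((\<lambda>i. (norm (?G i x + x))\<^sup>2) \<longlongrightarrow> 0) F" by (rule Lim_null_comparison[rotated])
      then have "((\<lambda>i. sqrt ((norm (?G i x + x))\<^sup>2)) \<longlongrightarrow> sqrt 0) F" by (rule tendsto_real_sqrt)
      then have "((\<lambda>i. ?G i x + x) \<longlongrightarrow> 0) F" by (simp add: tendsto_norm_zero_iff)
      then have "((\<lambda>i. ?G i x + x - x) \<longlongrightarrow> 0 - x) F" by (intro tendsto_intros)
      then show ?thesis using G_outside[OF x(1)] by simp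
    qed
  qed
qed

text \<open>The common Lipschitz constant 1 upgrades pointwise to uniform convergence by way of a
  finite net of mesh \<open>e / 3\<close>.\<close>

lemma cone_map_uniform:
  assumes V: "handed_fibration V \<epsilon>" and ev: "\<forall>\<^sub>F i in F. handed_fibration (W i) \<epsilon>"
    and lim: "\<And>q. ((\<lambda>i. W i q) \<longlongrightarrow> V q) F"
  shows "uniform_limit (sphere 0 1) (\<lambda>i. cone_map \<epsilon> (W i)) (cone_map \<epsilon> V) F"
  unfolding uniform_limit_iff
proof (intro allI impI)
  fix e :: real assume e: "0 < e"
  have "compact (sphere (0::real^3) 1)" by simp
  then obtain K where K: "finite K" "sphere (0::real^3) 1 \<subseteq> (\<Union>z\<in>K. ball z (e / 3))"
    using e unfolding compact_eq_totally_bounded by (meson divide_pos_pos zero_less_numeral)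
  have "\<forall>\<^sub>F i in F. \<forall>z\<in>K. dist (cone_map \<epsilon> (W i) z) (cone_map \<epsilon> V z) < e / 3"
    using tendstoD[OF cone_map_tendsto[OF V ev lim], of "e / 3"] e
    by (intro eventually_ball_finite K ballI) simp
  with ev show "\<forall>\<^sub>F i in F. \<forall>x\<in>sphere 0 1. dist (cone_map \<epsilon> (W i) x) (cone_map \<epsilon> V x) < e"
  proof eventually_elim
    case (elim i)
    show ?case
    proof
      fix x :: "real^3" assume "x \<in> sphere 0 1"
      then obtain z where z: "z \<in> K" "dist z x < e / 3" using K(2) by auto
      have "dist (cone_map \<epsilon> (W i) x) (cone_map \<epsilon> (W i) z) \<le> dist x z"
        "dist (cone_map \<epsilon> V z) (cone_map \<epsilon> V x) \<le> dist z x"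
        using handed_fibration.G_lipschitz[OF elim(1)] handed_fibration.G_lipschitz[OF V]
        by (simp_all add: dist_norm)
      then show "dist (cone_map \<epsilon> (W i) x) (cone_map \<epsilon> V x) < e"
        using elim(2) z dist_triangle[of "cone_map \<epsilon> (W i) x" "cone_map \<epsilon> V x" "cone_map \<epsilon> (W i) z"]
          dist_triangle[of "cone_map \<epsilon> (W i) z" "cone_map \<epsilon> V x" "cone_map \<epsilon> V z"] dist_commute[of x z]
        by fastforce
    qed
  qed
qed

text \<open>By compactness, vectors away from \<open>V q\<close> violate the fiber equation of
  \<open>G\<close> by a definite amount \<open>m\<close>, whereas \<open>W i q\<close> violates it
  only by the difference of \<open>G' i\<close> and \<open>G\<close>.\<close>

lemma fibers_of_uniform_limit:
  assumes G: "conic_nonexpansive G" and fib: "fibers_of \<epsilon> G V" and V: "continuous_on UNIV V"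
    and ev: "\<forall>\<^sub>F i in F. conic_nonexpansive (G' i) \<and> fibers_of \<epsilon> (G' i) (W i)"
    and lim: "uniform_limit (sphere 0 1) G' G F" and eps: "\<bar>\<epsilon>\<bar> \<le> 1"
  shows "uniform_limit (cball 0 R) W V F"
  unfolding uniform_limit_iff
proof (intro allI impI)
  fix e :: real assume e: "0 < e"
  define \<phi> where "\<phi> z = norm (snd z + \<epsilon> *\<^sub>R (fst z \<times> snd z) - G (snd z - \<epsilon> *\<^sub>R (fst z \<times> snd z)))" for z
  define Z where "Z = Sigma (cball 0 R) (\<lambda>_. sphere 0 1) \<inter> {z. e \<le> dist (snd z) (V (fst z))}"
  have fs: "continuous_on UNIV (fst :: (real^3) * (real^3) \<Rightarrow> _)" "continuous_on UNIV (snd :: (real^3) * (real^3) \<Rightarrow> _)"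
    by (intro continuous_intros)+
  have Vf: "continuous_on UNIV (\<lambda>z :: (real^3) * (real^3). V (fst z))"
    by (rule continuous_on_compose2[OF V fs(1)]) simp
  have arg: "continuous_on UNIV (\<lambda>z :: (real^3) * (real^3). snd z - \<epsilon> *\<^sub>R (fst z \<times> snd z))"
    by (intro continuous_on_diff continuous_on_scaleR continuous_on_const continuous_on_cross fs)
  have "continuous_on UNIV (\<lambda>z. G (snd z - \<epsilon> *\<^sub>R (fst z \<times> snd z)))"
    by (rule continuous_on_compose2[OF conic_nonexpansive_continuous[OF G, of UNIV] arg]) simp
  then have cont: "continuous_on UNIV \<phi>" unfolding \<phi>_def
    by (intro continuous_on_norm continuous_on_diff continuous_on_add continuous_on_scaleR
        continuous_on_const continuous_on_cross fs)
  have "closed {z. e \<le> dist (snd z) (V (fst z))}"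
    by (intro closed_Collect_le continuous_on_const continuous_on_dist fs Vf)
  then have "compact Z" unfolding Z_def by (intro compact_Int_closed compact_Times) auto
  obtain m where m: "0 < m" "\<And>z. z \<in> Z \<Longrightarrow> m \<le> \<phi> z"
  proof (cases "Z = {}")
    case False
    then obtain z0 where z0: "z0 \<in> Z" "\<And>z. z \<in> Z \<Longrightarrow> \<phi> z0 \<le> \<phi> z"
      using continuous_attains_inf[OF \<open>compact Z\<close> False continuous_on_subset[OF cont]] by auto
    have "\<phi> z0 \<noteq> 0"
    proof
      assume "\<phi> z0 = 0"
      moreover have "norm (snd z0) = 1" using z0(1) by (auto simp: Z_def)
      ultimately have "snd z0 = V (fst z0)" using fib by (simp add: \<phi>_def fibers_of_def)
      then show False using z0(1) e by (simp add: Z_def)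
    qed
    then have "0 < \<phi> z0" by (simp add: \<phi>_def)
    then show ?thesis using z0 that by blast
  qed (use that[of 1] in auto)
  \<comment> \<open>The arguments of \<open>G\<close> that occur have norm below
    \<open>2 + \<bar>R\<bar>\<close>, the factor by which homogeneity enlarges the error on the
    sphere.\<close>
  have M: "0 < 2 + \<bar>R\<bar>" by simp
  have "\<forall>\<^sub>F i in F. \<forall>x\<in>sphere 0 1. dist (G' i x) (G x) < m / (2 + \<bar>R\<bar>)"
    using lim m(1) M unfolding uniform_limit_iff by (meson divide_pos_pos)
  with ev show "\<forall>\<^sub>F i in F. \<forall>q\<in>cball 0 R. dist (W i q) (V q) < e"
  proof eventually_elim
    case (elim i)
    show ?case
    proof
      fix q :: "real^3" assume q: "q \<in> cball 0 R"
      define u where "u = W i q"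
      define x where "x = u - \<epsilon> *\<^sub>R (q \<times> u)"
      have u: "norm u = 1" "u + \<epsilon> *\<^sub>R (q \<times> u) = G' i x"
        using elim(1) by (auto simp: u_def x_def fibers_of_def)
      have "(norm (q \<times> u))\<^sup>2 \<le> (norm q)\<^sup>2"
        using norm_cross_dot[of q u] zero_le_power2[of "q \<bullet> u"] unfolding u(1) mult_1_right by linarith
      then have "norm (q \<times> u) \<le> norm q" using power2_le_imp_le norm_ge_zero by blast
      moreover have "\<bar>\<epsilon>\<bar> * norm (q \<times> u) \<le> 1 * norm (q \<times> u)" using eps by (intro mult_right_mono) auto
      ultimately have "norm (\<epsilon> *\<^sub>R (q \<times> u)) \<le> norm q" by simp
      then have "norm x \<le> 1 + norm q" using norm_triangle_ineq4[of u "\<epsilon> *\<^sub>R (q \<times> u)"] u(1) by (simp add: x_def)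
      then have nx: "norm x < 2 + \<bar>R\<bar>" using q by simp
      have "\<phi> (q, u) < m"
      proof (cases "x = 0")
        case True
        have "\<phi> (q, u) = norm (G' i x - G x)" using u(2) by (simp add: \<phi>_def x_def)
        also have "\<dots> = 0" using elim(1) conic_nonexpansiveD(1)[OF G, of 0] conic_nonexpansiveD(1)[of "G' i" 0]
          by (simp add: True)
        finally show ?thesis using m(1) by simp
      next
        case False
        have xs: "x = norm x *\<^sub>R sgn x" using False by (simp add: sgn_div_norm)
        have "\<phi> (q, u) = norm (G' i x - G x)" using u(2) by (simp add: \<phi>_def x_def)
        also have "G' i x = norm x *\<^sub>R G' i (sgn x)"
          using elim(1) conic_nonexpansiveD(3)[of "G' i" "norm x" "sgn x"] xs by simp
        also have "G x = norm x *\<^sub>R G (sgn x)"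
          using G conic_nonexpansiveD(3)[of G "norm x" "sgn x"] xs by simp
        also have "norm (norm x *\<^sub>R G' i (sgn x) - norm x *\<^sub>R G (sgn x)) = norm x * dist (G' i (sgn x)) (G (sgn x))"
          by (simp add: dist_norm flip: scaleR_diff_right)
        also have "\<dots> < (2 + \<bar>R\<bar>) * (m / (2 + \<bar>R\<bar>))"
        proof (rule mult_strict_mono)
          have "sgn x \<in> sphere 0 1" using False by (simp add: norm_sgn)
          then show "dist (G' i (sgn x)) (G (sgn x)) < m / (2 + \<bar>R\<bar>)" using elim(2) by blast
        qed (use nx in auto)
        finally show ?thesis by simp
      qed
      then have "(q, u) \<notin> Z" using m(2) by force
      then show "dist (W i q) (V q) < e" using q u(1) by (auto simp: Z_def u_def)
    qed
  qed
qed

section \<open>Calculus of repeatedly differentiable maps\<close>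

lemma Ck_const: "Ck k (\<lambda>x. c)"
proof (induction k arbitrary: c)
  case (Suc k)
  have "\<forall>x. ((\<lambda>x. c) has_derivative (\<lambda>v. 0)) (at x)" by simp
  then show ?case using Suc unfolding Ck.simps by (intro exI[of _ "\<lambda>x v. 0"]) auto
qed simp

lemma Ck_linear:
  assumes "bounded_linear f" shows "Ck k f"
proof (cases k)
  case 0
  then show ?thesis using assms by (simp add: linear_continuous_on)
next
  case (Suc n)
  have "\<forall>x. (f has_derivative f) (at x)" using assms by (simp add: bounded_linear_imp_has_derivative)
  then show ?thesis unfolding Suc Ck.simps by (intro exI[of _ "\<lambda>x. f"]) (auto intro: Ck_const)
qed

lemma Ck_SucD: "Ck (Suc k) f \<Longrightarrow> Ck k f"
proof (induction k arbitrary: f)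
  case 0
  then obtain f' where "\<And>x. (f has_derivative f' x) (at x)" by auto
  then have "isCont f x" for x using has_derivative_continuous by blast
  then show ?case by (simp add: continuous_at_imp_continuous_on)
next
  case (Suc k)
  then obtain f' where f': "\<forall>x. (f has_derivative f' x) (at x)" "\<forall>v. Ck (Suc k) (\<lambda>x. f' x v)"
    by (metis Ck.simps(2))
  then have "\<forall>v. Ck k (\<lambda>x. f' x v)" using Suc.IH by blast
  then show ?case using f'(1) by auto
qed

text \<open>Product and quotient rules leave undifferentiated factors, so the inductions need
  \<open>Ck k f\<close> next to the derivatives.\<close>

lemma Ck_SucE:
  assumes "Ck (Suc k) f"
  shows "\<exists>f'. (\<forall>x. (f has_derivative f' x) (at x)) \<and> (\<forall>v. Ck k (\<lambda>x. f' x v)) \<and> Ck k f"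
  using assms Ck_SucD[OF assms] by auto

lemma Ck_SucI:
  assumes "\<And>x. (f has_derivative f' x) (at x)" "\<And>v. Ck k (\<lambda>x. f' x v)"
  shows "Ck (Suc k) f"
  using assms by auto

lemma Ck_continuous: "Ck k f \<Longrightarrow> continuous_on UNIV f"
  by (induction k) (use Ck_SucD in auto)

lemma Ck_add: "Ck k f \<Longrightarrow> Ck k g \<Longrightarrow> Ck k (\<lambda>x. f x + g x)"
proof (induction k arbitrary: f g)
  case 0
  then show ?case by (simp add: continuous_on_add)
next
  case (Suc k)
  obtain f' where f': "\<And>x. (f has_derivative f' x) (at x)" "\<And>v. Ck k (\<lambda>x. f' x v)" using Ck_SucE[OF Suc.prems(1)] by blast
  obtain g' where g': "\<And>x. (g has_derivative g' x) (at x)" "\<And>v. Ck k (\<lambda>x. g' x v)" using Ck_SucE[OF Suc.prems(2)] by blast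
  show ?case
    by (rule Ck_SucI[where f'="\<lambda>x v. f' x v + g' x v"]) (use f' g' Suc.IH in \<open>auto intro: has_derivative_add\<close>)
qed

text \<open>One induction on the product rule covers scalar, inner, real and cross products.\<close>

lemma Ck_bilinear:
  assumes h: "bounded_bilinear h" and "Ck k f" "Ck k g"
  shows "Ck k (\<lambda>x. h (f x) (g x))"
  using assms(2,3)
proof (induction k arbitrary: f g)
  case 0
  then show ?case by (simp add: bounded_bilinear.continuous_on[OF h])
next
  case (Suc k)
  obtain f' where f': "\<And>x. (f has_derivative f' x) (at x)" "\<And>v. Ck k (\<lambda>x. f' x v)" "Ck k f" using Ck_SucE[OF Suc.prems(1)] by blast
  obtain g' where g': "\<And>x. (g has_derivative g' x) (at x)" "\<And>v. Ck k (\<lambda>x. g' x v)" "Ck k g" using Ck_SucE[OF Suc.prems(2)] by blast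
  show ?case
  proof (rule Ck_SucI[where f'="\<lambda>x v. h (f x) (g' x v) + h (f' x v) (g x)"])
    show "((\<lambda>x. h (f x) (g x)) has_derivative (\<lambda>v. h (f x) (g' x v) + h (f' x v) (g x))) (at x)" for x
      by (rule bounded_bilinear.FDERIV[OF h f'(1) g'(1)])
    show "Ck k (\<lambda>x. h (f x) (g' x v) + h (f' x v) (g x))" for v
      by (intro Ck_add Suc.IH f' g')
  qed
qed

lemmas Ck_scaleR = Ck_bilinear[OF bounded_bilinear_scaleR]
  and Ck_inner = Ck_bilinear[OF bounded_bilinear_inner]
  and Ck_mult = Ck_bilinear[OF bounded_bilinear_mult]
  and Ck_cross = Ck_bilinear[OF bilinear_conv_bounded_bilinear[THEN iffD1, OF bilinear_cross]]

lemma Ck_minus: "Ck k f \<Longrightarrow> Ck k (\<lambda>x. - f x)"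
  using Ck_scaleR[OF Ck_const, of k f "-1"] by simp

lemma Ck_diff: "Ck k f \<Longrightarrow> Ck k g \<Longrightarrow> Ck k (\<lambda>x. f x - g x)"
  using Ck_add[OF _ Ck_minus, of k f g] by simp

lemma Ck_sum: "finite S \<Longrightarrow> (\<And>i. i \<in> S \<Longrightarrow> Ck k (f i)) \<Longrightarrow> Ck k (\<lambda>x. \<Sum>i\<in>S. f i x)"
  by (induction S rule: finite_induct) (auto intro: Ck_const Ck_add)

text \<open>The derivative is a product of the function itself with derivatives of \<open>a\<close>,
  so regularity bootstraps. The proofs for \<open>sqrt\<close> and \<open>exp\<close> have the same
  pattern.\<close>

lemma Ck_inverse:
  fixes a :: "'a::real_normed_vector \<Rightarrow> real"
  assumes "Ck k a" "\<And>x. a x \<noteq> 0"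
  shows "Ck k (\<lambda>x. inverse (a x))"
  using assms(1)
proof (induction k)
  case 0
  then show ?case using assms(2) by (simp add: continuous_on_inverse)
next
  case (Suc k)
  obtain a' where a': "\<And>x. (a has_derivative a' x) (at x)" "\<And>v. Ck k (\<lambda>x. a' x v)" "Ck k a" using Ck_SucE[OF Suc.prems] by blast
  show ?case
  proof (rule Ck_SucI[where f'="\<lambda>x v. - (inverse (a x) * a' x v * inverse (a x))"])
    show "((\<lambda>x. inverse (a x)) has_derivative (\<lambda>v. - (inverse (a x) * a' x v * inverse (a x)))) (at x)" for x
      by (rule Deriv.has_derivative_inverse[OF assms(2) a'(1)])
    show "Ck k (\<lambda>x. - (inverse (a x) * a' x v * inverse (a x)))" for v
      by (intro Ck_minus Ck_mult Suc.IH a')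
  qed
qed

lemma Ck_sqrt:
  fixes a :: "'a::real_normed_vector \<Rightarrow> real"
  assumes "Ck k a" and pos: "\<And>x. 0 < a x"
  shows "Ck k (\<lambda>x. sqrt (a x))"
  using assms(1)
proof (induction k)
  case 0
  then show ?case by (simp add: continuous_on_real_sqrt)
next
  case (Suc k)
  obtain a' where a': "\<And>x. (a has_derivative a' x) (at x)" "\<And>v. Ck k (\<lambda>x. a' x v)" "Ck k a" using Ck_SucE[OF Suc.prems] by blast
  have s0: "sqrt (a x) \<noteq> 0" for x using pos[of x] by simp
  show ?case
  proof (rule Ck_SucI[where f'="\<lambda>x v. a' x v * (inverse (sqrt (a x)) * (1 / 2))"])
    show "((\<lambda>x. sqrt (a x)) has_derivative (\<lambda>v. a' x v * (inverse (sqrt (a x)) * (1 / 2)))) (at x)" for x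
    proof -
      have "(sqrt has_derivative (*) (inverse (sqrt (a x)) / 2)) (at (a x))"
        using DERIV_real_sqrt[OF pos] by (simp add: has_field_derivative_def)
      from has_derivative_compose[OF a'(1) this] show ?thesis
        by (rule has_derivative_eq_rhs) (simp add: fun_eq_iff mult.commute)
    qed
    show "Ck k (\<lambda>x. a' x v * (inverse (sqrt (a x)) * (1 / 2)))" for v
      by (intro Ck_mult Ck_inverse Ck_const Suc.IH a' s0)
  qed
qed

lemma Ck_exp:
  fixes a :: "'a::real_normed_vector \<Rightarrow> real"
  assumes "Ck k a"
  shows "Ck k (\<lambda>x. exp (a x))"
  using assms(1)
proof (induction k)
  case 0
  then show ?case by (simp add: continuous_on_exp)
next
  case (Suc k)
  obtain a' where a': "\<And>x. (a has_derivative a' x) (at x)" "\<And>v. Ck k (\<lambda>x. a' x v)" "Ck k a" using Ck_SucE[OF Suc.prems] by blast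
  show ?case
    by (rule Ck_SucI[where f'="\<lambda>x v. a' x v * exp (a x)"])
      (auto intro!: Ck_mult Suc.IH a' derivative_eq_intros)
qed

text \<open>\<open>Ck\<close> controls derivatives in fixed directions, while the chain rule
  evaluates \<open>g'\<close> in the direction \<open>f' x v\<close>, which moves with
  \<open>x\<close>. Expanding that direction in the basis separates the two.\<close>

lemma Ck_compose:
  fixes f :: "'a::real_normed_vector \<Rightarrow> 'b::euclidean_space" and g :: "'b \<Rightarrow> 'c::real_normed_vector"
  assumes "Ck k f" "Ck k g"
  shows "Ck k (\<lambda>x. g (f x))"
  using assms
proof (induction k arbitrary: f g)
  case 0
  then show ?case by (auto intro: continuous_on_compose2)
next
  case (Suc k)
  obtain f' where f': "\<And>x. (f has_derivative f' x) (at x)" "\<And>v. Ck k (\<lambda>x. f' x v)" "Ck k f" using Ck_SucE[OF Suc.prems(1)] by blast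
  obtain g' where g': "\<And>x. (g has_derivative g' x) (at x)" "\<And>v. Ck k (\<lambda>x. g' x v)" "Ck k g" using Ck_SucE[OF Suc.prems(2)] by blast
  have eq: "(\<Sum>i\<in>Basis. (f' x v \<bullet> i) *\<^sub>R g' (f x) i) = g' (f x) (f' x v)" for x v
  proof -
    interpret bounded_linear "g' (f x)" using g'(1) has_derivative_bounded_linear by blast
    have "g' (f x) (\<Sum>i\<in>Basis. (f' x v \<bullet> i) *\<^sub>R i) = (\<Sum>i\<in>Basis. (f' x v \<bullet> i) *\<^sub>R g' (f x) i)"
      by (simp only: sum scaleR)
    then show ?thesis by (simp add: euclidean_representation)
  qed
  show ?case
  proof (rule Ck_SucI[where f'="\<lambda>x v. \<Sum>i\<in>Basis. (f' x v \<bullet> i) *\<^sub>R g' (f x) i"])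
    show "((\<lambda>x. g (f x)) has_derivative (\<lambda>v. \<Sum>i\<in>Basis. (f' x v \<bullet> i) *\<^sub>R g' (f x) i)) (at x)" for x
      unfolding eq by (rule has_derivative_compose[OF f'(1) g'(1)])
    show "Ck k (\<lambda>x. \<Sum>i\<in>Basis. (f' x v \<bullet> i) *\<^sub>R g' (f x) i)" for v
      by (intro Ck_sum Ck_scaleR Ck_inner Ck_const f' Suc.IH[of f "\<lambda>y. g' y _"] g') simp
  qed
qed

lemma Ck_sgn:
  fixes f :: "'a::real_normed_vector \<Rightarrow> 'b::real_inner"
  assumes "Ck k f" "\<And>x. f x \<noteq> 0"
  shows "Ck k (\<lambda>x. sgn (f x))"
proof -
  have "Ck k (\<lambda>x. inverse (sqrt (f x \<bullet> f x)) *\<^sub>R f x)"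
    by (intro Ck_scaleR Ck_inverse Ck_sqrt Ck_inner assms) (use assms(2) in auto)
  then show ?thesis by (simp add: sgn_div_norm norm_eq_sqrt_inner)
qed

section \<open>Gaussian averages\<close>

lemma integral_translate:
  fixes f :: "'a::euclidean_space \<Rightarrow> 'b::{banach, second_countable_topology}"
  assumes [measurable]: "f \<in> borel_measurable borel"
  shows "(\<integral>z. f (t + z) \<partial>lborel) = (\<integral>z. f z \<partial>lborel)"
proof -
  have "(\<integral>z. f z \<partial>distr lborel borel ((+) t)) = (\<integral>z. f (t + z) \<partial>lborel)"
    by (rule integral_distr) measurable
  then show ?thesis by (simp add: lborel_distr_plus)
qed

lemma integral_reflect_origin:
  fixes f :: "'a::euclidean_space \<Rightarrow> 'b::{banach, second_countable_topology}"
  assumes [measurable]: "f \<in> borel_measurable borel"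
  shows "(\<integral>z. f (- z) \<partial>lborel) = (\<integral>z. f z \<partial>lborel)"
proof -
  have "lborel = distr lborel borel (uminus :: 'a \<Rightarrow> 'a)"
    using lborel_affine[of "-1" "0::'a"] by (simp add: density_1)
  moreover have "(\<integral>z. f z \<partial>distr lborel borel uminus) = (\<integral>z. f (- z) \<partial>lborel)"
    by (rule integral_distr) measurable
  ultimately show ?thesis by simp
qed

text \<open>The Gaussian factors over the coordinates, and each factor is a multiple of the standard
  normal density.\<close>

lemma gaussian_integrable: "integrable lborel (\<lambda>z::'a::euclidean_space. exp (- (norm z)\<^sup>2 / 2))"
proof -
  have prod: "exp (- (norm z)\<^sup>2 / 2) = (\<Prod>b\<in>Basis. exp (- (z \<bullet> b)\<^sup>2 / 2))" for z :: 'a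
    by (simp flip: exp_sum add: sum_negf sum_divide_distrib[symmetric] norm_eq_sqrt_inner
        euclidean_inner[of z z] power2_eq_square sum_nonneg)
  have 1: "integrable lborel (\<lambda>x::real. exp (- x\<^sup>2 / 2))"
  proof -
    have "integrable lborel (\<lambda>x. sqrt (2 * pi) * std_normal_density x)"
      by (intro integrable_mult_right integrable_normal_density) simp
    then show ?thesis by (simp add: normal_density_def)
  qed
  have fin: "(\<integral>\<^sup>+x. ennreal (exp (- x\<^sup>2 / 2)) \<partial>lborel) < \<infinity>"
    using 1 by (subst nn_integral_eq_integral) auto
  show ?thesis
  proof (rule integrableI_bounded)
    have "(\<integral>\<^sup>+z. ennreal (norm (exp (- (norm z)\<^sup>2 / 2))) \<partial>(lborel :: 'a measure))
        = (\<integral>\<^sup>+z. (\<Prod>b\<in>Basis. ennreal (exp (- (z \<bullet> b)\<^sup>2 / 2))) \<partial>(lborel :: 'a measure))"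
      unfolding real_norm_def abs_exp_cancel unfolding prod by (simp only: prod_ennreal[OF exp_ge_zero])
    also have "\<dots> = (\<Prod>b\<in>(Basis :: 'a set). (\<integral>\<^sup>+x. ennreal (exp (- x\<^sup>2 / 2)) \<partial>lborel))"
      by (rule nn_integral_lborel_prod) auto
    also have "\<dots> < \<infinity>" using fin by (simp add: power_less_top_ennreal)
    finally show "(\<integral>\<^sup>+z. ennreal (norm (exp (- (norm z)\<^sup>2 / 2))) \<partial>(lborel :: 'a measure)) < \<infinity>" .
  qed simp
qed

lemma gaussian_exp_integrable: "integrable lborel (\<lambda>z::'a::euclidean_space. exp (c * norm z - (norm z)\<^sup>2))"
proof (rule Bochner_Integration.integrable_bound)
  show "integrable lborel (\<lambda>z::'a. exp (c\<^sup>2 / 2) * exp (- (norm z)\<^sup>2 / 2))"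
    by (intro integrable_mult_right gaussian_integrable)
  have "c * t - t\<^sup>2 \<le> c\<^sup>2 / 2 + - t\<^sup>2 / 2" for t :: real
    using zero_le_power2[of "c - t"] by (simp add: power2_diff)
  then have "norm (exp (c * norm z - (norm z)\<^sup>2)) \<le> norm (exp (c\<^sup>2 / 2) * exp (- (norm z)\<^sup>2 / 2))" for z :: 'a
    unfolding exp_add[symmetric] by simp
  then show "AE z in lborel. norm (exp (c * norm (z::'a) - (norm z)\<^sup>2)) \<le> norm (exp (c\<^sup>2 / 2) * exp (- (norm z)\<^sup>2 / 2))"
    by simp
qed simp

section \<open>Laplace transforms of functions integrable against all exponentials\<close>

definition exp_integrable :: "('a::euclidean_space \<Rightarrow> 'b::{banach, second_countable_topology}) \<Rightarrow> bool" where
  "exp_integrable H \<longleftrightarrow> H \<in> borel_measurable borel \<and> (\<forall>n. integrable lborel (\<lambda>y. exp (real n * norm y) *\<^sub>R H y))"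

definition laplace :: "('a::euclidean_space \<Rightarrow> 'b::{banach, second_countable_topology}) \<Rightarrow> 'a \<Rightarrow> 'b" where
  "laplace H x = (\<integral>y. exp (x \<bullet> y) *\<^sub>R H y \<partial>lborel)"

lemma le_exp_self: "x \<le> exp (x::real)"
  using exp_ge_add_one_self[of x] by linarith

text \<open>Raising \<open>n\<close> by one absorbs the factor \<open>v \<bullet> y\<close>. This is
  the factor that differentiation brings down, so the derivatives of a Laplace transform are again
  of the same kind.\<close>

lemma exp_integrable_inner:
  assumes "exp_integrable H"
  shows "exp_integrable (\<lambda>y. (v \<bullet> y) *\<^sub>R H y)"
proof -
  have [measurable]: "H \<in> borel_measurable borel" using assms by (simp add: exp_integrable_def)
  have "integrable lborel (\<lambda>y. exp (real n * norm y) *\<^sub>R (v \<bullet> y) *\<^sub>R H y)" for n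
  proof (rule Bochner_Integration.integrable_bound)
    have "integrable lborel (\<lambda>y. exp (real (Suc n) * norm y) *\<^sub>R H y)"
      using assms unfolding exp_integrable_def by blast
    then show "integrable lborel (\<lambda>y. norm v *\<^sub>R exp (real (Suc n) * norm y) *\<^sub>R H y)"
      by (intro integrable_scaleR_right)
    have "norm (exp (real n * norm y) *\<^sub>R (v \<bullet> y) *\<^sub>R H y) \<le> norm (norm v *\<^sub>R exp (real (Suc n) * norm y) *\<^sub>R H y)" for y
    proof -
      have "\<bar>v \<bullet> y\<bar> \<le> norm v * exp (norm y)"
        using Cauchy_Schwarz_ineq2[of v y] mult_left_mono[OF le_exp_self[of "norm y"], of "norm v"] by simp
      then have "exp (real n * norm y) * \<bar>v \<bullet> y\<bar> * norm (H y) \<le> exp (real n * norm y) * (norm v * exp (norm y)) * norm (H y)"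
        by (intro mult_right_mono mult_left_mono) auto
      also have "\<dots> = norm v * exp (real (Suc n) * norm y) * norm (H y)"
        by (simp add: distrib_right exp_add algebra_simps)
      finally show ?thesis by (simp add: abs_mult mult.assoc)
    qed
    then show "AE y in lborel. norm (exp (real n * norm y) *\<^sub>R (v \<bullet> y) *\<^sub>R H y) \<le> norm (norm v *\<^sub>R exp (real (Suc n) * norm y) *\<^sub>R H y)"
      by simp
  qed measurable
  then show ?thesis by (simp add: exp_integrable_def)
qed

lemma laplace_integrable:
  assumes "exp_integrable H"
  shows "integrable lborel (\<lambda>y. exp (x \<bullet> y) *\<^sub>R H y)"
proof -
  have [measurable]: "H \<in> borel_measurable borel" using assms by (simp add: exp_integrable_def)
  obtain n where n: "norm x \<le> real n" using real_arch_simple by blast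
  show ?thesis
  proof (rule Bochner_Integration.integrable_bound)
    show "integrable lborel (\<lambda>y. exp (real n * norm y) *\<^sub>R H y)"
      using assms by (simp add: exp_integrable_def)
    have "x \<bullet> y \<le> real n * norm y" for y
      using norm_cauchy_schwarz[of x y] mult_right_mono[OF n, of "norm y"] by simp
    then show "AE y in lborel. norm (exp (x \<bullet> y) *\<^sub>R H y) \<le> norm (exp (real n * norm y) *\<^sub>R H y)"
      by (auto intro!: mult_right_mono)
  qed measurable
qed

text \<open>A second-order Taylor bound in which only absolute values enter, so that a single
  exponential of \<open>norm y\<close> can dominate it.\<close>

lemma exp_remainder:
  fixes a d :: real
  shows "\<bar>exp (a + d) - exp a - d * exp a\<bar> \<le> d\<^sup>2 * exp (\<bar>a\<bar> + \<bar>d\<bar>)"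
proof -
  have "1 - d \<le> exp (- d)" using exp_ge_add_one_self[of "- d"] by simp
  then have "(1 - d) * exp d \<le> exp (- d) * exp d" by (intro mult_right_mono) auto
  then have 1: "exp d - 1 \<le> d * exp d" by (simp add: left_diff_distrib flip: exp_add)
  have 2: "1 + d \<le> exp d" by simp
  have 3: "exp d - 1 - d \<le> d * (exp d - 1)" using 1 by (simp add: algebra_simps)
  have 4: "\<bar>exp d - 1\<bar> \<le> \<bar>d\<bar> * exp \<bar>d\<bar>"
  proof (cases "0 \<le> d")
    case True
    then show ?thesis using 1 by simp
  next
    case False
    have "\<bar>d\<bar> * 1 \<le> \<bar>d\<bar> * exp \<bar>d\<bar>" by (intro mult_left_mono) auto
    moreover have "\<bar>exp d - 1\<bar> = 1 - exp d" "\<bar>d\<bar> = - d" using False by simp_all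
    ultimately show ?thesis using 2 by linarith
  qed
  have "\<bar>exp d - 1 - d\<bar> \<le> \<bar>d\<bar> * \<bar>exp d - 1\<bar>"
    using 2 3 abs_ge_self[of "d * (exp d - 1)"] unfolding abs_mult by linarith
  also have "\<dots> \<le> \<bar>d\<bar> * (\<bar>d\<bar> * exp \<bar>d\<bar>)" using 4 by (intro mult_left_mono) auto
  finally have "\<bar>exp d - 1 - d\<bar> \<le> d\<^sup>2 * exp \<bar>d\<bar>" by (simp add: power2_eq_square)
  then have "exp a * \<bar>exp d - 1 - d\<bar> \<le> exp \<bar>a\<bar> * (d\<^sup>2 * exp \<bar>d\<bar>)" by (intro mult_mono) auto
  moreover have "exp (a + d) - exp a - d * exp a = exp a * (exp d - 1 - d)" by (simp add: exp_add algebra_simps)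
  ultimately show ?thesis by (simp add: abs_mult exp_add mult_ac)
qed

lemma laplace_has_derivative:
  assumes H: "exp_integrable H"
  shows "(laplace H has_derivative (\<lambda>v. laplace (\<lambda>y. (v \<bullet> y) *\<^sub>R H y) x)) (at x)"
proof -
  have [measurable]: "H \<in> borel_measurable borel" using H by (simp add: exp_integrable_def)
  let ?L = "\<lambda>v. laplace (\<lambda>y. (v \<bullet> y) *\<^sub>R H y) x"
  note int = laplace_integrable[OF H] laplace_integrable[OF exp_integrable_inner[OF H]]
  have lin: "linear ?L"
  proof (rule linearI)
    show "?L (v + w) = ?L v + ?L w" for v w
      using int(2)[of x v] int(2)[of x w]
      by (simp add: laplace_def inner_add_left scaleR_add_left scaleR_add_right flip: Bochner_Integration.integral_add)
    show "?L (c *\<^sub>R v) = c *\<^sub>R ?L v" for c v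
      by (simp add: laplace_def scaleR_left_commute[of c] flip: integral_scaleR_right scaleR_scaleR)
  qed
  \<comment> \<open>The margin 3 covers \<open>(h \<bullet> y)\<^sup>2\<close>, which costs
    \<open>exp (2 * norm y)\<close>, and \<open>exp \<bar>h \<bullet> y\<bar>\<close>, which costs
    \<open>exp (norm y)\<close>.\<close>
  obtain n where n: "norm x + 3 \<le> real n" using real_arch_simple by blast
  define K where "K = (\<integral>y. norm (exp (real n * norm y) *\<^sub>R H y) \<partial>lborel)"
  have intK: "integrable lborel (\<lambda>y. norm (exp (real n * norm y) *\<^sub>R H y))"
    using H by (intro integrable_norm) (simp add: exp_integrable_def)
  have bound: "norm (laplace H (x + h) - laplace H x - ?L h) \<le> (norm h)\<^sup>2 * K" if h: "norm h \<le> 1" for h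
  proof -
    have "laplace H (x + h) - laplace H x - ?L h
        = (\<integral>y. exp ((x + h) \<bullet> y) *\<^sub>R H y - exp (x \<bullet> y) *\<^sub>R H y - exp (x \<bullet> y) *\<^sub>R (h \<bullet> y) *\<^sub>R H y \<partial>lborel)"
      unfolding laplace_def
      by (simp only: Bochner_Integration.integral_diff[OF int(1) int(1)]
          Bochner_Integration.integral_diff[OF Bochner_Integration.integrable_diff[OF int(1) int(1)] int(2)])
    also have "norm \<dots> \<le> (\<integral>y. (norm h)\<^sup>2 * norm (exp (real n * norm y) *\<^sub>R H y) \<partial>lborel)"
    proof (rule Bochner_Integration.integral_norm_bound_integral)
      show "integrable lborel (\<lambda>y. exp ((x + h) \<bullet> y) *\<^sub>R H y - exp (x \<bullet> y) *\<^sub>R H y - exp (x \<bullet> y) *\<^sub>R (h \<bullet> y) *\<^sub>R H y)"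
        by (intro Bochner_Integration.integrable_diff int)
      show "integrable lborel (\<lambda>y. (norm h)\<^sup>2 * norm (exp (real n * norm y) *\<^sub>R H y))"
        by (intro integrable_mult_right intK)
      fix y
      have hy: "\<bar>h \<bullet> y\<bar> \<le> norm h * norm y" by (rule Cauchy_Schwarz_ineq2)
      then have hy1: "\<bar>h \<bullet> y\<bar> \<le> norm y" using mult_right_mono[OF h, of "norm y"] by simp
      have "(h \<bullet> y)\<^sup>2 \<le> (norm h * norm y)\<^sup>2" using power_mono[OF hy abs_ge_zero, of 2] by simp
      also have "\<dots> \<le> (norm h)\<^sup>2 * (exp (norm y))\<^sup>2"
        unfolding power_mult_distrib by (intro mult_left_mono power_mono le_exp_self) auto
      finally have sq: "(h \<bullet> y)\<^sup>2 \<le> (norm h)\<^sup>2 * exp (2 * norm y)"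
        by (simp add: exp_double)
      have "\<bar>x \<bullet> y\<bar> \<le> norm x * norm y" by (rule Cauchy_Schwarz_ineq2)
      then have ee: "exp (\<bar>x \<bullet> y\<bar> + \<bar>h \<bullet> y\<bar>) \<le> exp (norm x * norm y + norm y)" using hy1 by simp
      have "\<bar>exp ((x + h) \<bullet> y) - exp (x \<bullet> y) - (h \<bullet> y) * exp (x \<bullet> y)\<bar>
          \<le> (h \<bullet> y)\<^sup>2 * exp (\<bar>x \<bullet> y\<bar> + \<bar>h \<bullet> y\<bar>)"
        unfolding inner_add_left by (rule exp_remainder)
      also have "\<dots> \<le> ((norm h)\<^sup>2 * exp (2 * norm y)) * exp (norm x * norm y + norm y)"
        by (intro mult_mono sq ee) auto
      also have "\<dots> = (norm h)\<^sup>2 * exp ((norm x + 3) * norm y)"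
        by (simp add: mult.assoc algebra_simps flip: exp_add)
      also have "\<dots> \<le> (norm h)\<^sup>2 * exp (real n * norm y)"
        using n by (intro mult_left_mono) (auto intro: mult_right_mono)
      finally have "\<bar>exp ((x + h) \<bullet> y) - exp (x \<bullet> y) - (h \<bullet> y) * exp (x \<bullet> y)\<bar> * norm (H y)
          \<le> (norm h)\<^sup>2 * exp (real n * norm y) * norm (H y)" by (rule mult_right_mono) simp
      moreover have "exp ((x + h) \<bullet> y) *\<^sub>R H y - exp (x \<bullet> y) *\<^sub>R H y - exp (x \<bullet> y) *\<^sub>R (h \<bullet> y) *\<^sub>R H y
         = (exp ((x + h) \<bullet> y) - exp (x \<bullet> y) - (h \<bullet> y) * exp (x \<bullet> y)) *\<^sub>R H y"
        by (simp add: scaleR_diff_left mult.commute)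
      ultimately show "norm (exp ((x + h) \<bullet> y) *\<^sub>R H y - exp (x \<bullet> y) *\<^sub>R H y - exp (x \<bullet> y) *\<^sub>R (h \<bullet> y) *\<^sub>R H y)
          \<le> (norm h)\<^sup>2 * norm (exp (real n * norm y) *\<^sub>R H y)"
        by (simp add: mult.assoc)
    qed
    also have "\<dots> = (norm h)\<^sup>2 * K" by (simp add: K_def)
    finally show ?thesis .
  qed
  show ?thesis
  proof (rule has_derivativeI_sandwich[of 1])
    show "bounded_linear ?L" using lin by (simp add: linear_conv_bounded_linear)
    show "norm (laplace H y - laplace H x - ?L (y - x)) / norm (y - x) \<le> norm (y - x) * K"
      if "y \<noteq> x" "dist y x < 1" for y
      using bound[of "y - x"] that by (simp add: dist_norm divide_le_eq power2_eq_square mult_ac)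
    have "((\<lambda>y. norm (y - x) * K) \<longlongrightarrow> norm (x - x) * K) (at x)" by (intro tendsto_intros)
    then show "((\<lambda>y. norm (y - x) * K) \<longlongrightarrow> 0) (at x)" by simp
  qed simp
qed

lemma Ck_laplace: "exp_integrable H \<Longrightarrow> Ck k (laplace H)"
proof (induction k arbitrary: H)
  case 0
  have "isCont (laplace H) x" for x
    using laplace_has_derivative[OF 0] by (rule has_derivative_continuous)
  then show ?case by (simp add: continuous_at_imp_continuous_on)
next
  case (Suc k)
  show ?case
    by (rule Ck_SucI[OF laplace_has_derivative[OF Suc.prems]])
      (rule Suc.IH[OF exp_integrable_inner[OF Suc.prems]])
qed

section \<open>Gaussian averages of nonexpansive maps\<close>

definition gauss :: "'a::real_normed_vector \<Rightarrow> real" where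
  "gauss z = exp (- (norm z)\<^sup>2)"

text \<open>Left unnormalized, since only the direction of the average is used in the end. At
  \<open>s = 1\<close> the point \<open>x\<close> drops out.\<close>

definition mollify :: "real \<Rightarrow> ('a::euclidean_space \<Rightarrow> 'a) \<Rightarrow> 'a \<Rightarrow> 'a" where
  "mollify s G x = (\<integral>z. gauss z *\<^sub>R G ((1 - s) *\<^sub>R x + s *\<^sub>R z) \<partial>lborel)"

definition gauss_mass :: "'a::euclidean_space itself \<Rightarrow> real" where
  "gauss_mass _ = (\<integral>z. gauss (z::'a) \<partial>lborel)"

lemma gauss_pos: "0 < gauss z" by (simp add: gauss_def)

lemma gauss_continuous: "continuous_on UNIV (gauss :: 'a::euclidean_space \<Rightarrow> real)"
  unfolding gauss_def by (intro continuous_intros)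

lemma gauss_measurable [measurable]: "(gauss :: 'a::euclidean_space \<Rightarrow> real) \<in> borel_measurable borel"
  using gauss_continuous by (rule borel_measurable_continuous_onI)

lemma gauss_exp_integrable: "integrable lborel (\<lambda>z::'a::euclidean_space. gauss z * exp (c * norm z))"
  using gaussian_exp_integrable[of c] by (simp add: gauss_def add.commute flip: exp_add)

lemma gauss_integrable: "integrable lborel (gauss :: 'a::euclidean_space \<Rightarrow> real)"
  using gauss_exp_integrable[of 0] by simp

text \<open>The set where \<open>f\<close> is positive is open and nonempty, hence not
  negligible.\<close>

lemma integral_pos_continuous:
  fixes f :: "'a::euclidean_space \<Rightarrow> real"
  assumes "integrable lborel f" "continuous_on UNIV f" "\<And>z. 0 \<le> f z" "0 < f z0"
  shows "0 < (\<integral>z. f z \<partial>lborel)"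
proof -
  have "(\<integral>z. f z \<partial>lborel) \<noteq> 0"
  proof
    assume "(\<integral>z. f z \<partial>lborel) = 0"
    then have "AE z in lborel. f z = 0"
      using integral_nonneg_eq_0_iff_AE[OF assms(1)] assms(3) by simp
    then have "AE z in lebesgue. f z = 0" by (rule AE_completion)
    moreover have S: "{z. 0 < f z} \<in> sets lebesgue"
      using assms(2) by (intro sets_completionI_sets) (simp add: borel_open open_Collect_less)
    ultimately have "{z. 0 < f z} \<in> null_sets lebesgue"
      by (subst AE_iff_null_sets[OF S]) (auto elim: eventually_mono)
    then have "negligible {z. 0 < f z}" by (simp add: negligible_iff_null_sets)
    moreover have "open {z. 0 < f z}" using assms(2) by (intro open_Collect_less continuous_on_const)
    ultimately show False using open_not_negligible assms(4) by blast
  qed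
  moreover have "0 \<le> (\<integral>z. f z \<partial>lborel)" using assms(3) by simp
  ultimately show ?thesis by simp
qed

lemma gauss_mass_pos: "0 < gauss_mass TYPE('a::euclidean_space)"
  unfolding gauss_mass_def
  by (rule integral_pos_continuous[OF gauss_integrable gauss_continuous, of 0])
    (auto simp: gauss_pos less_imp_le)

lemma mollify_integrand_continuous:
  assumes "conic_nonexpansive G"
  shows "continuous_on UNIV (\<lambda>z::'a::euclidean_space. gauss z *\<^sub>R G ((1 - s) *\<^sub>R x + s *\<^sub>R z))"
proof -
  have "continuous_on UNIV (\<lambda>z. G ((1 - s) *\<^sub>R x + s *\<^sub>R z))"
    by (rule continuous_on_compose2[OF conic_nonexpansive_continuous[OF assms, of UNIV]])
      (auto intro!: continuous_intros)
  then show ?thesis by (intro continuous_on_scaleR gauss_continuous)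
qed

lemma gauss_growth_integrable:
  fixes f :: "'a::euclidean_space \<Rightarrow> 'b::{banach, second_countable_topology}"
  assumes "continuous_on UNIV f" "\<And>z. norm (f z) \<le> gauss z * (a + b * norm z)" "0 \<le> a" "0 \<le> b"
  shows "integrable lborel f"
proof (rule Bochner_Integration.integrable_bound)
  show "integrable lborel (\<lambda>z::'a. (a + b) * (gauss z * exp (1 * norm z)))"
    by (intro integrable_mult_right gauss_exp_integrable)
  show "f \<in> borel_measurable lborel" using borel_measurable_continuous_onI[OF assms(1)] by simp
  have "norm (f z) \<le> norm ((a + b) * (gauss z * exp (1 * norm z)))" for z
  proof -
    have "a * 1 \<le> a * exp (norm z)" by (rule mult_left_mono) (use assms(3) in auto)
    moreover have "b * norm z \<le> b * exp (norm z)" by (rule mult_left_mono[OF le_exp_self assms(4)])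
    ultimately have "a + b * norm z \<le> (a + b) * exp (norm z)" by (simp add: distrib_right)
    then have "gauss z * (a + b * norm z) \<le> gauss z * ((a + b) * exp (norm z))"
      using gauss_pos[of z] by (intro mult_left_mono) auto
    also have "\<dots> \<le> norm ((a + b) * (gauss z * exp (1 * norm z)))" by (simp add: mult_ac)
    finally show ?thesis using assms(2)[of z] by linarith
  qed
  then show "AE z in lborel. norm (f z) \<le> norm ((a + b) * (gauss z * exp (1 * norm z)))" by simp
qed

lemma norm_blend:
  assumes s: "0 \<le> s" "s \<le> 1"
  shows "norm ((1 - s) *\<^sub>R x + s *\<^sub>R (z::'a::real_normed_vector)) \<le> norm x + norm z"
proof -
  have "norm ((1 - s) *\<^sub>R x + s *\<^sub>R z) \<le> (1 - s) * norm x + s * norm z"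
    using norm_triangle_ineq[of "(1 - s) *\<^sub>R x" "s *\<^sub>R z"] s by simp
  also have "\<dots> \<le> 1 * norm x + 1 * norm z" using s by (intro add_mono mult_right_mono) auto
  finally show ?thesis by simp
qed

context
  fixes s :: real
  assumes s: "0 \<le> s" "s \<le> 1"
begin

lemma mollify_integrable:
  assumes G: "conic_nonexpansive G"
  shows "integrable lborel (\<lambda>z::'a::euclidean_space. gauss z *\<^sub>R G ((1 - s) *\<^sub>R x + s *\<^sub>R z))"
proof (rule gauss_growth_integrable[OF mollify_integrand_continuous[OF G], of _ _ "norm x" 1])
  show "norm (gauss z *\<^sub>R G ((1 - s) *\<^sub>R x + s *\<^sub>R z)) \<le> gauss z * (norm x + 1 * norm z)" for z
    using norm_blend[OF s, of x z] gauss_pos[of z] by (simp add: conic_nonexpansiveD(1)[OF G])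
qed auto

lemma mollify_lipschitz:
  assumes G: "conic_nonexpansive G"
  shows "norm (mollify s G x - mollify s G (y::'a::euclidean_space)) \<le> gauss_mass TYPE('a) * (1 - s) * norm (x - y)"
proof -
  have "mollify s G x - mollify s G y
      = (\<integral>z. gauss z *\<^sub>R G ((1 - s) *\<^sub>R x + s *\<^sub>R z) - gauss z *\<^sub>R G ((1 - s) *\<^sub>R y + s *\<^sub>R z) \<partial>lborel)"
    unfolding mollify_def by (simp only: Bochner_Integration.integral_diff[OF mollify_integrable[OF G] mollify_integrable[OF G]])
  also have "norm \<dots> \<le> (\<integral>z. gauss z * ((1 - s) * norm (x - y)) \<partial>(lborel :: 'a measure))"
  proof (rule Bochner_Integration.integral_norm_bound_integral)
    fix z
    have "norm (G ((1 - s) *\<^sub>R x + s *\<^sub>R z) - G ((1 - s) *\<^sub>R y + s *\<^sub>R z)) \<le> norm ((1 - s) *\<^sub>R (x - y))"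
      using conic_nonexpansive_lipschitz[OF G, of "(1 - s) *\<^sub>R x + s *\<^sub>R z" "(1 - s) *\<^sub>R y + s *\<^sub>R z"]
      by (simp add: scaleR_diff_right)
    then have "gauss z * norm (G ((1 - s) *\<^sub>R x + s *\<^sub>R z) - G ((1 - s) *\<^sub>R y + s *\<^sub>R z)) \<le> gauss z * ((1 - s) * norm (x - y))"
      using s gauss_pos[of z] by (intro mult_left_mono) auto
    then show "norm (gauss z *\<^sub>R G ((1 - s) *\<^sub>R x + s *\<^sub>R z) - gauss z *\<^sub>R G ((1 - s) *\<^sub>R y + s *\<^sub>R z)) \<le> gauss z * ((1 - s) * norm (x - y))"
      using gauss_pos[of z] by (simp flip: scaleR_diff_right)
  qed (intro Bochner_Integration.integrable_diff mollify_integrable G integrable_mult_left gauss_integrable)+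
  also have "\<dots> = gauss_mass TYPE('a) * (1 - s) * norm (x - y)"
    by (simp add: gauss_mass_def)
  finally show ?thesis .
qed

text \<open>By symmetry the Gaussian average of \<open>(1 - s) x + s z\<close> over \<open>z\<close> is \<open>(1 - s) x\<close>; hence mollifying a
  nonexpansive map does not decrease inner products against its values.\<close>
lemma mollify_inner:
  fixes G :: "'a::euclidean_space \<Rightarrow> 'a"
  assumes G: "conic_nonexpansive G" and s0: "0 < s" and strict: "\<exists>y. y \<bullet> x' < G y \<bullet> G x'"
  shows "gauss_mass TYPE('a) * (1 - s) * (x \<bullet> x') < mollify s G x \<bullet> G x'"
proof -
  let ?p = "\<lambda>z. (1 - s) *\<^sub>R x + s *\<^sub>R z"
  let ?D = "\<lambda>z. gauss z * (G (?p z) \<bullet> G x' - ?p z \<bullet> x')"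
  have i1: "integrable lborel (\<lambda>z. gauss z *\<^sub>R G (?p z) \<bullet> G x')"
    by (intro integrable_inner_left mollify_integrable[OF G])
  have idG: "conic_nonexpansive (\<lambda>x::'a. x)" by (simp add: conic_nonexpansive_def)
  have iz: "integrable lborel (\<lambda>z::'a. gauss z *\<^sub>R z)"
    by (rule gauss_growth_integrable[of _ 0 1])
      (auto intro!: continuous_intros gauss_continuous simp: gauss_pos less_imp_le)
  have i2: "integrable lborel (\<lambda>z. gauss z *\<^sub>R ?p z \<bullet> x')"
    by (intro integrable_inner_left mollify_integrable[OF idG])
  have eq: "?D = (\<lambda>z. gauss z *\<^sub>R G (?p z) \<bullet> G x' - gauss z *\<^sub>R ?p z \<bullet> x')"
    by (simp add: fun_eq_iff right_diff_distrib)
  obtain y where y: "y \<bullet> x' < G y \<bullet> G x'" using strict by blast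
  have "0 < (\<integral>z. ?D z \<partial>lborel)"
  proof (rule integral_pos_continuous)
    show "integrable lborel ?D" unfolding eq by (intro Bochner_Integration.integrable_diff i1 i2)
    have "continuous_on UNIV (\<lambda>z. gauss z *\<^sub>R G (?p z) \<bullet> G x' - gauss z *\<^sub>R ?p z \<bullet> x')"
      by (intro continuous_on_diff continuous_on_inner continuous_on_const mollify_integrand_continuous[OF G] mollify_integrand_continuous[OF idG])
    then show "continuous_on UNIV ?D" unfolding eq .
    show "0 \<le> ?D z" for z
      using gauss_pos[of z] conic_nonexpansiveD(2)[OF G, of "?p z" x'] by simp
    \<comment> \<open>The point \<open>z\<close> at which the blended argument equals the witness
      \<open>y\<close>; it exists because \<open>0 < s\<close>.\<close>
    have p: "?p ((1 / s) *\<^sub>R (y - (1 - s) *\<^sub>R x)) = y" using s0 by simp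
    show "0 < ?D ((1 / s) *\<^sub>R (y - (1 - s) *\<^sub>R x))"
      unfolding p by (rule mult_pos_pos[OF gauss_pos]) (use y in simp)
  qed
  also have "(\<integral>z. ?D z \<partial>lborel) = mollify s G x \<bullet> G x' - (\<integral>z. gauss z *\<^sub>R ?p z \<bullet> x' \<partial>lborel)"
    unfolding eq Bochner_Integration.integral_diff[OF i1 i2] mollify_def
    by (simp only: integral_inner_left[OF mollify_integrable[OF G]])
  also have "(\<integral>z. gauss z *\<^sub>R ?p z \<bullet> x' \<partial>lborel) = gauss_mass TYPE('a) * (1 - s) * (x \<bullet> x')"
  proof -
    have "(\<integral>z. gauss z *\<^sub>R z \<partial>lborel) = (\<integral>z. gauss (- z) *\<^sub>R (- z) \<partial>(lborel :: 'a measure))"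
      by (rule integral_reflect_origin[symmetric]) measurable
    also have "\<dots> = - (\<integral>z. gauss z *\<^sub>R z \<partial>lborel)" by (simp add: gauss_def)
    finally have z0: "(\<integral>z. gauss z *\<^sub>R z \<partial>(lborel :: 'a measure)) = 0"
      by (simp add: eq_neg_iff_add_eq_0 flip: scaleR_2)
    have "(\<integral>z. gauss z *\<^sub>R ?p z \<bullet> x' \<partial>lborel) = (\<integral>z. gauss z * ((1 - s) * (x \<bullet> x')) + s * (gauss z *\<^sub>R z \<bullet> x') \<partial>lborel)"
      by (simp add: inner_add_left algebra_simps)
    also have "\<dots> = (\<integral>z. gauss z * ((1 - s) * (x \<bullet> x')) \<partial>(lborel :: 'a measure)) + (\<integral>z. s * (gauss z *\<^sub>R z \<bullet> x') \<partial>lborel)"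
      by (intro Bochner_Integration.integral_add integrable_mult_left integrable_mult_right gauss_integrable integrable_inner_left iz)
    also have "(\<integral>z. s * (gauss z *\<^sub>R z \<bullet> x') \<partial>lborel) = s * ((\<integral>z. gauss z *\<^sub>R z \<partial>lborel) \<bullet> x')"
      by (simp only: integral_mult_right_zero integral_inner_left[OF iz])
    finally show ?thesis by (simp add: z0 gauss_mass_def)
  qed
  finally show ?thesis by simp
qed

text \<open>Joint continuity in the parameter and the map. A change of \<open>s\<close> moves the
  argument by \<open>\<bar>s' - s\<bar> * norm (z - x)\<close>; a change of the map costs, by
  homogeneity, \<open>d\<close> times the norm of the argument. Both grow linearly in
  \<open>norm z\<close>, which the Gaussian integrates.\<close>

lemma mollify_dist:
  fixes G G' :: "'a::euclidean_space \<Rightarrow> 'a"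
  assumes G: "conic_nonexpansive G" and G': "conic_nonexpansive G'"
    and s': "0 \<le> s'" "s' \<le> 1" and x: "norm x = 1"
    and d: "\<And>y. norm y = 1 \<Longrightarrow> norm (G' y - G y) \<le> d" "0 \<le> d"
  shows "norm (mollify s' G' x - mollify s G x) \<le> (\<bar>s' - s\<bar> + d) * (\<integral>z. gauss z * (1 + norm z) \<partial>(lborel :: 'a measure))"
proof -
  let ?p = "\<lambda>t z. (1 - t) *\<^sub>R x + t *\<^sub>R z"
  have i1: "integrable lborel (\<lambda>z. gauss z *\<^sub>R G (?p s z))" by (rule mollify_integrable[OF G])
  have i2: "integrable lborel (\<lambda>z. gauss z *\<^sub>R G' (?p s' z))"
  proof (rule gauss_growth_integrable[OF mollify_integrand_continuous[OF G'], of _ _ "norm x" 1])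
    show "norm (gauss z *\<^sub>R G' (?p s' z)) \<le> gauss z * (norm x + 1 * norm z)" for z
      using norm_blend[OF s', of x z] gauss_pos[of z] by (simp add: conic_nonexpansiveD(1)[OF G'])
  qed auto
  have "mollify s' G' x - mollify s G x = (\<integral>z. gauss z *\<^sub>R G' (?p s' z) - gauss z *\<^sub>R G (?p s z) \<partial>lborel)"
    unfolding mollify_def by (simp only: Bochner_Integration.integral_diff[OF i2 i1])
  also have "norm \<dots> \<le> (\<integral>z. (\<bar>s' - s\<bar> + d) * (gauss z * (1 + norm z)) \<partial>(lborel :: 'a measure))"
  proof (rule Bochner_Integration.integral_norm_bound_integral)
    show "integrable lborel (\<lambda>z::'a. (\<bar>s' - s\<bar> + d) * (gauss z * (1 + norm z)))"
      by (intro integrable_mult_right gauss_growth_integrable[of _ 1 1])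
        (auto intro!: continuous_intros gauss_continuous simp: gauss_pos less_imp_le abs_mult)
    fix z :: 'a
    have 1: "norm (G' (?p s' z) - G' (?p s z)) \<le> \<bar>s' - s\<bar> * (1 + norm z)"
    proof -
      have "norm (G' (?p s' z) - G' (?p s z)) \<le> norm (?p s' z - ?p s z)"
        by (rule conic_nonexpansive_lipschitz[OF G'])
      also have "?p s' z - ?p s z = (s' - s) *\<^sub>R (z - x)" by (simp add: algebra_simps)
      also have "norm \<dots> \<le> \<bar>s' - s\<bar> * (1 + norm z)"
        using norm_triangle_ineq4[of z x] x by (simp add: mult_left_mono)
      finally show ?thesis .
    qed
    have 2: "norm (G' (?p s z) - G (?p s z)) \<le> d * (1 + norm z)"
    proof (cases "?p s z = 0")
      case True
      then show ?thesis using conic_nonexpansiveD(1)[OF G, of 0] conic_nonexpansiveD(1)[OF G', of 0] d(2) by simp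
    next
      case False
      let ?n = "norm (?p s z)"
      have eq: "?p s z = ?n *\<^sub>R sgn (?p s z)" using False by (simp add: sgn_div_norm)
      have "G' (?p s z) - G (?p s z) = ?n *\<^sub>R (G' (sgn (?p s z)) - G (sgn (?p s z)))"
        by (subst (1 2) eq) (simp only: conic_nonexpansiveD(3)[OF G norm_ge_zero] conic_nonexpansiveD(3)[OF G' norm_ge_zero] scaleR_diff_right)
      then have "norm (G' (?p s z) - G (?p s z)) \<le> ?n * d"
        using d(1)[of "sgn (?p s z)"] False by (simp add: norm_sgn mult_left_mono)
      also have "\<dots> \<le> (1 + norm z) * d" using norm_blend[OF s, of x z] x d(2) by (intro mult_right_mono) auto
      finally show ?thesis by (simp add: mult.commute)
    qed
    have "norm (G' (?p s' z) - G (?p s z)) \<le> (\<bar>s' - s\<bar> + d) * (1 + norm z)"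
      using norm_triangle_ineq[of "G' (?p s' z) - G' (?p s z)" "G' (?p s z) - G (?p s z)"] 1 2
      by (simp add: distrib_right)
    then have "gauss z * norm (G' (?p s' z) - G (?p s z)) \<le> gauss z * ((\<bar>s' - s\<bar> + d) * (1 + norm z))"
      using gauss_pos[of z] by (intro mult_left_mono) auto
    then show "norm (gauss z *\<^sub>R G' (?p s' z) - gauss z *\<^sub>R G (?p s z)) \<le> (\<bar>s' - s\<bar> + d) * (gauss z * (1 + norm z))"
      using gauss_pos[of z] by (simp add: mult_ac flip: scaleR_diff_right)
  qed (intro Bochner_Integration.integrable_diff i1 i2)
  finally show ?thesis by simp
qed

end

lemma mollify_zero:
  assumes "conic_nonexpansive G" shows "mollify 0 G x = gauss_mass TYPE('a) *\<^sub>R G (x::'a::euclidean_space)"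
  unfolding mollify_def gauss_mass_def using integral_scaleR_left[OF gauss_integrable, of "G x"] by simp

lemma mollify_const_direction:
  assumes "0 \<le> s" "s \<le> 1" "\<And>y. G y = norm y *\<^sub>R v"
  obtains c where "0 \<le> c" "mollify s G x = c *\<^sub>R (v::'a::euclidean_space)"
proof -
  let ?f = "\<lambda>z::'a. gauss z * norm ((1 - s) *\<^sub>R x + s *\<^sub>R z)"
  have "mollify s G x = (\<integral>z. ?f z *\<^sub>R v \<partial>lborel)" by (simp add: mollify_def assms(3))
  also have "\<dots> = (\<integral>z. ?f z \<partial>lborel) *\<^sub>R v"
  proof (rule integral_scaleR_left)
    show "integrable lborel ?f"
    proof (rule gauss_growth_integrable[of _ "norm x" 1])
      show "continuous_on UNIV ?f" by (intro continuous_intros gauss_continuous)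
      show "norm (?f z) \<le> gauss z * (norm x + 1 * norm z)" for z
        using norm_blend[OF assms(1,2), of x z] gauss_pos[of z] by (simp add: abs_mult)
    qed auto
  qed
  finally have "mollify s G x = (\<integral>z. ?f z \<partial>lborel) *\<^sub>R v" .
  moreover have "0 \<le> (\<integral>z. ?f z \<partial>lborel)"
    by (intro Bochner_Integration.integral_nonneg mult_nonneg_nonneg less_imp_le[OF gauss_pos]) simp
  ultimately show ?thesis using that by blast
qed

lemma exp_integrable_gauss:
  assumes G: "conic_nonexpansive (G :: 'a::euclidean_space \<Rightarrow> 'a)"
  shows "exp_integrable (\<lambda>y. gauss y *\<^sub>R G y)"
  unfolding exp_integrable_def
proof (intro conjI allI)
  have c: "continuous_on UNIV (\<lambda>y. gauss y *\<^sub>R G y)"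
    using mollify_integrand_continuous[OF G, of 1 0] by simp
  then show "(\<lambda>y. gauss y *\<^sub>R G y) \<in> borel_measurable borel" by (rule borel_measurable_continuous_onI)
  fix n
  show "integrable lborel (\<lambda>y. exp (real n * norm y) *\<^sub>R gauss y *\<^sub>R G y)"
  proof (rule Bochner_Integration.integrable_bound)
    show "integrable lborel (\<lambda>z::'a. gauss z * exp (real (Suc n) * norm z))" by (rule gauss_exp_integrable)
    have "continuous_on UNIV (\<lambda>y. exp (real n * norm y) *\<^sub>R gauss y *\<^sub>R G y)"
      by (intro continuous_intros c)
    then show "(\<lambda>y. exp (real n * norm y) *\<^sub>R gauss y *\<^sub>R G y) \<in> borel_measurable lborel"
      using borel_measurable_continuous_onI by simp
    have "norm (exp (real n * norm y) *\<^sub>R gauss y *\<^sub>R G y) \<le> norm (gauss y * exp (real (Suc n) * norm y))" for y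
    proof -
      have "(exp (real n * norm y) * gauss y) * norm y \<le> (exp (real n * norm y) * gauss y) * exp (norm y)"
        using gauss_pos[of y] by (intro mult_left_mono le_exp_self) auto
      also have "\<dots> = gauss y * exp (real (Suc n) * norm y)"
        by (simp add: distrib_right exp_add)
      finally show ?thesis using gauss_pos[of y] by (simp add: conic_nonexpansiveD(1)[OF G] abs_mult mult_ac)
    qed
    then show "AE y in lborel. norm (exp (real n * norm y) *\<^sub>R gauss y *\<^sub>R G y) \<le> norm (gauss y * exp (real (Suc n) * norm y))"
      by simp
  qed
qed

text \<open>Completing the square turns the Gaussian average into a Laplace transform.\<close>
lemma mollify_laplace:
  fixes G :: "'a::euclidean_space \<Rightarrow> 'a"
  assumes G: "conic_nonexpansive G" and s: "0 < s" and a: "a = (1 - s) / s"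
  shows "mollify s G x = (s * gauss (a *\<^sub>R x)) *\<^sub>R laplace (\<lambda>y. gauss y *\<^sub>R G y) ((2 * a) *\<^sub>R x)"
proof -
  have Gm: "G \<in> borel_measurable borel"
    using conic_nonexpansive_continuous[OF G, of UNIV] by (rule borel_measurable_continuous_onI)
  \<comment> \<open>Homogeneity lets \<open>s\<close> be pulled out of \<open>G\<close>, which
    leaves a translation by \<open>a x\<close>.\<close>
  have e1: "(1 - s) *\<^sub>R x + s *\<^sub>R z = s *\<^sub>R (a *\<^sub>R x + z)" for z
    using s by (simp add: a scaleR_right_distrib)
  have "mollify s G x = (\<integral>z. s *\<^sub>R (gauss z *\<^sub>R G (a *\<^sub>R x + z)) \<partial>lborel)"
    unfolding mollify_def e1 conic_nonexpansiveD(3)[OF G less_imp_le[OF s]] by (simp only: scaleR_left_commute)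
  also have "\<dots> = s *\<^sub>R (\<integral>z. gauss (a *\<^sub>R x + z - a *\<^sub>R x) *\<^sub>R G (a *\<^sub>R x + z) \<partial>lborel)"
    by (simp only: integral_scaleR_right add_diff_cancel_left')
  also have "(\<integral>z. gauss (a *\<^sub>R x + z - a *\<^sub>R x) *\<^sub>R G (a *\<^sub>R x + z) \<partial>lborel)
      = (\<integral>y. gauss (y - a *\<^sub>R x) *\<^sub>R G y \<partial>lborel)"
    by (rule integral_translate[of "\<lambda>y. gauss (y - a *\<^sub>R x) *\<^sub>R G y"]) (use Gm in measurable)
  also have "\<dots> = (\<integral>y. gauss (a *\<^sub>R x) *\<^sub>R (exp (((2 * a) *\<^sub>R x) \<bullet> y) *\<^sub>R gauss y *\<^sub>R G y) \<partial>lborel)"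
  proof -
    have "gauss (y - a *\<^sub>R x) = gauss (a *\<^sub>R x) * (exp (((2 * a) *\<^sub>R x) \<bullet> y) * gauss y)" for y
      unfolding gauss_def power2_norm_eq_inner exp_add[symmetric]
      by (simp add: inner_diff inner_commute)
    then show ?thesis by simp
  qed
  also have "\<dots> = gauss (a *\<^sub>R x) *\<^sub>R laplace (\<lambda>y. gauss y *\<^sub>R G y) ((2 * a) *\<^sub>R x)"
    unfolding laplace_def by (rule integral_scaleR_right)
  finally show ?thesis by simp
qed

lemma Ck_mollify:
  fixes G :: "'a::euclidean_space \<Rightarrow> 'a"
  assumes G: "conic_nonexpansive G" and s: "0 < s"
  shows "Ck k (mollify s G)"
proof -
  define a where "a = (1 - s) / s"
  have lin: "Ck k (\<lambda>x::'a. c *\<^sub>R x)" for c k by (intro Ck_linear bounded_linear_scaleR_right)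
  have "Ck k (\<lambda>x::'a. exp (- ((a *\<^sub>R x) \<bullet> (a *\<^sub>R x))))"
    by (intro Ck_exp Ck_minus Ck_inner lin)
  then have "Ck k (\<lambda>x::'a. gauss (a *\<^sub>R x))" unfolding gauss_def power2_norm_eq_inner .
  moreover have "Ck k (\<lambda>x. laplace (\<lambda>y. gauss y *\<^sub>R G y) ((2 * a) *\<^sub>R x))"
    by (rule Ck_compose[OF lin Ck_laplace[OF exp_integrable_gauss[OF G]]])
  ultimately have "Ck k (\<lambda>x. (s * gauss (a *\<^sub>R x)) *\<^sub>R laplace (\<lambda>y. gauss y *\<^sub>R G y) ((2 * a) *\<^sub>R x))"
    by (intro Ck_scaleR Ck_mult Ck_const)
  then show ?thesis using mollify_laplace[OF G s a_def] by (metis (no_types, lifting) ext)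
qed

section \<open>The fibration of a sphere contraction\<close>

text \<open>The solution is already known to exist and to be continuous, so only differentiability
  is at stake. The candidate derivative solves the linearized equation; the lower bound
  \<open>B\<close> of the partial derivative \<open>A\<close> controls the error, part of which is
  absorbed on the left.\<close>

lemma implicit_function_derivative:
  fixes E :: "'a::euclidean_space * 'b::euclidean_space \<Rightarrow> 'b"
  assumes E0: "\<And>q. E (q, Z q) = 0" and Zc: "isCont Z q"
    and E': "(E has_derivative E') (at (q, Z q))" and inj: "\<And>\<zeta>. E' (0, \<zeta>) = 0 \<Longrightarrow> \<zeta> = 0"
  obtains Z' where "(Z has_derivative Z') (at q)" "\<And>v. E' (v, Z' v) = 0"
proof -
  interpret E': bounded_linear E' using E' has_derivative_bounded_linear by blast
  define A where "A \<zeta> = E' (0, \<zeta>)" for \<zeta>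
  have linA: "linear A" unfolding A_def
    by (rule linearI) (simp_all flip: E'.add E'.scaleR)
  have injA: "inj A" using inj linear_injective_0[OF linA] by (auto simp: A_def)
  obtain B where B: "0 < B" "\<And>x. B * norm x \<le> norm (A x)" using linear_inj_bounded_below_pos[OF linA injA] by blast
  obtain A' where A': "linear A'" "\<And>x. A (A' x) = x"
    using linear_surjective_right_inverse[OF linA linear_inj_imp_surj[OF linA injA]]
    by (auto simp: fun_eq_iff)
  define Z' where "Z' v = A' (- E' (v, 0))" for v
  have "linear (\<lambda>v. - E' (v, 0))"
  proof (rule linearI)
    show "- E' (v + w, 0) = - E' (v, 0) + - E' (w, 0)" for v w
      using E'.add[of "(v, 0)" "(w, 0)"] by simp
    show "- E' (c *\<^sub>R v, 0) = c *\<^sub>R (- E' (v, 0))" for c v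
      using E'.scaleR[of c "(v, 0)"] by simp
  qed
  from linear_compose[OF this A'(1)] have linZ: "linear Z'" unfolding Z'_def[abs_def] o_def .
  then have blZ: "bounded_linear Z'" by (simp add: linear_conv_bounded_linear)
  have split: "E' (v, w) = A (w - Z' v)" for v w
  proof -
    have "E' (v, w) = E' (v, 0) + E' (0, w)" by (simp flip: E'.add)
    also have "E' (v, 0) = - A (Z' v)" by (simp add: Z'_def A'(2))
    finally show ?thesis by (simp add: A_def[symmetric] linear_diff[OF linA])
  qed
  obtain C where C: "0 < C" "\<And>v. norm (Z' v) \<le> C * norm v"
    using bounded_linear.pos_bounded[OF blZ] by (auto simp: mult.commute)
  have "(Z has_derivative Z') (at q)"
    unfolding has_derivative_at_alt
  proof (intro conjI allI impI blZ)
    fix e :: real assume e: "0 < e"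
    \<comment> \<open>The first bound lets half of the left side absorb the error
      \<open>norm (\<delta> - Z' k)\<close>; the second keeps the remaining term below
      \<open>e * B / 2\<close> times \<open>norm k\<close>.\<close>
    define \<eta> where "\<eta> = min (B / 2) (e * B / (2 * (1 + C)))"
    have \<eta>: "0 < \<eta>" "\<eta> \<le> B / 2" "\<eta> * (1 + C) \<le> e * B / 2"
    proof -
      have "0 < e * B / (2 * (1 + C))" using B(1) C(1) e by simp
      then show "0 < \<eta>" using B(1) by (simp add: \<eta>_def)
      show "\<eta> \<le> B / 2" unfolding \<eta>_def by (rule min.cobounded1)
      have "\<eta> \<le> e * B / (2 * (1 + C))" by (simp add: \<eta>_def)
      then have "\<eta> * (1 + C) \<le> e * B / (2 * (1 + C)) * (1 + C)" using C by (intro mult_right_mono) auto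
      also have "e * B / (2 * (1 + C)) * (1 + C) = e * B / 2" using C(1) by (simp add: field_simps)
      finally show "\<eta> * (1 + C) \<le> e * B / 2" .
    qed
    obtain d where d: "0 < d" "\<And>p. norm (p - (q, Z q)) < d \<Longrightarrow>
        norm (E p - E (q, Z q) - E' (p - (q, Z q))) \<le> \<eta> * norm (p - (q, Z q))"
      using E' \<eta>(1) unfolding has_derivative_at_alt by meson
    obtain d2 where d2: "0 < d2" "\<And>p. dist p q < d2 \<Longrightarrow> dist (Z p) (Z q) < d / 2"
      using Zc d(1) unfolding continuous_at_eps_delta by (meson half_gt_zero)
    show "\<exists>d>0. \<forall>y. norm (y - q) < d \<longrightarrow> norm (Z y - Z q - Z' (y - q)) \<le> e * norm (y - q)"
    proof (intro exI[of _ "min d2 (d / 2)"] conjI allI impI)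
      show "0 < min d2 (d / 2)" using d d2 by simp
      fix y assume y: "norm (y - q) < min d2 (d / 2)"
      define k where "k = y - q"
      define \<delta> where "\<delta> = Z y - Z q"
      have le: "norm (k, \<delta>) \<le> norm k + norm \<delta>" by (rule norm_Pair_le)
      have "norm \<delta> < d / 2" using d2(2)[of y] y by (simp add: \<delta>_def dist_norm)
      then have "norm (k, \<delta>) < d" using le y by (simp add: k_def)
      then have "norm (E (y, Z y) - E (q, Z q) - E' (k, \<delta>)) \<le> \<eta> * norm (k, \<delta>)"
        using d(2)[of "(y, Z y)"] by (simp add: k_def \<delta>_def)
      then have "norm (A (\<delta> - Z' k)) \<le> \<eta> * norm (k, \<delta>)" by (simp add: E0 split)
      also have "\<dots> \<le> \<eta> * (norm k + norm \<delta>)" using le \<eta>(1) by (intro mult_left_mono) auto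
      also have "norm \<delta> \<le> norm (\<delta> - Z' k) + C * norm k"
        using norm_triangle_ineq[of "\<delta> - Z' k" "Z' k"] C(2)[of k] by simp
      finally have "norm (A (\<delta> - Z' k)) \<le> \<eta> * (norm k + (norm (\<delta> - Z' k) + C * norm k))"
        using \<eta>(1) by (simp add: mult_left_mono)
      then have "B * norm (\<delta> - Z' k) \<le> \<eta> * (1 + C) * norm k + \<eta> * norm (\<delta> - Z' k)"
        using B(2)[of "\<delta> - Z' k"] by (simp add: algebra_simps)
      also have "\<dots> \<le> e * B / 2 * norm k + B / 2 * norm (\<delta> - Z' k)"
        using \<eta> by (intro add_mono mult_right_mono) auto
      finally have "B / 2 * norm (\<delta> - Z' k) \<le> B / 2 * (e * norm k)" by (simp add: field_simps)
      then show "norm (Z y - Z q - Z' (y - q)) \<le> e * norm (y - q)"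
        using B(1) by (simp add: k_def \<delta>_def)
    qed
  qed
  moreover have "E' (v, Z' v) = 0" for v by (simp add: split linear_0[OF linA])
  ultimately show ?thesis using that by blast
qed

section \<open>The linear maps sending a direction at \<open>q\<close> to the halves of its
  line\<close>

definition twist :: "real \<Rightarrow> real^3 \<Rightarrow> real^3 \<Rightarrow> real^3" where
  "twist e q u = u + e *\<^sub>R (q \<times> u)"

lemma twist_linear:
  "twist e q (u + v) = twist e q u + twist e q v"
  "twist e q (u - v) = twist e q u - twist e q v"
  "twist e q (c *\<^sub>R u) = c *\<^sub>R twist e q u" "twist e q 0 = 0"
  by (simp_all add: twist_def cross_add_right Cross3.right_diff_distrib cross_mult_right algebra_simps)

text \<open>The mixed terms cancel because the cross product with \<open>q\<close> is
  skew-symmetric. So the twists of opposite sign have the same Gram matrix, and one of them composed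
  with the inverse of the other is an isometry.\<close>

lemma twist_inner:
  assumes "e * e = 1"
  shows "twist e q u \<bullet> twist e q v = u \<bullet> v + (q \<times> u) \<bullet> (q \<times> v)"
    "twist (- e) q u \<bullet> twist (- e) q v = u \<bullet> v + (q \<times> u) \<bullet> (q \<times> v)"
proof -
  have a: "u \<bullet> (q \<times> v) + (q \<times> u) \<bullet> v = 0" by (simp add: cross3_simps)
  have b: "e * (e * x) = x" for x using assms by (simp flip: mult.assoc)
  have "e * (u \<bullet> (q \<times> v)) + e * ((q \<times> u) \<bullet> v) = 0" using a by (simp flip: distrib_left)
  then show "twist e q u \<bullet> twist e q v = u \<bullet> v + (q \<times> u) \<bullet> (q \<times> v)"
    "twist (- e) q u \<bullet> twist (- e) q v = u \<bullet> v + (q \<times> u) \<bullet> (q \<times> v)"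
    by (simp_all add: twist_def inner_add inner_diff b algebra_simps)
qed

lemma norm_twist: "e * e = 1 \<Longrightarrow> norm (twist (- e) q u) = norm (twist e q u)"
  by (simp add: norm_eq twist_inner)

lemma norm_twist_ge:
  assumes "e * e = 1" shows "norm u \<le> norm (twist e q u)"
  unfolding norm_le twist_inner(1)[OF assms] by simp

text \<open>The inverse of \<open>twist e q\<close> for \<open>e * e = 1\<close>; the formula comes
  from expanding \<open>q \<times> (q \<times> w)\<close>.\<close>

definition untwist :: "real \<Rightarrow> real^3 \<Rightarrow> real^3 \<Rightarrow> real^3" where
  "untwist e q w = (1 / (1 + q \<bullet> q)) *\<^sub>R (w - e *\<^sub>R (q \<times> w) + (q \<bullet> w) *\<^sub>R q)"

lemma one_plus_self_pos: "0 < 1 + q \<bullet> (q::'a::real_inner)"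
  by (simp add: add_pos_nonneg)

lemma twist_untwist:
  assumes "e * e = 1" shows "twist e q (untwist e q w) = w"
proof -
  have "twist e q (w - e *\<^sub>R (q \<times> w) + (q \<bullet> w) *\<^sub>R q) = w + (q \<bullet> w) *\<^sub>R q - (e * e) *\<^sub>R (q \<times> (q \<times> w))"
    by (simp add: twist_def cross_add_right Cross3.right_diff_distrib cross_mult_right algebra_simps)
  also have "\<dots> = (1 + q \<bullet> q) *\<^sub>R w"
    by (simp add: assms triple_double_cross algebra_simps)
  finally show ?thesis using one_plus_self_pos[of q] by (simp add: untwist_def twist_linear)
qed

lemma untwist_twist:
  assumes "e * e = 1" shows "untwist e q (twist e q u) = u"
proof -
  have "twist e q (untwist e q (twist e q u) - u) = 0" by (simp add: twist_linear twist_untwist[OF assms])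
  then show ?thesis using norm_twist_ge[OF assms, of "untwist e q (twist e q u) - u" q] by simp
qed

lemma untwist_diff: "untwist e q (v - w) = untwist e q v - untwist e q w"
  by (simp add: untwist_def Cross3.right_diff_distrib inner_diff_right algebra_simps)

text \<open>An explicit rational formula for the solution, from which its regularity in the
  coefficients can be read off.\<close>

lemma cramer_cross:
  fixes c1 c2 c3 :: "real^3" and \<zeta> :: "real^3"
  assumes w: "\<zeta>$1 *\<^sub>R c1 + \<zeta>$2 *\<^sub>R c2 + \<zeta>$3 *\<^sub>R c3 = w" and d: "c1 \<bullet> (c2 \<times> c3) \<noteq> 0"
  shows "\<zeta> = inverse (c1 \<bullet> (c2 \<times> c3)) *\<^sub>R
    ((w \<bullet> (c2 \<times> c3)) *\<^sub>R axis 1 1 + (w \<bullet> (c3 \<times> c1)) *\<^sub>R axis 2 1 + (w \<bullet> (c1 \<times> c2)) *\<^sub>R axis 3 1)"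
proof -
  have s: "c2 \<bullet> (c3 \<times> c1) = c1 \<bullet> (c2 \<times> c3)" "c3 \<bullet> (c1 \<times> c2) = c1 \<bullet> (c2 \<times> c3)"
    by (simp_all add: cross3_simps)
  have "w \<bullet> (c2 \<times> c3) = \<zeta>$1 * (c1 \<bullet> (c2 \<times> c3))" "w \<bullet> (c3 \<times> c1) = \<zeta>$2 * (c1 \<bullet> (c2 \<times> c3))"
    "w \<bullet> (c1 \<times> c2) = \<zeta>$3 * (c1 \<bullet> (c2 \<times> c3))"
    by (simp_all add: w[symmetric] inner_add_left dot_cross_self s)
  then show ?thesis using d by (simp add: vec_eq_iff forall_3 axis_def)
qed

lemma independent_triple:
  fixes c1 c2 c3 :: "real^3"
  assumes "\<And>a b c. a *\<^sub>R c1 + b *\<^sub>R c2 + c *\<^sub>R c3 = 0 \<Longrightarrow> a = 0 \<and> b = 0 \<and> c = 0"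
  shows "c1 \<bullet> (c2 \<times> c3) \<noteq> 0"
proof
  assume 0: "c1 \<bullet> (c2 \<times> c3) = 0"
  define n where "n = c2 \<times> c3"
  show False
  proof (cases "n = 0")
    case False
    have "(n \<bullet> n) *\<^sub>R c1 = (c1 \<bullet> (c3 \<times> n)) *\<^sub>R c2 + (c1 \<bullet> (n \<times> c2)) *\<^sub>R c3 + (c1 \<bullet> n) *\<^sub>R n"
      unfolding n_def by (rule cross_frame_expansion)
    then have "(n \<bullet> n) *\<^sub>R c1 + (- (c1 \<bullet> (c3 \<times> n))) *\<^sub>R c2 + (- (c1 \<bullet> (n \<times> c2))) *\<^sub>R c3 = 0"
      using 0 by (simp add: n_def[symmetric])
    from assms[OF this] show False using False by simp
  next
    case True
    have "c3 \<times> (c2 \<times> c3) = (c3 \<bullet> c3) *\<^sub>R c2 - (c3 \<bullet> c2) *\<^sub>R c3" by (rule triple_double_cross)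
    then have "0 *\<^sub>R c1 + (c3 \<bullet> c3) *\<^sub>R c2 + (- (c3 \<bullet> c2)) *\<^sub>R c3 = 0" using True by (simp add: n_def)
    then have "c3 = 0" using assms[of 0 "c3 \<bullet> c3" "- (c3 \<bullet> c2)"] by simp
    then show False using assms[of 0 0 1] by simp
  qed
qed

text \<open>\<open>h\<close> is defined on the whole space so that ordinary derivatives apply; at
  points of the sphere its derivative shrinks every nonzero vector, radial ones included. The
  strictness is pointwise, as in Edelstein's fixed point theorem, with no uniform factor.\<close>

locale sphere_contraction =
  fixes h :: "real^3 \<Rightarrow> real^3" and \<epsilon> :: real
  assumes smooth: "smooth_map h" and unit: "\<And>x. norm (h x) = 1"
    and contract: "\<And>b b'. norm b = 1 \<Longrightarrow> norm b' = 1 \<Longrightarrow> b \<noteq> b' \<Longrightarrow> norm (h b - h b') < norm (b - b')"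
    and contract': "\<And>x D \<xi>. norm x = 1 \<Longrightarrow> (h has_derivative D) (at x) \<Longrightarrow> \<xi> \<noteq> 0 \<Longrightarrow> norm (D \<xi>) < norm \<xi>"
    and eps: "\<epsilon> * \<epsilon> = 1"
begin

text \<open>In terms of \<open>b = twist (- \<epsilon>) q z\<close> the equation asks for a fixed
  point of \<open>h\<close> followed by an isometry, a map that decreases distances on the compact
  sphere. The length of \<open>z\<close> is chosen to make \<open>b\<close> a unit vector; the
  direction of the fiber will be \<open>sgn z\<close>.\<close>

lemma fiber_exists:
  "\<exists>!z. norm (twist (- \<epsilon>) q z) = 1 \<and> twist \<epsilon> q z = h (twist (- \<epsilon>) q z)"
proof -
  define g where "g b = twist (- \<epsilon>) q (untwist \<epsilon> q (h b))" for b
  have ng: "norm (twist (- \<epsilon>) q (untwist \<epsilon> q w)) = norm w" for w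
    by (simp add: norm_twist[OF eps] twist_untwist[OF eps])
  have "\<exists>!b\<in>sphere 0 1. g b = b"
  proof (rule Edelstein_fix)
    show "sphere (0::real^3) 1 \<noteq> {}" by simp
    show "g ` sphere 0 1 \<subseteq> sphere 0 1" by (auto simp: g_def ng unit)
    fix x y :: "real^3" assume "x \<in> sphere 0 1" "y \<in> sphere 0 1"
    then show "x \<noteq> y \<longrightarrow> dist (g x) (g y) < dist x y"
      using contract[of x y] ng[of "h x - h y"]
      by (simp add: dist_norm g_def untwist_diff twist_linear)
  qed simp
  then obtain b where b0: "b \<in> sphere 0 1 \<and> g b = b"
    and uniq0: "\<forall>b'. b' \<in> sphere 0 1 \<and> g b' = b' \<longrightarrow> b' = b"
    by (elim ex1E) blast
  have b: "norm b = 1" "g b = b" using b0 by simp_all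
  have uniq: "b' = b" if "norm b' = 1" "g b' = b'" for b'
    using uniq0 that by simp
  show ?thesis
  proof (rule ex1I[of _ "untwist \<epsilon> q (h b)"])
    show "norm (twist (- \<epsilon>) q (untwist \<epsilon> q (h b))) = 1 \<and>
      twist \<epsilon> q (untwist \<epsilon> q (h b)) = h (twist (- \<epsilon>) q (untwist \<epsilon> q (h b)))"
      using b by (simp add: g_def[symmetric] twist_untwist[OF eps])
    fix z assume z: "norm (twist (- \<epsilon>) q z) = 1 \<and> twist \<epsilon> q z = h (twist (- \<epsilon>) q z)"
    then have zu: "z = untwist \<epsilon> q (h (twist (- \<epsilon>) q z))" using untwist_twist[OF eps, of q z] by simp
    then have "twist (- \<epsilon>) q z = b" using uniq[of "twist (- \<epsilon>) q z"] z by (simp add: g_def)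
    then show "z = untwist \<epsilon> q (h b)" using zu by simp
  qed
qed

definition Z :: "real^3 \<Rightarrow> real^3" where
  "Z q = (THE z. norm (twist (- \<epsilon>) q z) = 1 \<and> twist \<epsilon> q z = h (twist (- \<epsilon>) q z))"

definition X :: "real^3 \<Rightarrow> real^3" where "X q = twist (- \<epsilon>) q (Z q)"

lemma Z: "norm (X q) = 1" "twist \<epsilon> q (Z q) = h (X q)"
  using theI'[OF fiber_exists[of q]] by (simp_all add: Z_def X_def)

lemma Z_unique:
  "norm (twist (- \<epsilon>) q z) = 1 \<Longrightarrow> twist \<epsilon> q z = h (twist (- \<epsilon>) q z) \<Longrightarrow> z = Z q"
  unfolding Z_def by (rule the1_equality[OF fiber_exists, symmetric]) simp

lemma Z_nonzero: "Z q \<noteq> 0"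
  using Z(1)[of q] by (auto simp: X_def twist_linear)

text \<open>By uniqueness the graph is the whole solution set of a continuous equation, hence
  closed, and the values stay in a compact ball.\<close>

lemma continuous_Z: "continuous_on UNIV Z"
proof (rule continuous_from_closed_graph)
  show "compact (cball (0::real^3) 1)" by simp
  show "Z \<in> UNIV \<rightarrow> cball 0 1"
  proof
    fix q
    show "Z q \<in> cball 0 1"
      using norm_twist_ge[of "- \<epsilon>" "Z q" q] eps Z(1)[of q] by (simp add: X_def)
  qed
  have ch: "continuous_on UNIV h" using smooth unfolding smooth_map_def by (metis Ck.simps(1))
  have fs: "continuous_on UNIV (fst :: (real^3) * (real^3) \<Rightarrow> _)" "continuous_on UNIV (snd :: (real^3) * (real^3) \<Rightarrow> _)"
    by (intro continuous_intros)+
  have tw: "continuous_on UNIV (\<lambda>p :: (real^3) * (real^3). twist e (fst p) (snd p))" for e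
    unfolding twist_def by (intro continuous_on_add continuous_on_scaleR continuous_on_const continuous_on_cross fs)
  have "closed {p. norm (twist (- \<epsilon>) (fst p) (snd p)) = 1 \<and> twist \<epsilon> (fst p) (snd p) = h (twist (- \<epsilon>) (fst p) (snd p))}"
    by (intro closed_Collect_conj closed_Collect_eq continuous_on_norm continuous_on_const tw
        continuous_on_compose2[OF ch tw]) auto
  moreover have "(\<lambda>x. (x, Z x)) ` UNIV =
     {p. norm (twist (- \<epsilon>) (fst p) (snd p)) = 1 \<and> twist \<epsilon> (fst p) (snd p) = h (twist (- \<epsilon>) (fst p) (snd p))}"
    using Z Z_unique by (auto simp: X_def image_iff)
  ultimately show "closed ((\<lambda>x. (x, Z x)) ` UNIV)" by simp
qed

section \<open>Smooth dependence of the fiber on the point\<close>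

definition D :: "real^3 \<Rightarrow> real^3 \<Rightarrow> real^3" where
  "D x = (SOME D. (h has_derivative D) (at x))"

lemma D: "(h has_derivative D x) (at x)"
proof -
  obtain h' where "\<And>x. (h has_derivative h' x) (at x)"
    using smooth_map_C1[OF smooth] by auto
  then show ?thesis unfolding D_def by (metis someI_ex)
qed

lemma Ck_D: "Ck k (\<lambda>x. D x v)"
proof -
  have "Ck (Suc k) h" using smooth by (simp add: smooth_map_def del: Ck.simps)
  then obtain h' where h': "\<And>x. (h has_derivative h' x) (at x)" "\<And>v. Ck k (\<lambda>x. h' x v)"
    using Ck_SucE by blast
  have "h' = D" using has_derivative_unique[OF h'(1) D] by (simp add: fun_eq_iff)
  then show ?thesis using h'(2) by simp
qed

lemma D_orthogonal: "D x \<xi> \<bullet> h x = 0"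
proof -
  have "((\<lambda>p. h p \<bullet> h p) has_derivative (\<lambda>w. h x \<bullet> D x w + D x w \<bullet> h x)) (at x)"
    by (intro has_derivative_inner D)
  moreover have "((\<lambda>p. h p \<bullet> h p) has_derivative (\<lambda>w. 0)) (at x)"
    using unit by (simp add: norm_eq_1)
  ultimately have "(\<lambda>w. h x \<bullet> D x w + D x w \<bullet> h x) = (\<lambda>w. 0)" by (rule has_derivative_unique)
  then have "h x \<bullet> D x \<xi> + D x \<xi> \<bullet> h x = 0" by (rule fun_cong)
  then show ?thesis by (simp add: inner_commute)
qed

text \<open>The fiber equation, rescaled so that its solutions are the unit-norm ones without imposing
  the constraint separately; \<open>E'\<close> is its differential along the solution.\<close>
definition E :: "(real^3) * (real^3) \<Rightarrow> real^3" where
  "E p = twist \<epsilon> (fst p) (snd p)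
     - (twist (- \<epsilon>) (fst p) (snd p) \<bullet> twist (- \<epsilon>) (fst p) (snd p)) *\<^sub>R h (twist (- \<epsilon>) (fst p) (snd p))"

text \<open>The variation of \<open>twist (- \<epsilon>) q (Z q)\<close> when \<open>q\<close> moves
  by \<open>v\<close> and \<open>Z q\<close> by \<open>\<zeta>\<close>.\<close>

definition \<xi> :: "real^3 \<Rightarrow> real^3 \<Rightarrow> real^3 \<Rightarrow> real^3" where
  "\<xi> q v \<zeta> = twist (- \<epsilon>) q \<zeta> - \<epsilon> *\<^sub>R (v \<times> Z q)"

definition E' :: "real^3 \<Rightarrow> real^3 \<Rightarrow> real^3 \<Rightarrow> real^3" where
  "E' q v \<zeta> = twist \<epsilon> q \<zeta> + \<epsilon> *\<^sub>R (v \<times> Z q) - (2 * (X q \<bullet> \<xi> q v \<zeta>)) *\<^sub>R h (X q) - D (X q) (\<xi> q v \<zeta>)"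

lemma E_zero: "E (q, Z q) = 0"
  using Z[of q] unfolding E_def fst_conv snd_conv X_def[symmetric] by (simp add: norm_eq_1)

lemma E_derivative: "(E has_derivative (\<lambda>p. E' q (fst p) (snd p))) (at (q, Z q))"
proof -
  have tw: "((\<lambda>p. twist e (fst p) (snd p)) has_derivative (\<lambda>p. twist e q (snd p) + e *\<^sub>R (fst p \<times> Z q))) (at (q, Z q))" for e
  proof -
    have "((\<lambda>p. fst p \<times> snd p) has_derivative (\<lambda>p. fst (q, Z q) \<times> snd p + fst p \<times> snd (q, Z q))) (at (q, Z q))"
      by (rule bounded_bilinear.FDERIV[OF bilinear_conv_bounded_bilinear[THEN iffD1, OF bilinear_cross]])
        (auto intro: derivative_eq_intros)
    then have "((\<lambda>p. snd p + e *\<^sub>R (fst p \<times> snd p)) has_derivative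
       (\<lambda>p. snd p + e *\<^sub>R (fst (q, Z q) \<times> snd p + fst p \<times> snd (q, Z q)))) (at (q, Z q))"
      by (intro has_derivative_add has_derivative_scaleR_right has_derivative_snd has_derivative_ident)
    then show ?thesis by (simp add: twist_def algebra_simps)
  qed
  have x: "((\<lambda>p. twist (- \<epsilon>) (fst p) (snd p)) has_derivative (\<lambda>p. \<xi> q (fst p) (snd p))) (at (q, Z q))"
    using tw[of "- \<epsilon>"] by (simp add: \<xi>_def)
  have at: "twist (- \<epsilon>) (fst (q, Z q)) (snd (q, Z q)) = X q" by (simp add: X_def)
  have hx: "((\<lambda>p. h (twist (- \<epsilon>) (fst p) (snd p))) has_derivative (\<lambda>p. D (X q) (\<xi> q (fst p) (snd p)))) (at (q, Z q))"
    by (rule has_derivative_compose[OF x]) (simp only: at D)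
  have "((\<lambda>p. twist (- \<epsilon>) (fst p) (snd p) \<bullet> twist (- \<epsilon>) (fst p) (snd p)) has_derivative
     (\<lambda>p. 2 * (X q \<bullet> \<xi> q (fst p) (snd p)))) (at (q, Z q))"
    by (rule has_derivative_eq_rhs[OF has_derivative_inner[OF x x]]) (simp add: X_def[symmetric] inner_commute fun_eq_iff)
  from has_derivative_scaleR[OF this hx]
  have "((\<lambda>p. (twist (- \<epsilon>) (fst p) (snd p) \<bullet> twist (- \<epsilon>) (fst p) (snd p)) *\<^sub>R h (twist (- \<epsilon>) (fst p) (snd p))) has_derivative
     (\<lambda>p. D (X q) (\<xi> q (fst p) (snd p)) + (2 * (X q \<bullet> \<xi> q (fst p) (snd p))) *\<^sub>R h (X q))) (at (q, Z q))"
    unfolding at using Z(1)[of q] by (simp add: norm_eq_1)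
  from has_derivative_diff[OF tw[of \<epsilon>] this] show ?thesis
    unfolding E_def[abs_def] E'_def by (rule has_derivative_eq_rhs) (simp add: fun_eq_iff)
qed

text \<open>The image of \<open>D\<close> is orthogonal to \<open>h (X q)\<close>. Pairing the
  linearized equation with that unit vector thus gives
  \<open>2 * (X q \<bullet> \<xi> q v \<zeta>)\<close>, twice what the second hypothesis says, so
  this number is 0. What is left says that \<open>D\<close> preserves the norm of
  \<open>\<xi> q v \<zeta>\<close>, against strict contraction.\<close>

lemma E'_zero:
  assumes "E' q v \<zeta> = 0" and S: "(twist \<epsilon> q \<zeta> + \<epsilon> *\<^sub>R (v \<times> Z q)) \<bullet> h (X q) = X q \<bullet> \<xi> q v \<zeta>"
    and n: "norm (twist \<epsilon> q \<zeta> + \<epsilon> *\<^sub>R (v \<times> Z q)) = norm (\<xi> q v \<zeta>)"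
  shows "\<xi> q v \<zeta> = 0"
proof (rule ccontr)
  assume ne: "\<xi> q v \<zeta> \<noteq> 0"
  let ?l = "twist \<epsilon> q \<zeta> + \<epsilon> *\<^sub>R (v \<times> Z q)"
  have l: "?l = (2 * (X q \<bullet> \<xi> q v \<zeta>)) *\<^sub>R h (X q) + D (X q) (\<xi> q v \<zeta>)"
    using assms(1) unfolding E'_def by (simp add: algebra_simps)
  have "?l \<bullet> h (X q) = 2 * (X q \<bullet> \<xi> q v \<zeta>)"
    unfolding l using unit by (simp add: inner_add_left D_orthogonal norm_eq_1)
  then have "X q \<bullet> \<xi> q v \<zeta> = 0" using S by simp
  then have "norm (D (X q) (\<xi> q v \<zeta>)) = norm (\<xi> q v \<zeta>)" using l n by simp
  then show False using contract'[OF Z(1) D ne, of q] by simp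
qed

lemma E'_injective:
  assumes "E' q 0 \<zeta> = 0" shows "\<zeta> = 0"
proof -
  have xi: "\<xi> q 0 \<zeta> = twist (- \<epsilon>) q \<zeta>" by (simp add: \<xi>_def)
  have h1: "h (X q) = twist \<epsilon> q (Z q)" using Z(2) by simp
  have "\<xi> q 0 \<zeta> = 0"
  proof (rule E'_zero[OF assms])
    show "(twist \<epsilon> q \<zeta> + \<epsilon> *\<^sub>R (0 \<times> Z q)) \<bullet> h (X q) = X q \<bullet> \<xi> q 0 \<zeta>"
      unfolding xi h1 by (simp add: X_def twist_inner[OF eps] inner_commute)
    show "norm (twist \<epsilon> q \<zeta> + \<epsilon> *\<^sub>R (0 \<times> Z q)) = norm (\<xi> q 0 \<zeta>)"
      unfolding xi by (simp add: norm_twist[OF eps])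
  qed
  then show ?thesis using norm_twist_ge[of "- \<epsilon>" \<zeta> q] eps by (simp add: xi)
qed

lemma Z_derivative:
  obtains Z' where "(Z has_derivative Z') (at q)" "\<And>v. E' q v (Z' v) = 0"
proof (rule implicit_function_derivative[of E Z q "\<lambda>p. E' q (fst p) (snd p)"])
  show "isCont Z q" using continuous_Z by (simp add: continuous_on_eq_continuous_at)
qed (use E_zero E_derivative E'_injective in auto)

lemma E'_linear: "E' q v (\<zeta>) = E' q v 0 + (\<zeta>$1 *\<^sub>R E' q 0 (axis 1 1) + \<zeta>$2 *\<^sub>R E' q 0 (axis 2 1) + \<zeta>$3 *\<^sub>R E' q 0 (axis 3 1))"
proof -
  interpret E': bounded_linear "\<lambda>p. E' q (fst p) (snd p)"
    using E_derivative has_derivative_bounded_linear by blast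
  have ex: "\<zeta> = \<zeta>$1 *\<^sub>R axis 1 1 + \<zeta>$2 *\<^sub>R axis 2 1 + \<zeta>$3 *\<^sub>R axis 3 1"
    by (simp add: vec_eq_iff forall_3 axis_def)
  have add: "E' q 0 (a + b) = E' q 0 a + E' q 0 b" for a b
    using E'.add[of "(0, a)" "(0, b)"] by simp
  have scale: "E' q 0 (c *\<^sub>R a) = c *\<^sub>R E' q 0 a" for c a
    using E'.scaleR[of c "(0, a)"] by simp
  have "E' q v \<zeta> = E' q v 0 + E' q 0 \<zeta>" using E'.add[of "(v, 0)" "(0, \<zeta>)"] by simp
  also have "E' q 0 \<zeta> = E' q 0 (\<zeta>$1 *\<^sub>R axis 1 1 + \<zeta>$2 *\<^sub>R axis 2 1 + \<zeta>$3 *\<^sub>R axis 3 1)"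
    by (rule arg_cong[OF ex])
  finally show ?thesis by (simp only: add scale)
qed

lemma Ck_E':
  assumes "Ck k Z" shows "Ck k (\<lambda>q. E' q v \<zeta>)"
proof -
  have id: "Ck k (\<lambda>q::real^3. q)" by (rule Ck_linear[OF bounded_linear_ident])
  have tw: "Ck k (\<lambda>q. twist e q (f q))" if "Ck k f" for e f
    unfolding twist_def by (intro Ck_add Ck_scaleR Ck_const Ck_cross id that)
  have X: "Ck k X" unfolding X_def[abs_def] by (intro tw assms)
  have xi: "Ck k (\<lambda>q. \<xi> q v \<zeta>)" unfolding \<xi>_def
    by (intro Ck_diff tw Ck_scaleR Ck_const Ck_cross assms)
  have hX: "Ck k (\<lambda>q. h (X q))"
    by (rule Ck_compose[OF X smooth[unfolded smooth_map_def, rule_format]])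
  have DX: "Ck k (\<lambda>q. D (X q) (\<xi> q v \<zeta>))"
  proof -
    have "(\<Sum>i\<in>Basis. (\<xi> q v \<zeta> \<bullet> i) *\<^sub>R D (X q) i) = D (X q) (\<xi> q v \<zeta>)" for q
    proof -
      interpret DX: bounded_linear "D (X q)" using D has_derivative_bounded_linear by blast
      have "D (X q) (\<Sum>i\<in>Basis. (\<xi> q v \<zeta> \<bullet> i) *\<^sub>R i) = (\<Sum>i\<in>Basis. (\<xi> q v \<zeta> \<bullet> i) *\<^sub>R D (X q) i)"
        by (simp only: DX.sum DX.scaleR)
      then show ?thesis by (simp add: euclidean_representation)
    qed
    moreover have "Ck k (\<lambda>q. \<Sum>i\<in>Basis. (\<xi> q v \<zeta> \<bullet> i) *\<^sub>R D (X q) i)"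
      by (intro Ck_sum Ck_scaleR Ck_inner Ck_const xi Ck_compose[OF X Ck_D]) simp
    ultimately show ?thesis by simp
  qed
  show ?thesis unfolding E'_def
    by (intro Ck_diff Ck_add tw Ck_scaleR Ck_mult Ck_inner Ck_const Ck_cross assms X xi hX DX)
qed

text \<open>The linear system for the derivative of \<open>Z\<close> has coefficients built from
  \<open>Z\<close> and from \<open>h\<close> and its derivative, hence as regular as
  \<open>Z\<close>. Solving it by Cramer's rule gains one order.\<close>

lemma Ck_Z: "Ck k Z"
proof (induction k)
  case 0
  then show ?case using continuous_Z by simp
next
  case (Suc k)
  let ?c = "\<lambda>i q. E' q 0 (axis i 1)"
  let ?d = "\<lambda>q. ?c 1 q \<bullet> (?c 2 q \<times> ?c 3 q)"
  let ?w = "\<lambda>v q. - E' q v 0"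
  let ?Z' = "\<lambda>q v. inverse (?d q) *\<^sub>R ((?w v q \<bullet> (?c 2 q \<times> ?c 3 q)) *\<^sub>R axis 1 1
      + (?w v q \<bullet> (?c 3 q \<times> ?c 1 q)) *\<^sub>R axis 2 1 + (?w v q \<bullet> (?c 1 q \<times> ?c 2 q)) *\<^sub>R axis 3 1)"
  have E'00: "E' q 0 0 = 0" for q
    using has_derivative_bounded_linear[OF E_derivative[of q]] linear_simps(3) by fastforce
  have d: "?d q \<noteq> 0" for q
  proof (rule independent_triple)
    fix a b c assume 0: "a *\<^sub>R ?c 1 q + b *\<^sub>R ?c 2 q + c *\<^sub>R ?c 3 q = 0"
    let ?\<zeta> = "vector [a, b, c] :: real^3"
    have "E' q 0 ?\<zeta> = 0" unfolding E'_linear[of q 0 ?\<zeta>] using 0 by (simp add: E'00)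
    then have "?\<zeta> = 0" by (rule E'_injective)
    then have "?\<zeta>$1 = 0" "?\<zeta>$2 = 0" "?\<zeta>$3 = 0" by simp_all
    then show "a = 0 \<and> b = 0 \<and> c = 0" by simp
  qed
  show ?case
  proof (rule Ck_SucI[where f'="?Z'"])
    fix q
    obtain Z' where Z': "(Z has_derivative Z') (at q)" "\<And>v. E' q v (Z' v) = 0"
      using Z_derivative[of q] by blast
    have "Z' v = ?Z' q v" for v
      by (rule cramer_cross[OF _ d]) (use Z'(2)[of v] E'_linear[of q v "Z' v"] in \<open>simp add: eq_neg_iff_add_eq_0 add.commute\<close>)
    then show "(Z has_derivative ?Z' q) (at q)" using Z'(1) by (metis (no_types, lifting) ext)
  next
    show "Ck k (\<lambda>q. ?Z' q v)" for v
      by (intro Ck_scaleR Ck_inverse Ck_add Ck_inner Ck_cross Ck_const Ck_minus Ck_E' Suc.IH d)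
  qed
qed

section \<open>The direction field of the fibers\<close>

definition field :: "real^3 \<Rightarrow> real^3" where "field q = sgn (Z q)"

lemma fibers_of_field: "fibers_of \<epsilon> (\<lambda>x. norm x *\<^sub>R h (sgn x)) field"
proof -
  have "(u + \<epsilon> *\<^sub>R (q \<times> u) = norm (u - \<epsilon> *\<^sub>R (q \<times> u)) *\<^sub>R h (sgn (u - \<epsilon> *\<^sub>R (q \<times> u)))) = (u = field q)"
    if u: "norm u = 1" for q u
  proof -
    let ?x = "twist (- \<epsilon>) q u"
    have x: "u - \<epsilon> *\<^sub>R (q \<times> u) = ?x" "u + \<epsilon> *\<^sub>R (q \<times> u) = twist \<epsilon> q u" by (simp_all add: twist_def)
    have nx: "1 \<le> norm ?x" using norm_twist_ge[of "- \<epsilon>" u q] eps u by simp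
    have "?x \<noteq> 0" using nx by auto
    show ?thesis unfolding x
    proof
      assume eq: "twist \<epsilon> q u = norm ?x *\<^sub>R h (sgn ?x)"
      have s: "twist (- \<epsilon>) q (inverse (norm ?x) *\<^sub>R u) = sgn ?x" by (simp add: twist_linear sgn_div_norm)
      have "inverse (norm ?x) *\<^sub>R u = Z q"
      proof (rule Z_unique)
        show "norm (twist (- \<epsilon>) q (inverse (norm ?x) *\<^sub>R u)) = 1" unfolding s using \<open>?x \<noteq> 0\<close> by (simp add: norm_sgn)
        show "twist \<epsilon> q (inverse (norm ?x) *\<^sub>R u) = h (twist (- \<epsilon>) q (inverse (norm ?x) *\<^sub>R u))"
          unfolding s using \<open>?x \<noteq> 0\<close> by (simp add: twist_linear eq)
      qed
      then have "field q = sgn (inverse (norm ?x) *\<^sub>R u)" by (simp add: field_def)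
      also have "\<dots> = u" using u nx \<open>?x \<noteq> 0\<close> by (simp add: sgn_scaleR) (simp add: sgn_div_norm)
      finally show "u = field q" by simp
    next
      assume "u = field q"
      then have uz: "u = inverse (norm (Z q)) *\<^sub>R Z q" by (simp add: field_def sgn_div_norm)
      have "?x = inverse (norm (Z q)) *\<^sub>R X q" by (simp add: uz twist_linear X_def)
      moreover from this have "norm ?x = inverse (norm (Z q))" using Z(1) by simp
      ultimately have "sgn ?x = X q" using Z_nonzero[of q] by (simp add: sgn_div_norm)
      then show "twist \<epsilon> q u = norm ?x *\<^sub>R h (sgn ?x)"
        using \<open>norm ?x = inverse (norm (Z q))\<close> Z(2)[of q] by (simp add: uz twist_linear)
    qed
  qed
  moreover have "norm (field q) = 1" for q using Z_nonzero[of q] by (simp add: field_def norm_sgn)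
  ultimately show ?thesis by (auto simp: fibers_of_def)
qed

text \<open>Along a direction \<open>w\<close> in which \<open>field\<close> is stationary,
  \<open>Z\<close> changes only by a multiple \<open>k\<close> of itself. Such a variation meets
  both conditions of \<open>E'_zero\<close>, so \<open>k\<close> times \<open>X q\<close> equals
  \<open>\<epsilon>\<close> times \<open>w \<times> Z q\<close>. Pairing with \<open>Z q\<close>
  gives \<open>k = 0\<close>, and then \<open>w\<close> is parallel to the fiber.\<close>

lemma field_nondegenerate: "nondegenerate field"
  unfolding nondegenerate_def
proof (intro allI impI)
  fix q F w assume F: "(field has_derivative F) (at q)" and w: "F w = 0"
  obtain Z' where Z': "(Z has_derivative Z') (at q)" "\<And>v. E' q v (Z' v) = 0" using Z_derivative[of q] by blast
  let ?z = "Z q"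
  obtain N where N: "((\<lambda>p. norm (Z p)) has_derivative N) (at q)"
    using has_derivative_compose[OF Z'(1) has_derivative_norm[OF Z_nonzero]] by blast
  have "((\<lambda>p. norm (Z p) *\<^sub>R field p) has_derivative (\<lambda>v. norm ?z *\<^sub>R F v + N v *\<^sub>R field q)) (at q)"
    by (rule has_derivative_scaleR[OF N F])
  moreover have "(\<lambda>p. norm (Z p) *\<^sub>R field p) = Z" using Z_nonzero by (simp add: fun_eq_iff field_def sgn_div_norm)
  ultimately have "(Z has_derivative (\<lambda>v. norm ?z *\<^sub>R F v + N v *\<^sub>R field q)) (at q)" by simp
  then have "Z' = (\<lambda>v. norm ?z *\<^sub>R F v + N v *\<^sub>R field q)" by (rule has_derivative_unique[OF Z'(1)])
  then have "Z' w = N w *\<^sub>R field q" using w by simp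
  also have "field q = inverse (norm ?z) *\<^sub>R ?z" by (simp add: field_def sgn_div_norm)
  finally obtain k where k: "Z' w = k *\<^sub>R ?z" by auto
  let ?m = "w \<times> ?z"
  have xi: "\<xi> q w (k *\<^sub>R ?z) = k *\<^sub>R X q - \<epsilon> *\<^sub>R ?m" by (simp add: \<xi>_def twist_linear X_def)
  have tz: "twist \<epsilon> q (k *\<^sub>R ?z) = k *\<^sub>R h (X q)" by (simp add: twist_linear Z(2))
  have hh: "h (X q) \<bullet> h (X q) = 1" "X q \<bullet> X q = 1" using unit Z(1) by (simp_all add: norm_eq_1)
  have zm: "?z \<bullet> ?m = 0" "?m \<bullet> ?z = 0" by (simp_all add: dot_cross_self)
  have mh: "\<epsilon> * (?m \<bullet> h (X q)) = ?m \<bullet> (q \<times> ?z)"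
    unfolding Z(2)[symmetric] using eps by (simp add: twist_def inner_add_right zm flip: mult.assoc)
  have mx: "\<epsilon> * (?m \<bullet> X q) = - (?m \<bullet> (q \<times> ?z))"
    unfolding X_def using eps by (simp add: twist_def inner_diff_right zm flip: mult.assoc)
  have "\<xi> q w (k *\<^sub>R ?z) = 0"
  proof (rule E'_zero)
    show "E' q w (k *\<^sub>R ?z) = 0" using Z'(2)[of w] k by simp
    show "(twist \<epsilon> q (k *\<^sub>R ?z) + \<epsilon> *\<^sub>R ?m) \<bullet> h (X q) = X q \<bullet> \<xi> q w (k *\<^sub>R ?z)"
      unfolding xi tz using mh mx by (simp add: inner_add_left inner_diff_right hh inner_commute[of "X q" ?m])
    have e2: "\<epsilon> * (\<epsilon> * x) = x" for x using eps by (simp flip: mult.assoc)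
    have "(k *\<^sub>R h (X q) + \<epsilon> *\<^sub>R ?m) \<bullet> (k *\<^sub>R h (X q) + \<epsilon> *\<^sub>R ?m) = k * k + 2 * k * (\<epsilon> * (?m \<bullet> h (X q))) + ?m \<bullet> ?m"
      by (simp add: inner_add hh e2 inner_commute[of "h (X q)" ?m] algebra_simps)
    moreover have "(k *\<^sub>R X q - \<epsilon> *\<^sub>R ?m) \<bullet> (k *\<^sub>R X q - \<epsilon> *\<^sub>R ?m) = k * k - 2 * k * (\<epsilon> * (?m \<bullet> X q)) + ?m \<bullet> ?m"
      by (simp add: inner_diff hh e2 inner_commute[of "X q" ?m] algebra_simps)
    ultimately show "norm (twist \<epsilon> q (k *\<^sub>R ?z) + \<epsilon> *\<^sub>R ?m) = norm (\<xi> q w (k *\<^sub>R ?z))"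
      unfolding xi tz norm_eq mh mx by simp
  qed
  then have km: "k *\<^sub>R X q = \<epsilon> *\<^sub>R ?m" by (simp add: xi)
  have "k * (X q \<bullet> ?z) = 0" using arg_cong[OF km, of "\<lambda>x. x \<bullet> ?z"] by (simp add: zm)
  moreover have "X q \<bullet> ?z = ?z \<bullet> ?z" by (simp add: X_def twist_def inner_diff_left dot_cross_self)
  ultimately have "k = 0" using Z_nonzero[of q] by simp
  then have "?m = 0" using km eps by auto
  then have "w \<times> field q = 0" by (simp add: field_def sgn_div_norm cross_mult_right)
  moreover have "norm (field q) = 1" using Z_nonzero[of q] by (simp add: field_def norm_sgn)
  ultimately show "\<exists>c. w = c *\<^sub>R field q" using parallel_imp_multiple by blast
qed

text \<open>The moment is the same at all points of a line, so \<open>field\<close> is constant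
  along its own lines and has zero derivative in its own direction. It is therefore constant along
  every integral curve.\<close>

lemma field_line_fibration: "line_fibration field"
proof -
  have fib: "\<And>q u. norm u = 1 \<Longrightarrow> u + \<epsilon> *\<^sub>R (q \<times> u) = norm (u - \<epsilon> *\<^sub>R (q \<times> u)) *\<^sub>R h (sgn (u - \<epsilon> *\<^sub>R (q \<times> u))) \<longleftrightarrow> u = field q"
    and u1: "\<And>q. norm (field q) = 1"
    using fibers_of_field unfolding fibers_of_def by blast+
  have const: "field (q + t *\<^sub>R field q) = field q" for q t
  proof -
    have "(q + t *\<^sub>R field q) \<times> field q = q \<times> field q" by (simp add: cross_add_left cross_mult_left)
    then show ?thesis using fib[where u="field q" and q="q + t *\<^sub>R field q", OF u1] fib[where u="field q" and q=q, OF u1]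
      by metis
  qed
  have smf: "smooth_map field"
    unfolding smooth_map_def field_def[abs_def] using Ck_sgn[OF Ck_Z Z_nonzero] by blast
  have "\<gamma> t = \<gamma> 0 + t *\<^sub>R field (\<gamma> 0)" if \<gamma>: "integral_curve field \<gamma>" for \<gamma> t
  proof -
    have d\<gamma>: "(\<gamma> has_vector_derivative field (\<gamma> t)) (at t)" for t using \<gamma> by (simp add: integral_curve_def)
    have "((\<lambda>t. field (\<gamma> t)) has_vector_derivative 0) (at t)" for t
    proof -
      obtain F where F: "(field has_derivative F) (at (\<gamma> t))" using smooth_map_C1[OF smf] by auto
      have "((\<lambda>s. field (\<gamma> t + s *\<^sub>R field (\<gamma> t))) has_derivative (\<lambda>s. F (s *\<^sub>R field (\<gamma> t)))) (at 0)"
        by (rule has_derivative_compose[of "\<lambda>s. \<gamma> t + s *\<^sub>R field (\<gamma> t)" "\<lambda>s. s *\<^sub>R field (\<gamma> t)"])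
          (use F in \<open>auto intro!: derivative_eq_intros\<close>)
      then have "((\<lambda>s::real. field (\<gamma> t)) has_derivative (\<lambda>s. F (s *\<^sub>R field (\<gamma> t)))) (at 0)" by (simp add: const)
      then have "(\<lambda>s::real. F (s *\<^sub>R field (\<gamma> t))) = (\<lambda>s. 0)" using has_derivative_unique has_derivative_const by blast
      then have F0: "F (s *\<^sub>R field (\<gamma> t)) = 0" for s by metis
      have "((\<lambda>t. field (\<gamma> t)) has_derivative (\<lambda>s. F (s *\<^sub>R field (\<gamma> t)))) (at t)"
        by (rule has_derivative_compose[OF d\<gamma>[unfolded has_vector_derivative_def] F])
      then show ?thesis by (simp add: has_vector_derivative_def F0)
    qed
    then have "\<exists>c. \<forall>t. field (\<gamma> t) = c"
      using has_vector_derivative_zero_constant[of UNIV "\<lambda>t. field (\<gamma> t)"] by (metis UNIV_I at_within_open convex_UNIV open_UNIV)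
    then have c: "field (\<gamma> t) = field (\<gamma> 0)" for t by metis
    have c0: "field (\<gamma> t) - field (\<gamma> 0) = 0" for t using c[of t] by simp
    have "((\<lambda>t. \<gamma> t - t *\<^sub>R field (\<gamma> 0)) has_vector_derivative 0) (at t)" for t
    proof -
      have "((\<lambda>t. \<gamma> t - t *\<^sub>R field (\<gamma> 0)) has_vector_derivative field (\<gamma> t) - field (\<gamma> 0)) (at t)"
        by (intro has_vector_derivative_diff d\<gamma>) (auto intro!: derivative_eq_intros)
      then show ?thesis unfolding c0 .
    qed
    then have "\<exists>c. \<forall>t. \<gamma> t - t *\<^sub>R field (\<gamma> 0) = c"
      using has_vector_derivative_zero_constant[of UNIV "\<lambda>t. \<gamma> t - t *\<^sub>R field (\<gamma> 0)"] by (metis UNIV_I at_within_open convex_UNIV open_UNIV)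
    then have "\<gamma> t - t *\<^sub>R field (\<gamma> 0) = \<gamma> 0 - 0 *\<^sub>R field (\<gamma> 0)" by metis
    then show ?thesis by (simp add: algebra_simps)
  qed
  then show ?thesis unfolding line_fibration_def using smf u1 by blast
qed

lemma field_in_nondeg: "field \<in> nondeg_fibrations"
  by (simp add: nondeg_fibrations_def field_line_fibration field_nondegenerate)

end

section \<open>Smoothing nonexpansive maps\<close>

text \<open>The squared distance splits into \<open>(norm a - norm b)\<^sup>2\<close> and
  \<open>norm a * norm b\<close> times the squared distance of the directions.\<close>

lemma sgn_lipschitz:
  fixes a b :: "'a::real_inner"
  assumes "0 < m" "m \<le> norm a" "m \<le> norm b"
  shows "m * norm (sgn a - sgn b) \<le> norm (a - b)"
proof -
  have ab: "a \<noteq> 0" "b \<noteq> 0" using assms by auto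
  define c where "c = sgn a \<bullet> sgn b"
  have "norm (sgn a) = 1" "norm (sgn b) = 1" using ab by (simp_all add: norm_sgn)
  then have s: "(norm (sgn a - sgn b))\<^sup>2 = 2 - 2 * c"
    using dot_norm_neg[of "sgn a" "sgn b"] unfolding c_def[symmetric] by simp
  have "a = norm a *\<^sub>R sgn a" "b = norm b *\<^sub>R sgn b" using ab by (simp_all add: sgn_div_norm)
  then have "a \<bullet> b = norm a * norm b * c" unfolding c_def
    by (metis inner_scaleR_left inner_scaleR_right mult.assoc)
  then have "(norm (a - b))\<^sup>2 = (norm a - norm b)\<^sup>2 + norm a * norm b * (2 - 2 * c)"
    unfolding dot_norm_neg by (simp add: power2_diff field_simps)
  then have "norm a * norm b * (norm (sgn a - sgn b))\<^sup>2 \<le> (norm (a - b))\<^sup>2" by (simp add: s)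
  moreover have "m * m * (norm (sgn a - sgn b))\<^sup>2 \<le> norm a * norm b * (norm (sgn a - sgn b))\<^sup>2"
    using assms by (intro mult_right_mono mult_mono) auto
  ultimately have "(m * norm (sgn a - sgn b))\<^sup>2 \<le> (norm (a - b))\<^sup>2"
    by (simp add: power_mult_distrib power2_eq_square[of m])
  then show ?thesis by (rule power2_le_imp_le) simp
qed

lemma derivative_norm_le:
  assumes D: "(h has_derivative D) (at x)"
    and K: "\<forall>\<^sub>F y in nhds x. norm (h y - h x) \<le> K * norm (y - x)"
  shows "norm (D v) \<le> K * norm v"
proof (rule ccontr)
  assume nle: "\<not> ?thesis"
  interpret bounded_linear D using D has_derivative_bounded_linear by blast
  have v: "v \<noteq> 0" using nle zero by auto
  define e where "e = (norm (D v) - K * norm v) / (2 * norm v)"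
  have e: "0 < e" using nle v by (simp add: e_def)
  obtain d1 where d1: "0 < d1" "\<And>y. norm (y - x) < d1 \<Longrightarrow> norm (h y - h x - D (y - x)) \<le> e * norm (y - x)"
    using D e unfolding has_derivative_at_alt by meson
  obtain d2 where d2: "0 < d2" "\<And>y. dist y x < d2 \<Longrightarrow> norm (h y - h x) \<le> K * norm (y - x)"
    using K unfolding eventually_nhds_metric by blast
  define t where "t = min d1 d2 / (2 * norm v)"
  have t: "0 < t" using d1 d2 v by (simp add: t_def)
  have tv: "t * norm v < d1" "t * norm v < d2" using d1 d2 v by (simp_all add: t_def)
  have n1: "norm (h (x + t *\<^sub>R v) - h x - D (t *\<^sub>R v)) \<le> e * (t * norm v)"
    using d1(2)[of "x + t *\<^sub>R v"] tv t by simp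
  have n2: "norm (h (x + t *\<^sub>R v) - h x) \<le> K * (t * norm v)"
    using d2(2)[of "x + t *\<^sub>R v"] tv t by (simp add: dist_norm)
  have "norm (D (t *\<^sub>R v)) \<le> norm (h (x + t *\<^sub>R v) - h x) + norm (h (x + t *\<^sub>R v) - h x - D (t *\<^sub>R v))"
    using norm_triangle_ineq4[of "h (x + t *\<^sub>R v) - h x" "h (x + t *\<^sub>R v) - h x - D (t *\<^sub>R v)"] by simp
  then have "t * norm (D v) \<le> K * (t * norm v) + e * (t * norm v)"
    using n1 n2 t by (simp add: scaleR)
  then have "t * norm (D v) \<le> t * (K * norm v + e * norm v)" by (simp add: algebra_simps)
  then have "norm (D v) \<le> K * norm v + e * norm v" using t by simp
  moreover have "e * norm v = (norm (D v) - K * norm v) / 2" using v by (simp add: e_def)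
  moreover have "a \<le> b" if "a \<le> b + c" "c = (a - b) / 2" for a b c :: real
    using that by (simp add: field_simps)
  ultimately show False using nle by blast
qed

definition strict_map :: "('a::real_inner \<Rightarrow> 'a) \<Rightarrow> bool" where
  "strict_map G \<longleftrightarrow> (\<forall>x. x \<noteq> 0 \<longrightarrow> (\<exists>y. y \<bullet> x < G y \<bullet> G x))"

definition smoothing :: "real \<Rightarrow> (real^3 \<Rightarrow> real^3) \<Rightarrow> real^3 \<Rightarrow> real^3" where
  "smoothing s G x = norm x *\<^sub>R sgn (mollify s G (sgn x))"

text \<open>Obtained by pairing the average with \<open>G x\<close>. The left side is the Lipschitz
  constant of the average, so normalizing it leaves a strict contraction.\<close>

lemma norm_mollify_greater:
  fixes G :: "real^3 \<Rightarrow> real^3"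
  assumes G: "conic_nonexpansive G" "strict_map G" and s: "0 < s" "s \<le> 1" and x: "norm x = 1"
  shows "gauss_mass TYPE(real^3) * (1 - s) < norm (mollify s G x)"
proof -
  have "x \<noteq> 0" using x by auto
  then have "gauss_mass TYPE(real^3) * (1 - s) * (x \<bullet> x) < mollify s G x \<bullet> G x"
    using G s by (intro mollify_inner) (auto simp: strict_map_def)
  also have "\<dots> \<le> norm (mollify s G x) * norm (G x)" by (rule norm_cauchy_schwarz)
  finally show ?thesis using x conic_nonexpansiveD(1)[OF G(1)] by (simp add: norm_eq_1)
qed

text \<open>Stated for every \<open>x\<close>, since the normalized average has to be smooth on the
  whole space. At the origin any nonzero test vector serves.\<close>

lemma mollify_nonzero:
  fixes G :: "real^3 \<Rightarrow> real^3"
  assumes G: "conic_nonexpansive G" "strict_map G" and s: "0 < s" "s \<le> 1"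
  shows "mollify s G x \<noteq> 0"
proof
  assume 0: "mollify s G x = 0"
  define x' where "x' = (if x = 0 then axis 1 1 else x)"
  have "x' \<noteq> 0" by (simp add: x'_def axis_eq_0_iff)
  then have "gauss_mass TYPE(real^3) * (1 - s) * (x \<bullet> x') < mollify s G x \<bullet> G x'"
    using G s by (intro mollify_inner) (auto simp: strict_map_def)
  moreover have "0 \<le> gauss_mass TYPE(real^3) * (1 - s) * (x \<bullet> x')"
    using gauss_mass_pos[where 'a="real^3"] s by (intro mult_nonneg_nonneg) (auto simp: x'_def)
  ultimately show False using 0 by simp
qed

lemma sphere_contraction_mollify:
  fixes G :: "real^3 \<Rightarrow> real^3"
  assumes G: "conic_nonexpansive G" "strict_map G" and s: "0 < s" "s \<le> 1" and e: "\<epsilon> * \<epsilon> = 1"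
  shows "sphere_contraction (\<lambda>x. sgn (mollify s G x)) \<epsilon>"
proof
  let ?M = "mollify s G"
  define c where "c = gauss_mass TYPE(real^3) * (1 - s)"
  have c: "0 \<le> c" using gauss_mass_pos[where 'a="real^3"] s by (simp add: c_def)
  have nz: "?M x \<noteq> 0" for x by (rule mollify_nonzero[OF G s])
  have gt: "c < norm (?M x)" if "norm x = 1" for x unfolding c_def by (rule norm_mollify_greater[OF G s that])
  have lip: "norm (?M x - ?M y) \<le> c * norm (x - y)" for x y
    unfolding c_def using s by (intro mollify_lipschitz G) auto
  show "smooth_map (\<lambda>x. sgn (?M x))"
    unfolding smooth_map_def using Ck_sgn[OF Ck_mollify[OF G(1) s(1)] nz] by blast
  show "norm (sgn (?M x)) = 1" for x using nz by (simp add: norm_sgn)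
  show "norm (sgn (?M b) - sgn (?M b')) < norm (b - b')" if b: "norm b = 1" "norm b' = 1" "b \<noteq> b'" for b b'
  proof -
    define m where "m = min (norm (?M b)) (norm (?M b'))"
    have m: "c < m" using gt b by (simp add: m_def)
    have "m * norm (sgn (?M b) - sgn (?M b')) \<le> norm (?M b - ?M b')"
      using m c by (intro sgn_lipschitz) (auto simp: m_def)
    also have "\<dots> \<le> c * norm (b - b')" by (rule lip)
    also have "\<dots> < m * norm (b - b')" using m b(3) by (intro mult_strict_right_mono) auto
    finally show ?thesis using m c by simp
  qed
  show "norm (D \<xi>) < norm \<xi>" if x: "norm x = 1" and D: "((\<lambda>x. sgn (?M x)) has_derivative D) (at x)" and xi: "\<xi> \<noteq> 0" for x D \<xi>
  proof -
    \<comment> \<open>A number strictly between the Lipschitz constant and the norm at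
      \<open>x\<close> remains a lower bound for the norm near \<open>x\<close>, so
      \<open>c / m < 1\<close> is a local Lipschitz constant.\<close>
    obtain m where m: "c < m" "m < norm (?M x)" using dense gt[OF x] by blast
    have "continuous_on UNIV (\<lambda>x. norm (?M x))"
      using Ck_continuous[OF Ck_mollify[OF G(1) s(1), of 0]] by (intro continuous_on_norm)
    then have "open {y. m < norm (?M y)}" by (intro open_Collect_less continuous_on_const)
    then have "\<forall>\<^sub>F y in nhds x. m < norm (?M y)"
      using eventually_nhds_in_open[of "{y. m < norm (?M y)}" x] m by simp
    then have "\<forall>\<^sub>F y in nhds x. norm (sgn (?M y) - sgn (?M x)) \<le> c / m * norm (y - x)"
    proof eventually_elim
      case (elim y)
      have "m * norm (sgn (?M y) - sgn (?M x)) \<le> norm (?M y - ?M x)"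
        using m c elim by (intro sgn_lipschitz) auto
      also have "\<dots> \<le> c * norm (y - x)" by (rule lip)
      finally show ?case using m c by (simp add: field_simps)
    qed
    from derivative_norm_le[OF D this] have "norm (D \<xi>) \<le> c / m * norm \<xi>" .
    also have "\<dots> < 1 * norm \<xi>" using m c xi by (intro mult_strict_right_mono) (auto simp: divide_less_eq)
    finally show ?thesis by simp
  qed
qed (rule e)

lemma conic_from_sphere:
  fixes h :: "real^3 \<Rightarrow> real^3"
  assumes unit: "\<And>b. norm b = 1 \<Longrightarrow> norm (h b) = 1"
    and lip: "\<And>b b'. norm b = 1 \<Longrightarrow> norm b' = 1 \<Longrightarrow> norm (h b - h b') \<le> norm (b - b')"
  shows "conic_nonexpansive (\<lambda>x. norm x *\<^sub>R h (sgn x))"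
  unfolding conic_nonexpansive_def
proof (intro conjI allI impI)
  show "norm (norm x *\<^sub>R h (sgn x)) = norm x" for x :: "real^3"
    using unit[of "sgn x"] by (cases "x = 0") (simp_all add: norm_sgn)
  show "norm (c *\<^sub>R x) *\<^sub>R h (sgn (c *\<^sub>R x)) = c *\<^sub>R (norm x *\<^sub>R h (sgn x))" if "0 \<le> c" for c and x :: "real^3"
    using that by (cases "c = 0") (simp_all add: sgn_scaleR)
  fix x y :: "real^3"
  show "x \<bullet> y \<le> (norm x *\<^sub>R h (sgn x)) \<bullet> (norm y *\<^sub>R h (sgn y))"
  proof (cases "x = 0 \<or> y = 0")
    case False
    have "norm (sgn x) = 1" "norm (sgn y) = 1" using False by (auto simp: norm_sgn)
    then have "(norm (h (sgn x) - h (sgn y)))\<^sup>2 \<le> (norm (sgn x - sgn y))\<^sup>2" "norm (h (sgn x)) = 1" "norm (h (sgn y)) = 1"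
      using lip unit by (auto intro!: power_mono)
    then have "sgn x \<bullet> sgn y \<le> h (sgn x) \<bullet> h (sgn y)"
      using \<open>norm (sgn x) = 1\<close> \<open>norm (sgn y) = 1\<close> unfolding dot_norm_neg by simp
    then have "norm x * (norm y * (sgn x \<bullet> sgn y)) \<le> norm x * (norm y * (h (sgn x) \<bullet> h (sgn y)))"
      by (intro mult_left_mono) auto
    moreover have "x \<bullet> y = norm x * (norm y * (sgn x \<bullet> sgn y))" using False by (simp add: sgn_div_norm field_simps)
    moreover have "(norm x *\<^sub>R h (sgn x)) \<bullet> (norm y *\<^sub>R h (sgn y)) = norm x * (norm y * (h (sgn x) \<bullet> h (sgn y)))" by simp
    ultimately show ?thesis by linarith
  qed auto
qed

lemma smoothing_zero:
  assumes "conic_nonexpansive G" shows "smoothing 0 G = G"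
proof
  fix x
  show "smoothing 0 G x = G x"
  proof (cases "x = 0")
    case True
    then show ?thesis using conic_nonexpansiveD(1)[OF assms, of 0] by (simp add: smoothing_def)
  next
    case False
    have "norm (G (sgn x)) = 1" using conic_nonexpansiveD(1)[OF assms] False by (simp add: norm_sgn)
    then have "smoothing 0 G x = norm x *\<^sub>R G (sgn x)"
      using gauss_mass_pos[where 'a="real^3"]
      by (simp add: smoothing_def mollify_zero[OF assms] sgn_scaleR) (simp add: sgn_div_norm)
    also have "\<dots> = G (norm x *\<^sub>R sgn x)" using conic_nonexpansiveD(3)[OF assms] by simp
    finally show ?thesis using False by (simp add: sgn_div_norm)
  qed
qed

lemma smoothing_conic:
  assumes G: "conic_nonexpansive G" "strict_map G" and s: "0 \<le> s" "s \<le> 1"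
  shows "conic_nonexpansive (smoothing s G)"
proof (cases "s = 0")
  case True
  then show ?thesis using G smoothing_zero by simp
next
  case False
  interpret sphere_contraction "\<lambda>x. sgn (mollify s G x)" 1
    using False G s by (intro sphere_contraction_mollify) auto
  have "conic_nonexpansive (\<lambda>x. norm x *\<^sub>R sgn (mollify s G (sgn x)))"
  proof (rule conic_from_sphere)
    show "norm (sgn (mollify s G b) - sgn (mollify s G b')) \<le> norm (b - b')" if "norm b = 1" "norm b' = 1" for b b'
      using contract[OF that] by (cases "b = b'") auto
  qed (rule unit)
  then show ?thesis by (simp add: smoothing_def[abs_def])
qed

text \<open>The limiting average stays away from 0 on the sphere, also for \<open>s0 = 0\<close>, so
  uniform convergence of the averages survives normalization.\<close>

lemma smoothing_uniform_limit:
  assumes G: "conic_nonexpansive G" "strict_map G" and s0: "0 \<le> s0" "s0 \<le> 1"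
    and ev: "\<forall>\<^sub>F i in F. conic_nonexpansive (G' i) \<and> 0 \<le> S i \<and> S i \<le> 1"
    and S: "(S \<longlongrightarrow> s0) F" and lim: "uniform_limit (sphere 0 1) G' G F"
  shows "uniform_limit (sphere 0 1) (\<lambda>i. smoothing (S i) (G' i)) (smoothing s0 G) F"
  unfolding uniform_limit_iff
proof (intro allI impI)
  fix e :: real assume e: "0 < e"
  let ?M = "mollify s0 G"
  define I where "I = (\<integral>z. gauss z * (1 + norm z) \<partial>(lborel :: (real^3) measure))"
  have I: "0 \<le> I" unfolding I_def by (intro Bochner_Integration.integral_nonneg) (simp add: gauss_pos less_imp_le)
  have nz: "?M x \<noteq> 0" if "norm x = 1" for x
  proof (cases "s0 = 0")
    case True
    have "G x \<noteq> 0" using conic_nonexpansiveD(1)[OF G(1), of x] that by auto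
    then show ?thesis using True gauss_mass_pos[where 'a="real^3"] by (simp add: mollify_zero[OF G(1)])
  qed (use mollify_nonzero[OF G] s0 in auto)
  have "continuous_on (sphere 0 1) ?M"
  proof (rule lipschitz_on_continuous_on)
    show "(gauss_mass TYPE(real^3) * (1 - s0))-lipschitz_on (sphere 0 1) ?M"
      using mollify_lipschitz[OF s0 G(1)] gauss_mass_pos[where 'a="real^3"] s0
      by (intro lipschitz_onI) (auto simp: dist_norm)
  qed
  then have "continuous_on (sphere 0 1) (\<lambda>x. norm (?M x))" by (intro continuous_on_norm)
  moreover have "sphere (0::real^3) 1 \<noteq> {}" by simp
  ultimately obtain x0 where x0: "x0 \<in> sphere 0 1" "\<And>x. x \<in> sphere 0 1 \<Longrightarrow> norm (?M x0) \<le> norm (?M x)"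
    using continuous_attains_inf[OF compact_sphere] by blast
  define m where "m = norm (?M x0) / 2"
  have m: "0 < m" using nz[of x0] x0(1) by (simp add: m_def)
  \<comment> \<open>Keeps the error of the averages below \<open>m\<close>, so that the nearby
    average also stays away from 0, and below \<open>e * m\<close>, so that normalizing costs less
    than \<open>e\<close>.\<close>
  define \<eta> where "\<eta> = min m (e * m) / (2 * (I + 1))"
  have \<eta>: "0 < \<eta>" using m e I by (simp add: \<eta>_def)
  have "\<forall>\<^sub>F i in F. \<bar>S i - s0\<bar> < \<eta>" using tendstoD[OF S \<eta>] by (simp add: dist_norm)
  moreover have "\<forall>\<^sub>F i in F. \<forall>x\<in>sphere 0 1. dist (G' i x) (G x) < \<eta>"
    using lim \<eta> by (simp add: uniform_limit_iff)
  ultimately show "\<forall>\<^sub>F i in F. \<forall>x\<in>sphere 0 1. dist (smoothing (S i) (G' i) x) (smoothing s0 G x) < e"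
    using ev
  proof eventually_elim
    case (elim i)
    show ?case
    proof
      fix x :: "real^3" assume x: "x \<in> sphere 0 1"
      then have nx: "norm x = 1" by simp
      have sx: "sgn x = x" using nx by (simp add: sgn_div_norm)
      let ?a = "mollify (S i) (G' i) x"
      have "norm (?a - ?M x) \<le> (\<bar>S i - s0\<bar> + \<eta>) * I" unfolding I_def
        using elim \<eta> by (intro mollify_dist[OF s0 G(1) _ _ _ nx]) (auto simp: dist_norm intro: less_imp_le)
      also have "\<dots> \<le> (\<eta> + \<eta>) * I" using elim I by (intro mult_right_mono) auto
      also have "\<dots> < 2 * \<eta> * (I + 1)" using \<eta> by simp
      also have "\<dots> = \<eta> * (2 * (I + 1))" by simp
      also have "\<dots> = min m (e * m)"
      proof -
        have "2 * (I + 1) \<noteq> 0" using I by simp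
        then show ?thesis using nonzero_eq_divide_eq \<eta>_def by blast
      qed
      finally have d: "norm (?a - ?M x) < m" "norm (?a - ?M x) < e * m" by simp_all
      have "2 * m \<le> norm (?M x)" using x0(2)[OF x] by (simp add: m_def)
      moreover have "norm (?M x) \<le> norm ?a + norm (?a - ?M x)"
        using norm_triangle_ineq4[of ?a "?a - ?M x"] by simp
      ultimately have "m * norm (sgn ?a - sgn (?M x)) \<le> norm (?a - ?M x)"
        using d(1) m by (intro sgn_lipschitz) auto
      then have "m * norm (sgn ?a - sgn (?M x)) < m * e" using d(2) by (simp add: mult.commute)
      then show "dist (smoothing (S i) (G' i) x) (smoothing s0 G x) < e"
        using m by (simp add: smoothing_def sx nx dist_norm)
    qed
  qed
qed

lemma smoothing_field_exists:
  assumes "conic_nonexpansive G" "strict_map G" "0 < s" "s \<le> 1" "\<epsilon> * \<epsilon> = 1"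
  shows "\<exists>W \<in> nondeg_fibrations. fibers_of \<epsilon> (smoothing s G) W"
proof -
  interpret sphere_contraction "\<lambda>x. sgn (mollify s G x)" \<epsilon>
    using assms by (rule sphere_contraction_mollify)
  show ?thesis using field_in_nondeg fibers_of_field unfolding smoothing_def[abs_def] by blast
qed

section \<open>Uniqueness, translations and the sign of a fibration\<close>

lemma fibers_of_unique: "fibers_of \<epsilon> G V \<Longrightarrow> fibers_of \<epsilon> G V' \<Longrightarrow> V = V'"
  unfolding fibers_of_def by (metis ext)

lemma nondeg_translate:
  assumes V: "V \<in> nondeg_fibrations" shows "(\<lambda>q. V (q + a)) \<in> nondeg_fibrations"
proof -
  have sm: "Ck k (\<lambda>q. V (q + a))" for k
  proof (rule Ck_compose[of k "\<lambda>q. q + a" V])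
    show "Ck k (\<lambda>q. q + a)" by (intro Ck_add Ck_const Ck_linear bounded_linear_ident)
    show "Ck k V" using V by (simp add: nondeg_fibrations_def line_fibration_def smooth_map_def)
  qed
  have "\<gamma> t = \<gamma> 0 + t *\<^sub>R V (\<gamma> 0 + a)" if "integral_curve (\<lambda>q. V (q + a)) \<gamma>" for \<gamma> t
  proof -
    have "integral_curve V (\<lambda>t. \<gamma> t + a)"
      using that unfolding integral_curve_def by (auto intro!: derivative_eq_intros)
    then have "\<forall>t. \<gamma> t + a = \<gamma> 0 + a + t *\<^sub>R V (\<gamma> 0 + a)"
      using V unfolding nondeg_fibrations_def line_fibration_def by blast
    then have "\<gamma> t + a = \<gamma> 0 + a + t *\<^sub>R V (\<gamma> 0 + a)" by blast
    also have "\<dots> = (\<gamma> 0 + t *\<^sub>R V (\<gamma> 0 + a)) + a" by (simp only: add.assoc add.commute)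
    finally show ?thesis by (simp only: add_right_cancel)
  qed
  moreover have "\<exists>c. w = c *\<^sub>R V (p + a)" if D: "((\<lambda>q. V (q + a)) has_derivative D) (at p)" and "D w = 0" for p D w
  proof -
    have "((\<lambda>q. V ((q - a) + a)) has_derivative D) (at (p + a))"
      by (rule has_derivative_compose[of "\<lambda>q. q - a" "\<lambda>v. v" "p + a" UNIV "\<lambda>q. V (q + a)" D])
        (use D in \<open>auto intro!: derivative_eq_intros\<close>)
    then show ?thesis using V that(2) by (simp add: nondeg_fibrations_def nondegenerate_def)
  qed
  ultimately show ?thesis using sm nondeg_unit[OF V]
    by (auto simp: nondeg_fibrations_def line_fibration_def nondegenerate_def smooth_map_def)
qed

lemma handed_translate:
  assumes "handed_fibration V \<epsilon>" shows "handed_fibration (\<lambda>q. V (q + a)) \<epsilon>"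
proof -
  interpret handed_fibration V \<epsilon> by fact
  show ?thesis
  proof
    show "0 \<le> \<epsilon> * ((q - q') \<bullet> (V (q + a) \<times> V (q' + a)))" for q q'
      using handed[of "q + a" "q' + a"] by simp
  qed (use nondeg_translate[OF V] eps in auto)
qed

lemma handed_exists: "V \<in> nondeg_fibrations \<Longrightarrow> \<exists>\<epsilon>. handed_fibration V \<epsilon>"
  by (metis nondeg_handed handed_fibration.intro)

lemma two_fibers:
  assumes V: "V \<in> nondeg_fibrations"
  obtains q q' where "(q - q') \<bullet> (V q \<times> V q') \<noteq> 0"
proof -
  have "V 0 \<noteq> 0" using nondeg_unit[OF V, of 0] by auto
  then obtain e where e: "e \<times> V 0 \<noteq> 0" by (rule exists_nonparallel)
  have "(e - 0) \<bullet> (V e \<times> V 0) \<noteq> 0"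
  proof
    assume "(e - 0) \<bullet> (V e \<times> V 0) = 0"
    then obtain t where "e = 0 + t *\<^sub>R V 0" using nondeg_skew[OF V] by blast
    then have "e \<times> V 0 = (0 + t *\<^sub>R V 0) \<times> V 0" by simp
    then show False using e by (simp add: cross_mult_left)
  qed
  then show ?thesis using that by blast
qed

lemma handed_unique:
  assumes "handed_fibration V \<epsilon>" "handed_fibration V \<epsilon>'" shows "\<epsilon> = \<epsilon>'"
proof -
  interpret A: handed_fibration V \<epsilon> by fact
  interpret B: handed_fibration V \<epsilon>' by fact
  obtain q q' where q: "(q - q') \<bullet> (V q \<times> V q') \<noteq> 0" using two_fibers[OF A.V] by blast
  show ?thesis using A.handed[of q q'] B.handed[of q q'] A.eps B.eps q by auto
qed

section \<open>Hopf fibrations\<close>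

text \<open>The Hopf fibration with center \<open>a\<close> and axis \<open>v\<close>: seen from
  \<open>a\<close>, the half \<open>twist \<epsilon>\<close> of every fiber is a positive multiple
  of \<open>v\<close>.\<close>

definition hopf_field :: "real \<Rightarrow> real^3 \<Rightarrow> real^3 \<Rightarrow> real^3 \<Rightarrow> real^3" where
  "hopf_field \<epsilon> a v q = sgn (untwist \<epsilon> (q - a) v)"

lemma untwist_scaleR: "untwist e q (c *\<^sub>R v) = c *\<^sub>R untwist e q v"
  by (simp add: untwist_def cross_mult_right algebra_simps)

lemma untwist_nonzero: "e * e = 1 \<Longrightarrow> v \<noteq> 0 \<Longrightarrow> untwist e q v \<noteq> 0"
  using twist_untwist[of e q v] by (auto simp: twist_linear)

lemma fibers_of_const:
  assumes e: "\<epsilon> * \<epsilon> = 1" and v: "norm v = 1"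
  shows "fibers_of \<epsilon> (\<lambda>x. norm x *\<^sub>R v) V \<longleftrightarrow> (\<forall>q. V q = hopf_field \<epsilon> 0 v q)"
proof -
  have v0: "v \<noteq> 0" using v by auto
  have eq: "(u + \<epsilon> *\<^sub>R (q \<times> u) = norm (u - \<epsilon> *\<^sub>R (q \<times> u)) *\<^sub>R v) \<longleftrightarrow> u = hopf_field \<epsilon> 0 v q" (is "?l \<longleftrightarrow> ?r")
    if u: "norm u = 1" for u q
  proof -
    have tw: "u - \<epsilon> *\<^sub>R (q \<times> u) = twist (- \<epsilon>) q u" "u + \<epsilon> *\<^sub>R (q \<times> u) = twist \<epsilon> q u" by (simp_all add: twist_def)
    have n: "1 \<le> norm (twist (- \<epsilon>) q u)" using norm_twist_ge[of "- \<epsilon>" u q] e u by simp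
    show ?thesis unfolding tw
    proof
      assume "twist \<epsilon> q u = norm (twist (- \<epsilon>) q u) *\<^sub>R v"
      then have "u = norm (twist (- \<epsilon>) q u) *\<^sub>R untwist \<epsilon> q v"
        using untwist_twist[OF e, of q u] by (simp add: untwist_scaleR)
      then have "sgn u = sgn (norm (twist (- \<epsilon>) q u) *\<^sub>R untwist \<epsilon> q v)" by simp
      moreover have "0 < norm (twist (- \<epsilon>) q u)" using n by linarith
      ultimately have "sgn u = sgn (untwist \<epsilon> q v)" by (simp only: sgn_scaleR sgn_pos scaleR_one)
      then show "u = hopf_field \<epsilon> 0 v q" using u by (simp add: hopf_field_def sgn_div_norm[of u])
    next
      assume "u = hopf_field \<epsilon> 0 v q"
      then have u': "u = inverse (norm (untwist \<epsilon> q v)) *\<^sub>R untwist \<epsilon> q v" by (simp add: hopf_field_def sgn_div_norm)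
      then have t: "twist \<epsilon> q u = inverse (norm (untwist \<epsilon> q v)) *\<^sub>R v"
        by (simp add: twist_linear twist_untwist[OF e])
      then have "norm (twist \<epsilon> q u) = inverse (norm (untwist \<epsilon> q v))" using v by simp
      then show "twist \<epsilon> q u = norm (twist (- \<epsilon>) q u) *\<^sub>R v" using t norm_twist[OF e] by simp
    qed
  qed
  have n1: "norm (hopf_field \<epsilon> 0 v q) = 1" for q
    using untwist_nonzero[OF e v0] by (simp add: hopf_field_def norm_sgn)
  show ?thesis
  proof
    assume "fibers_of \<epsilon> (\<lambda>x. norm x *\<^sub>R v) V"
    then show "\<forall>q. V q = hopf_field \<epsilon> 0 v q" using eq n1 unfolding fibers_of_def by metis
  next
    assume "\<forall>q. V q = hopf_field \<epsilon> 0 v q"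
    then show "fibers_of \<epsilon> (\<lambda>x. norm x *\<^sub>R v) V" using eq n1 unfolding fibers_of_def by simp
  qed
qed

lemma hopf_field_translate: "hopf_field \<epsilon> a v (q + b) = hopf_field \<epsilon> (a - b) v q"
  by (simp add: hopf_field_def algebra_simps)

lemma hopf_field_nondeg:
  assumes e: "\<epsilon> * \<epsilon> = 1" and v: "norm v = 1"
  shows "hopf_field \<epsilon> a v \<in> nondeg_fibrations"
proof -
  interpret sphere_contraction "\<lambda>_. v" \<epsilon>
  proof
    show "smooth_map (\<lambda>_::real^3. v)" by (simp add: smooth_map_def Ck_const)
    show "norm (D \<xi>) < norm \<xi>" if "((\<lambda>_. v) has_derivative D) (at x)" "\<xi> \<noteq> 0" for x D and \<xi> :: "real^3"
    proof -
      have "D = (\<lambda>_. 0)" using has_derivative_unique[OF that(1) has_derivative_const] .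
      then show ?thesis using that(2) by simp
    qed
  qed (use v e in auto)
  have "\<forall>q. field q = hopf_field \<epsilon> 0 v q" using fibers_of_field fibers_of_const[OF e v] by blast
  then have "field = hopf_field \<epsilon> 0 v" by (intro ext) blast
  then have "(\<lambda>q. hopf_field \<epsilon> 0 v (q + (- a))) \<in> nondeg_fibrations" using nondeg_translate field_in_nondeg by metis
  moreover have "hopf_field \<epsilon> a v = (\<lambda>q. hopf_field \<epsilon> 0 v (q + (- a)))" by (simp add: hopf_field_def fun_eq_iff)
  ultimately show ?thesis by simp
qed

text \<open>The moment about the center is constant along the line, and twisting the direction
  vector gives \<open>1 + y \<bullet> y\<close> times \<open>v\<close>.\<close>

lemma hopf_line_direction:
  assumes e: "\<epsilon> * \<epsilon> = 1" and v: "norm v = 1" and y: "y \<bullet> v = 0"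
  shows "hopf_field \<epsilon> a v (a + y + t *\<^sub>R (\<epsilon> *\<^sub>R (v \<times> y) + v)) = sgn (\<epsilon> *\<^sub>R (v \<times> y) + v)"
proof -
  let ?T = "\<epsilon> *\<^sub>R (v \<times> y) + v"
  have "twist \<epsilon> (y + t *\<^sub>R ?T) ?T = ?T + \<epsilon> *\<^sub>R (y \<times> ?T)"
    by (simp add: twist_def cross_add_left cross_mult_left)
  also have "\<epsilon> *\<^sub>R (y \<times> ?T) = (\<epsilon> * \<epsilon>) *\<^sub>R (y \<times> (v \<times> y)) - \<epsilon> *\<^sub>R (v \<times> y)"
    by (simp add: cross_add_right cross_mult_right algebra_simps cross_skew[of y v])
  also have "y \<times> (v \<times> y) = (y \<bullet> y) *\<^sub>R v" using y by (simp add: triple_double_cross)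
  finally have tw: "twist \<epsilon> (y + t *\<^sub>R ?T) ?T = (1 + y \<bullet> y) *\<^sub>R v" by (simp add: e algebra_simps)
  have "?T = (1 + y \<bullet> y) *\<^sub>R untwist \<epsilon> (y + t *\<^sub>R ?T) v"
    using untwist_twist[OF e, of "y + t *\<^sub>R ?T" ?T] unfolding tw by (simp add: untwist_scaleR)
  then have "sgn ?T = sgn (untwist \<epsilon> (y + t *\<^sub>R ?T) v)"
    using one_plus_self_pos[of y] by (metis scaleR_one sgn_pos sgn_scaleR)
  then show ?thesis by (simp add: hopf_field_def add.assoc)
qed

lemma hopf_fibration_iff:
  "hopf_fibration V \<longleftrightarrow> (\<exists>a v \<epsilon>. norm v = 1 \<and> (\<epsilon> = 1 \<or> \<epsilon> = -1) \<and> V = hopf_field \<epsilon> a v)"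
proof
  assume "hopf_fibration V"
  then obtain a v \<epsilon> where *: "norm v = 1 \<and> \<epsilon> \<in> {1, -1} \<and> (\<forall>p. (p - a) \<bullet> v = 0 \<longrightarrow>
      (\<forall>t. V (p + t *\<^sub>R (\<epsilon> *\<^sub>R (v \<times> (p - a)) + v)) = sgn (\<epsilon> *\<^sub>R (v \<times> (p - a)) + v)))"
    unfolding hopf_fibration_def by blast
  then have v: "norm v = 1" and e: "\<epsilon> = 1 \<or> \<epsilon> = -1" by auto
  have line: "V (p + t *\<^sub>R (\<epsilon> *\<^sub>R (v \<times> (p - a)) + v)) = sgn (\<epsilon> *\<^sub>R (v \<times> (p - a)) + v)"
    if "(p - a) \<bullet> v = 0" for p t
    using * that by blast
  have ee: "\<epsilon> * \<epsilon> = 1" using e by auto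
  have vv: "v \<bullet> v = 1" using v by (simp add: norm_eq_1)
  have "V q = hopf_field \<epsilon> a v q" for q
  proof -
    define t where "t = (q - a) \<bullet> v"
    define W where "W = (q - a) - t *\<^sub>R v"
    \<comment> \<open>The point, relative to \<open>a\<close>, where the fiber through
      \<open>q\<close> must cross the plane: with \<open>J = v \<times> _\<close>, which squares to
      \<open>- 1\<close> on the plane, it solves \<open>y + t \<epsilon> J y = W\<close>.\<close>
    define y where "y = (1 / (1 + t * t)) *\<^sub>R (W - (t * \<epsilon>) *\<^sub>R (v \<times> W))"
    have Wv: "W \<bullet> v = 0" by (simp add: W_def t_def inner_diff_left vv)
    then have yv: "y \<bullet> v = 0" by (simp add: y_def inner_diff_left dot_cross_self)
    have t0: "1 + t * t \<noteq> 0" using zero_le_square[of t] by linarith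
    have "v \<times> (v \<times> W) = - W" using Wv by (simp add: triple_double_cross vv inner_commute)
    then have "\<epsilon> *\<^sub>R (v \<times> y) = (1 / (1 + t * t)) *\<^sub>R (\<epsilon> *\<^sub>R (v \<times> W) + (t * (\<epsilon> * \<epsilon>)) *\<^sub>R W)"
      by (simp add: y_def cross_mult_right Cross3.right_diff_distrib algebra_simps)
    then have "y + t *\<^sub>R (\<epsilon> *\<^sub>R (v \<times> y)) = (1 / (1 + t * t)) *\<^sub>R ((1 + t * t) *\<^sub>R W)"
      unfolding y_def by (simp add: ee algebra_simps)
    then have "y + t *\<^sub>R (\<epsilon> *\<^sub>R (v \<times> y)) = W" using t0 by simp
    then have q: "q = a + y + t *\<^sub>R (\<epsilon> *\<^sub>R (v \<times> y) + v)" by (simp add: W_def algebra_simps)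
    have "V (a + y + t *\<^sub>R (\<epsilon> *\<^sub>R (v \<times> y) + v)) = sgn (\<epsilon> *\<^sub>R (v \<times> y) + v)"
      using line[of "a + y" t] yv by simp
    then show ?thesis using hopf_line_direction[OF ee v yv, of a t] q by simp
  qed
  then show "\<exists>a v \<epsilon>. norm v = 1 \<and> (\<epsilon> = 1 \<or> \<epsilon> = -1) \<and> V = hopf_field \<epsilon> a v" using v e by blast
next
  assume "\<exists>a v \<epsilon>. norm v = 1 \<and> (\<epsilon> = 1 \<or> \<epsilon> = -1) \<and> V = hopf_field \<epsilon> a v"
  then obtain a v \<epsilon> where v: "norm v = 1" and e: "\<epsilon> = 1 \<or> \<epsilon> = -1" and V: "V = hopf_field \<epsilon> a v" by blast
  have ee: "\<epsilon> * \<epsilon> = 1" using e by auto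
  show "hopf_fibration V" unfolding hopf_fibration_def
  proof (intro exI conjI allI impI)
    show "V (p + t *\<^sub>R (\<epsilon> *\<^sub>R (v \<times> (p - a)) + v)) = sgn (\<epsilon> *\<^sub>R (v \<times> (p - a)) + v)" if "(p - a) \<bullet> v = 0" for p t
      using hopf_line_direction[OF ee v that, of a t] by (simp add: V)
  qed (use v e in auto)
qed

text \<open>All vectors \<open>ray \<epsilon>\<close> point along \<open>v\<close>, so the inner
  product inequality is Cauchy-Schwarz.\<close>

lemma hopf_handed:
  assumes e: "\<epsilon> = 1 \<or> \<epsilon> = -1" and v: "norm v = 1"
  shows "handed_fibration (hopf_field \<epsilon> a v) \<epsilon>"
proof -
  have ee: "\<epsilon> * \<epsilon> = 1" using e by auto
  let ?V = "hopf_field \<epsilon> 0 v"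
  have "handed_fibration ?V \<epsilon>"
  proof
    show "?V \<in> nondeg_fibrations" by (rule hopf_field_nondeg[OF ee v])
    fix q q'
    have r: "ray \<epsilon> ?V p = norm (ray (- \<epsilon>) ?V p) *\<^sub>R v" for p
    proof -
      have "fibers_of \<epsilon> (\<lambda>x. norm x *\<^sub>R v) ?V" using fibers_of_const[OF ee v] by blast
      then show ?thesis by (simp add: fibers_of_def ray_def)
    qed
    have "ray (- \<epsilon>) ?V q \<bullet> ray (- \<epsilon>) ?V q' \<le> norm (ray (- \<epsilon>) ?V q) * norm (ray (- \<epsilon>) ?V q')" by (rule norm_cauchy_schwarz)
    also have "\<dots> = ray \<epsilon> ?V q \<bullet> ray \<epsilon> ?V q'"
      unfolding r[of q] r[of q'] using v by (simp add: norm_eq_1)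
    finally show "0 \<le> \<epsilon> * ((q - q') \<bullet> (?V q \<times> ?V q'))" using ray_inner_diff[of \<epsilon> ?V q q'] by linarith
  qed (rule e)
  from handed_translate[OF this, of "- a"] have "handed_fibration (\<lambda>q. hopf_field \<epsilon> 0 v (q + (- a))) \<epsilon>" .
  moreover have "hopf_field \<epsilon> a v = (\<lambda>q. hopf_field \<epsilon> 0 v (q + (- a)))" by (simp add: hopf_field_def fun_eq_iff)
  ultimately show ?thesis by simp
qed

text \<open>The formula extends from the cone to its closure by continuity. At frontier points it
  has to agree with \<open>- x\<close>, which makes them nonpositive multiples of \<open>v\<close>.
  A nonzero point outside the closure lies between two of these.\<close>

lemma hopf_cone_map:
  assumes e: "\<epsilon> = 1 \<or> \<epsilon> = -1" and v: "norm v = 1"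
  shows "cone_map \<epsilon> (hopf_field \<epsilon> 0 v) x = norm x *\<^sub>R v"
proof -
  have ee: "\<epsilon> * \<epsilon> = 1" using e by auto
  let ?V = "hopf_field \<epsilon> 0 v"
  interpret handed_fibration ?V \<epsilon> by (rule hopf_handed[OF e v])
  have in_C: "G x = norm x *\<^sub>R v" if x: "x \<in> C" for x
  proof -
    obtain c q where cq: "0 < c" "x = c *\<^sub>R ray (- \<epsilon>) ?V q" using x by (rule coneE)
    have "fibers_of \<epsilon> (\<lambda>x. norm x *\<^sub>R v) ?V" using fibers_of_const[OF ee v] by blast
    then have "ray \<epsilon> ?V q = norm (ray (- \<epsilon>) ?V q) *\<^sub>R v" by (simp add: fibers_of_def ray_def)
    then show ?thesis using G_ray[OF cq(1), of q] cq by simp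
  qed
  have closed: "closed {x. G x = norm x *\<^sub>R v}"
    using conic_nonexpansive_continuous[OF conic_G] by (intro closed_Collect_eq continuous_intros)
  have "C \<subseteq> {x. G x = norm x *\<^sub>R v}" using in_C by blast
  then have "closure C \<subseteq> {x. G x = norm x *\<^sub>R v}" using closed by (rule closure_minimal)
  then have cl: "G x = norm x *\<^sub>R v" if "x \<in> closure C" for x using that by blast
  show ?thesis
  proof (cases "x \<in> C \<or> x = 0")
    case True
    then show ?thesis using in_C norm_G[of 0] by auto
  next
    case False
    then have x: "x \<notin> C" "x \<noteq> 0" by auto
    obtain w where w: "w \<in> C" "- w \<in> C" using exists_two_sided_direction[OF x] .
    obtain t1 where t1: "0 \<le> t1" "x + t1 *\<^sub>R w \<in> closure C" "x + t1 *\<^sub>R w \<notin> C"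
      using reach_frontier[OF x(1) w(1)] .
    obtain t2 where t2: "0 \<le> t2" "x + t2 *\<^sub>R (- w) \<in> closure C" "x + t2 *\<^sub>R (- w) \<notin> C"
      using reach_frontier[OF x(1) w(2)] .
    show ?thesis
    proof (cases "t1 = 0")
      case True
      then show ?thesis using cl[OF t1(2)] by simp
    next
      case False
      define n1 where "n1 = norm (x + t1 *\<^sub>R w)"
      define n2 where "n2 = norm (x + t2 *\<^sub>R (- w))"
      have 1: "x + t1 *\<^sub>R w = - (n1 *\<^sub>R v)" "x + t2 *\<^sub>R (- w) = - (n2 *\<^sub>R v)"
        using cl[OF t1(2)] G_outside[OF t1(3)] cl[OF t2(2)] G_outside[OF t2(3)]
        unfolding n1_def[symmetric] n2_def[symmetric] by (metis minus_minus)+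
      have "(t1 + t2) *\<^sub>R x = t2 *\<^sub>R (x + t1 *\<^sub>R w) + t1 *\<^sub>R (x + t2 *\<^sub>R (- w))" by (simp add: algebra_simps)
      also have "\<dots> = - ((t2 * n1 + t1 * n2) *\<^sub>R v)" unfolding 1 by (simp add: algebra_simps)
      finally have "inverse (t1 + t2) *\<^sub>R ((t1 + t2) *\<^sub>R x) = inverse (t1 + t2) *\<^sub>R (- ((t2 * n1 + t1 * n2) *\<^sub>R v))" by simp
      moreover define k where "k = inverse (t1 + t2) * (t2 * n1 + t1 * n2)"
      moreover have "0 < t1 + t2" using False t1 t2 by simp
      ultimately have xk: "x = - (k *\<^sub>R v)" by simp
      have "0 \<le> k" using t1 t2 by (simp add: k_def n1_def n2_def)
      then show ?thesis using v unfolding G_outside[OF x(1)] unfolding xk by simp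
    qed
  qed
qed

lemma smoothing_hopf:
  assumes v: "norm v = 1" and G: "\<And>x. G x = norm x *\<^sub>R v" "conic_nonexpansive G" "strict_map G" and s: "0 \<le> s" "s \<le> 1"
  shows "smoothing s G = G"
proof (cases "s = 0")
  case True
  then show ?thesis using smoothing_zero[OF G(2)] by simp
next
  case False
  have "sgn (mollify s G x) = v" for x
  proof -
    obtain c where c: "0 \<le> c" "mollify s G x = c *\<^sub>R v" using mollify_const_direction[OF s G(1)] by blast
    have "mollify s G x \<noteq> 0" using mollify_nonzero[OF G(2,3)] s False by simp
    then have "0 < c" using c by (cases "c = 0") auto
    then show ?thesis using c v by (simp add: sgn_scaleR) (simp add: sgn_div_norm)
  qed
  then show ?thesis using G(1) by (simp add: smoothing_def fun_eq_iff)
qed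

lemma smoothing_one_const: "smoothing 1 G x = norm x *\<^sub>R sgn (mollify 1 G 0)"
  by (simp add: smoothing_def mollify_def)

section \<open>The space of fibrations\<close>

lemma topspace_compact_open [simp]: "topspace compact_open = UNIV"
proof -
  have "{f::'a \<Rightarrow> 'b. f ` {} \<subseteq> UNIV} \<in> {{f. f ` K \<subseteq> U} | K U. compact K \<and> open U}"
    by (intro CollectI exI[of _ "{}"] exI[of _ UNIV]) simp
  then show ?thesis unfolding compact_open_def topology_generated_by_topspace by auto
qed

lemma openin_compact_open: "compact K \<Longrightarrow> open U \<Longrightarrow> openin compact_open {f. f ` K \<subseteq> U}"
  unfolding compact_open_def by (rule topology_generated_by_Basis) blast

abbreviation fibration_space :: "(real^3 \<Rightarrow> real^3) topology" where
  "fibration_space \<equiv> subtopology compact_open nondeg_fibrations"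

text \<open>Finitely many subbasic conditions, one for each small ball of a cover of
  \<open>cball 0 R\<close>, force uniform closeness there.\<close>

lemma uniform_nhd:
  assumes V: "V \<in> nondeg_fibrations"
  shows "uniform_limit (cball 0 R) (\<lambda>W. W) V (nhdsin fibration_space V)"
  unfolding uniform_limit_iff
proof (intro allI impI)
  fix e :: real assume e: "0 < e"
  have "uniformly_continuous_on (cball 0 R) V"
    by (intro compact_uniformly_continuous nondeg_continuous V) simp
  then obtain d where d: "0 < d" "\<And>p q. p \<in> cball 0 R \<Longrightarrow> q \<in> cball 0 R \<Longrightarrow> dist p q < d \<Longrightarrow> dist (V p) (V q) < e / 2"
    using e unfolding uniformly_continuous_on_def by (meson half_gt_zero)
  have cover: "cball (0::real^3) R \<subseteq> (\<Union>p\<in>cball 0 R. ball p (d / 2))"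
  proof
    fix x :: "real^3" assume "x \<in> cball 0 R"
    moreover have "x \<in> ball x (d / 2)" using d(1) by simp
    ultimately show "x \<in> (\<Union>p\<in>cball 0 R. ball p (d / 2))" by blast
  qed
  obtain P :: "(real^3) set" where P: "P \<subseteq> cball 0 R" "finite P" "cball 0 R \<subseteq> (\<Union>p\<in>P. ball p (d / 2))"
    by (rule compactE_image[OF compact_cball _ cover]) auto
  define K where "K p = cball p (d / 2) \<inter> cball 0 R" for p :: "real^3"
  define U where "U = (\<Inter>p\<in>P. {f. f ` K p \<subseteq> ball (V p) (e / 2)})"
  have "openin compact_open (U \<inter> topspace compact_open)"
    unfolding U_def using P(2) by (intro openin_INT openin_compact_open) (auto simp: K_def compact_Int_closed)
  then have "openin fibration_space (U \<inter> nondeg_fibrations)" by (auto simp: openin_subtopology)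
  moreover have "V \<in> U \<inter> nondeg_fibrations"
    using V d P(1) by (auto simp: U_def K_def subset_iff)
  moreover have "\<forall>q\<in>cball 0 R. dist (W q) (V q) < e" if "W \<in> U \<inter> nondeg_fibrations" for W
  proof
    fix q :: "real^3" assume q: "q \<in> cball 0 R"
    then obtain p where p: "p \<in> P" "dist p q < d / 2" using P(3) by auto
    then have "q \<in> K p" using q by (simp add: K_def)
    then have "W q \<in> ball (V p) (e / 2)" using that p(1) unfolding U_def by blast
    then have "dist (V p) (W q) < e / 2" by (simp only: mem_ball)
    moreover have "dist (V p) (V q) < e / 2"
    proof (rule d(2))
      show "dist p q < d" using p(2) d(1) by linarith
    qed (use p(1) q P(1) in auto)
    ultimately show "dist (W q) (V q) < e"
      using dist_triangle[of "W q" "V q" "V p"] dist_commute[of "W q" "V p"] by linarith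
  qed
  ultimately show "\<forall>\<^sub>F W in nhdsin fibration_space V. \<forall>q\<in>cball 0 R. dist (W q) (V q) < e"
    unfolding eventually_nhdsin by blast
qed

text \<open>A compact image inside \<open>U\<close> has a margin \<open>e\<close> within
  \<open>U\<close>; fields that are \<open>e\<close>-close on a ball containing \<open>K\<close>
  keep the image of \<open>K\<close> inside.\<close>

lemma continuous_map_into_fibration_space:
  assumes N: "\<And>y. y \<in> topspace Y \<Longrightarrow> f y \<in> nondeg_fibrations"
    and lim: "\<And>y R. y \<in> topspace Y \<Longrightarrow> uniform_limit (cball 0 R) f (f y) (nhdsin Y y)"
  shows "continuous_map Y fibration_space f"
proof -
  have "continuous_map Y compact_open f"
    unfolding compact_open_def continuous_on_generated_topo_iff
  proof (intro conjI allI impI)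
    have "\<Union> {{f. f ` K \<subseteq> U} |K U. compact K \<and> open U} = (UNIV :: (real^3 \<Rightarrow> real^3) set)"
      using topspace_compact_open unfolding compact_open_def topology_generated_by_topspace .
    then show "f ` topspace Y \<subseteq> \<Union> {{f. f ` K \<subseteq> U} |K U. compact K \<and> open U}" by (simp only: subset_UNIV)
    fix S :: "(real^3 \<Rightarrow> real^3) set"
    assume "S \<in> {{f. f ` K \<subseteq> U} |K U. compact K \<and> open U}"
    then obtain K U where KU: "compact K" "open U" "S = {f. f ` K \<subseteq> U}" by blast
    show "openin Y (f -` S \<inter> topspace Y)"
      unfolding openin_subopen[of Y "f -` S \<inter> topspace Y"]
    proof
      fix y assume y: "y \<in> f -` S \<inter> topspace Y"
      have "compact (f y ` K)"
        using KU(1) N y by (intro compact_continuous_image nondeg_continuous) auto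
      moreover have "f y ` K \<subseteq> U" using y KU by auto
      ultimately obtain e where e: "0 < e" "(\<Union>x\<in>f y ` K. ball x e) \<subseteq> U"
        using compact_subset_open_imp_ball_epsilon_subset[of "f y ` K" U] KU(2) by blast
      obtain R where "\<forall>x\<in>K. norm x \<le> R" using compact_imp_bounded[OF KU(1)] unfolding bounded_iff by blast
      then have R: "K \<subseteq> cball 0 R" by auto
      have "\<forall>\<^sub>F z in nhdsin Y y. \<forall>q\<in>cball 0 R. dist (f z q) (f y q) < e"
        using lim[of y R] y e(1) by (auto simp: uniform_limit_iff)
      then obtain T where T: "openin Y T" "y \<in> T" "\<And>z. z \<in> T \<Longrightarrow> \<forall>q\<in>cball 0 R. dist (f z q) (f y q) < e"
        using y unfolding eventually_nhdsin by auto
      have "T \<subseteq> f -` S \<inter> topspace Y"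
      proof
        fix z assume z: "z \<in> T"
        have "f z q \<in> U" if q: "q \<in> K" for q
        proof -
          have "f z q \<in> ball (f y q) e" using T(3)[OF z] q R by (auto simp: dist_commute)
          then show ?thesis using e(2) q by blast
        qed
        then show "z \<in> f -` S \<inter> topspace Y" using KU(3) z openin_subset[OF T(1)] by auto
      qed
      then show "\<exists>T. openin Y T \<and> y \<in> T \<and> T \<subseteq> f -` S \<inter> topspace Y" using T by blast
    qed
  qed
  then show ?thesis using N by (auto simp: continuous_map_in_subtopology)
qed

text \<open>On unit fields, locally uniform convergence is uniform convergence of the weighted fields.\<close>
definition weighted :: "(real^3 \<Rightarrow> real^3) \<Rightarrow> (real^3) \<Rightarrow>\<^sub>C (real^3)" where
  "weighted V = Bcontfun (\<lambda>q. inverse (1 + norm q) *\<^sub>R V q)"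

lemma weight_pos: "0 < 1 + norm (q::'a::real_normed_vector)"
  by (simp add: add_pos_nonneg)

lemma apply_weighted:
  assumes V: "V \<in> nondeg_fibrations"
  shows "apply_bcontfun (weighted V) q = inverse (1 + norm q) *\<^sub>R V q"
proof -
  have "(\<lambda>q. inverse (1 + norm q) *\<^sub>R V q) \<in> bcontfun"
  proof (rule bcontfun_normI)
    show "continuous_on UNIV (\<lambda>q. inverse (1 + norm q) *\<^sub>R V q)"
      using weight_pos[where 'a="real^3"] by (intro continuous_intros nondeg_continuous V) (auto simp: less_imp_neq[symmetric])
    show "norm (inverse (1 + norm q) *\<^sub>R V q) \<le> 1" for q
      using nondeg_unit[OF V] weight_pos[of q] by (simp add: inverse_le_1_iff)
  qed
  then show ?thesis unfolding weighted_def by (simp add: Bcontfun_inverse)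
qed

text \<open>Provides normality for Tietze's theorem and the Hausdorff property that makes compact
  sets of Hopf fibrations closed.\<close>

lemma metrizable_fibration_space: "metrizable_space fibration_space"
proof -
  define Y where "Y = top_of_set (weighted ` nondeg_fibrations)"
  define k where "k g = (\<lambda>q::real^3. (1 + norm q) *\<^sub>R apply_bcontfun g q :: real^3)" for g
  have kw: "k (weighted V) = V" if "V \<in> nondeg_fibrations" for V
    using weight_pos[where 'a="real^3"] by (simp add: k_def apply_weighted[OF that] fun_eq_iff less_imp_neq[symmetric])
  have "continuous_map fibration_space Y weighted"
    unfolding Y_def continuous_map_in_subtopology
  proof (intro conjI)
    show "continuous_map fibration_space euclidean weighted"
      unfolding continuous_map_def
    proof (intro conjI allI impI)
      fix U :: "((real^3) \<Rightarrow>\<^sub>C (real^3)) set" assume "openin euclidean U"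
      then have "open U" by simp
      show "openin fibration_space {x \<in> topspace fibration_space. weighted x \<in> U}" (is "openin _ ?P")
        unfolding openin_subopen[of _ ?P]
      proof
        fix V assume VP: "V \<in> ?P"
        then have V: "V \<in> nondeg_fibrations" by simp
        have "weighted V \<in> U" using VP by simp
        then obtain e where e: "0 < e" "ball (weighted V) e \<subseteq> U"
          using \<open>open U\<close> open_contains_ball[of U] by blast
        \<comment> \<open>Outside \<open>cball 0 R\<close> the weight is below \<open>e / 4\<close>,
          and two unit vectors differ by at most 2.\<close>
        define R where "R = 4 / e"
        have R: "0 < R" using e by (simp add: R_def)
        have "\<forall>\<^sub>F W in nhdsin fibration_space V. \<forall>q\<in>cball 0 R. dist (W q) (V q) < e / 2"
          by (rule uniform_limitD[OF uniform_nhd[OF V] half_gt_zero[OF e(1)]])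
        then obtain T where T: "openin fibration_space T" "V \<in> T" "\<And>W. W \<in> T \<Longrightarrow> \<forall>q\<in>cball 0 R. dist (W q) (V q) < e / 2"
          using V unfolding eventually_nhdsin by auto
        have "T \<subseteq> ?P"
        proof
          fix W assume W: "W \<in> T"
          then have WN: "W \<in> nondeg_fibrations" using openin_subset[OF T(1)] by auto
          have "dist (weighted W) (weighted V) \<le> e / 2"
          proof (rule dist_bound)
            fix q
            have "dist (apply_bcontfun (weighted W) q) (apply_bcontfun (weighted V) q) = dist (W q) (V q) / (1 + norm q)"
              unfolding apply_weighted[OF V] apply_weighted[OF WN] dist_norm scaleR_diff_right[symmetric] norm_scaleR
              using weight_pos[of q] by (simp add: divide_inverse mult.commute)
            also have "\<dots> \<le> e / 2"
            proof (cases "norm q \<le> R")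
              case True
              then have "dist (W q) (V q) < e / 2" using bspec[OF T(3)[OF W], of q] by simp
              moreover have "e / 2 * 1 \<le> e / 2 * (1 + norm q)" by (rule mult_left_mono) (use e in auto)
              ultimately have "dist (W q) (V q) \<le> e / 2 * (1 + norm q)" by linarith
              then show ?thesis using weight_pos[of q] by (simp add: divide_le_eq)
            next
              case False
              have "dist (W q) (V q) \<le> 2" using norm_triangle_ineq4[of "W q" "V q"] nondeg_unit[OF V] nondeg_unit[OF WN] by (simp add: dist_norm)
              also have "2 = e / 2 * R" using e by (simp add: R_def)
              also have "\<dots> \<le> e / 2 * (1 + norm q)" using False e by (intro mult_left_mono) auto
              finally show ?thesis using weight_pos[of q] by (simp add: divide_le_eq)
            qed
            finally show "dist (apply_bcontfun (weighted W) q) (apply_bcontfun (weighted V) q) \<le> e / 2" .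
          qed
          then have "weighted W \<in> ball (weighted V) e" using e(1) by (simp add: dist_commute)
          then show "W \<in> ?P" using e(2) WN by auto
        qed
        then show "\<exists>T. openin fibration_space T \<and> V \<in> T \<and> T \<subseteq> ?P" using T by blast
      qed
    qed simp
  qed auto
  moreover have "continuous_map Y fibration_space k"
  proof (rule continuous_map_into_fibration_space)
    fix g assume "g \<in> topspace Y"
    then obtain V where V: "V \<in> nondeg_fibrations" "g = weighted V" by (auto simp: Y_def)
    show "k g \<in> nondeg_fibrations" using V kw by simp
    fix R
    show "uniform_limit (cball 0 R) k (k g) (nhdsin Y g)"
      unfolding uniform_limit_iff
    proof (intro allI impI)
      fix e :: real assume e: "0 < e"
      define d where "d = e / (1 + \<bar>R\<bar>)"
      have d: "0 < d" using e by (simp add: d_def add_pos_nonneg)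
      have "openin Y (ball g d \<inter> weighted ` nondeg_fibrations)"
        unfolding Y_def inf_commute[of "ball g d"] by (intro openin_open_Int open_ball)
      moreover have "g \<in> ball g d \<inter> weighted ` nondeg_fibrations" using d V by simp
      moreover have "\<forall>q\<in>cball 0 R. dist (k g' q) (k g q) < e" if "g' \<in> ball g d \<inter> weighted ` nondeg_fibrations" for g'
      proof
        fix q :: "real^3" assume q: "q \<in> cball 0 R"
        have "dist (apply_bcontfun g' q) (apply_bcontfun g q) < d"
          using that dist_bounded[of g' q g] by (simp add: dist_commute[of g])
        then have "(1 + norm q) * dist (apply_bcontfun g' q) (apply_bcontfun g q) < (1 + \<bar>R\<bar>) * d"
          using q weight_pos[of q] by (intro mult_le_less_imp_less) auto
        then show "dist (k g' q) (k g q) < e"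
          using weight_pos[of q] by (simp add: k_def dist_norm d_def abs_of_pos flip: scaleR_diff_right)
      qed
      ultimately show "\<forall>\<^sub>F g' in nhdsin Y g. \<forall>q\<in>cball 0 R. dist (k g' q) (k g q) < e"
        unfolding eventually_nhdsin by blast
    qed
  qed
  ultimately have "homeomorphic_maps fibration_space Y weighted k"
    unfolding homeomorphic_maps_def using kw by (auto simp: Y_def)
  then have "fibration_space homeomorphic_space Y" unfolding homeomorphic_space_def by blast
  moreover have "metrizable_space Y" unfolding Y_def
    by (intro metrizable_space_subtopology metrizable_space_euclidean)
  ultimately show ?thesis using homeomorphic_metrizable_space by blast
qed

section \<open>Centers of Hopf fibrations\<close>

lemma norm_cross_le: "norm (x \<times> y) \<le> norm x * norm (y::real^3)"
proof (rule power2_le_imp_le)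
  show "(norm (x \<times> y))\<^sup>2 \<le> (norm x * norm y)\<^sup>2"
    using norm_cross_dot[of x y] zero_le_power2[of "x \<bullet> y"] by linarith
qed simp

lemma perpendicular_exists:
  fixes v :: "real^3"
  assumes "norm v = 1" "0 \<le> r"
  obtains y where "y \<bullet> v = 0" "norm y = r"
proof -
  have "v \<noteq> 0" using assms(1) by auto
  then obtain e where e: "e \<times> v \<noteq> 0" by (rule exists_nonparallel)
  have "(r *\<^sub>R sgn (e \<times> v)) \<bullet> v = 0" by (simp add: sgn_div_norm dot_cross_self)
  moreover have "norm (r *\<^sub>R sgn (e \<times> v)) = r" using e assms(2) by (simp add: norm_sgn)
  ultimately show ?thesis using that by blast
qed

lemma hopf_twist:
  assumes e: "\<epsilon> * \<epsilon> = 1" and v: "norm v = 1"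
  obtains l where "0 < l" "twist \<epsilon> (q - a) (hopf_field \<epsilon> a v q) = l *\<^sub>R v"
proof
  have v0: "v \<noteq> 0" using v by auto
  let ?u = "untwist \<epsilon> (q - a) v"
  show "0 < inverse (norm ?u)" using untwist_nonzero[OF e v0] by simp
  show "twist \<epsilon> (q - a) (hopf_field \<epsilon> a v q) = inverse (norm ?u) *\<^sub>R v"
    by (simp add: hopf_field_def sgn_div_norm twist_linear twist_untwist[OF e])
qed

lemma hopf_at_center:
  assumes "norm v = 1" shows "hopf_field \<epsilon> a v a = v"
  using assms by (simp add: hopf_field_def untwist_def sgn_div_norm)

lemma hopf_on_plane:
  assumes e: "\<epsilon> * \<epsilon> = 1" and v: "norm v = 1" and y: "y \<bullet> v = 0"
  shows "hopf_field \<epsilon> a v (a + y) = sgn (\<epsilon> *\<^sub>R (v \<times> y) + v)"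
  using hopf_line_direction[OF e v y, of a 0] by simp

text \<open>The norm is in fact \<open>sqrt (1 + y \<bullet> y)\<close>. Its growth serves to
  compare the axes of two Hopf fibrations far out.\<close>

lemma hopf_twist_large:
  assumes e: "\<epsilon> * \<epsilon> = 1" and v: "norm v = 1" and y: "y \<bullet> v = 0"
  shows "norm y \<le> norm (twist \<epsilon> y (hopf_field \<epsilon> a v (a + y)))"
proof -
  let ?u = "hopf_field \<epsilon> a v (a + y)"
  obtain l where l: "0 < l" "twist \<epsilon> (a + y - a) ?u = l *\<^sub>R v" using hopf_twist[OF e v] by blast
  then have lu: "?u = l *\<^sub>R untwist \<epsilon> y v" using untwist_twist[OF e, of y ?u] by (simp add: untwist_scaleR)
  have "untwist \<epsilon> y v = (1 / (1 + y \<bullet> y)) *\<^sub>R (v - \<epsilon> *\<^sub>R (y \<times> v))" using y by (simp add: untwist_def)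
  moreover have "twist \<epsilon> y ?u \<bullet> twist \<epsilon> y ?u = l * l" using l v by (simp add: norm_eq_1)
  moreover have "?u \<bullet> ?u = 1"
  proof -
    have "v \<noteq> 0" using v by auto
    then show ?thesis using untwist_nonzero[OF e] by (simp add: hopf_field_def norm_sgn flip: norm_eq_1)
  qed
  moreover have "(v - \<epsilon> *\<^sub>R (y \<times> v)) \<bullet> (v - \<epsilon> *\<^sub>R (y \<times> v)) = 1 + y \<bullet> y"
  proof -
    have "(v - \<epsilon> *\<^sub>R (y \<times> v)) \<bullet> (v - \<epsilon> *\<^sub>R (y \<times> v)) = twist (- \<epsilon>) y v \<bullet> twist (- \<epsilon>) y v" by (simp add: twist_def)
    also have "\<dots> = v \<bullet> v + (y \<times> v) \<bullet> (y \<times> v)" by (rule twist_inner(2)[OF e])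
    also have "(y \<times> v) \<bullet> (y \<times> v) = y \<bullet> y"
      using norm_cross_dot[of y v] y v by (simp add: dot_square_norm)
    finally show ?thesis using v by (simp add: norm_eq_1)
  qed
  ultimately have "l * l = 1 + y \<bullet> y" using lu
    by (auto simp: mult.assoc split: if_splits)
  then have "(norm y)\<^sup>2 \<le> (norm (twist \<epsilon> y ?u))\<^sup>2"
    using \<open>twist \<epsilon> y ?u \<bullet> twist \<epsilon> y ?u = l * l\<close> by (simp add: power2_norm_eq_inner)
  then show ?thesis by (rule power2_le_imp_le) simp
qed

text \<open>Moving the center by \<open>d\<close> changes the twisted vectors by at most
  \<open>norm d\<close>. They become long far out, so their directions \<open>v\<close> and
  \<open>v'\<close> agree. Then \<open>d \<times> ?V q\<close> is always a multiple of
  \<open>v\<close>, and looking at \<open>a\<close> and at one more point of the plane forces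
  \<open>d = 0\<close>.\<close>

lemma hopf_unique:
  assumes e: "\<epsilon> = 1 \<or> \<epsilon> = -1" and v: "norm v = 1" and e': "\<epsilon>' = 1 \<or> \<epsilon>' = -1" and v': "norm v' = 1"
    and eq: "hopf_field \<epsilon> a v = hopf_field \<epsilon>' a' v'"
  shows "\<epsilon> = \<epsilon>' \<and> a = a'"
proof
  show ee': "\<epsilon> = \<epsilon>'" using handed_unique hopf_handed[OF e v, of a] hopf_handed[OF e' v', of a'] eq by metis
  have ee: "\<epsilon> * \<epsilon> = 1" using e by auto
  have eps0: "\<epsilon> \<noteq> 0" using e by auto
  let ?V = "hopf_field \<epsilon> a v"
  have V': "?V = hopf_field \<epsilon> a' v'" using eq ee' by simp
  define d where "d = a - a'"
  have tw: "twist \<epsilon> (q - a') u = twist \<epsilon> (q - a) u + \<epsilon> *\<^sub>R (d \<times> u)" for q u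
    by (simp add: twist_def d_def Cross3.left_diff_distrib algebra_simps)
  have rel: "\<exists>l l'. 0 < l \<and> 0 < l' \<and> twist \<epsilon> (q - a) (?V q) = l *\<^sub>R v \<and> l' *\<^sub>R v' = l *\<^sub>R v + \<epsilon> *\<^sub>R (d \<times> ?V q)" for q
  proof -
    obtain l where l: "0 < l" "twist \<epsilon> (q - a) (?V q) = l *\<^sub>R v" using hopf_twist[OF ee v] by blast
    obtain l' where l': "0 < l'" "twist \<epsilon> (q - a') (hopf_field \<epsilon> a' v' q) = l' *\<^sub>R v'" using hopf_twist[OF ee v'] by blast
    have "l' *\<^sub>R v' = l *\<^sub>R v + \<epsilon> *\<^sub>R (d \<times> ?V q)" using l'(2) l(2) tw[of q "?V q"] V' by simp
    then show ?thesis using l l' by blast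
  qed
  have n1: "norm (?V q) = 1" for q using nondeg_unit[OF hopf_field_nondeg[OF ee v]] .
  have vv: "v = v'"
  proof (rule ccontr)
    assume "v \<noteq> v'"
    then have \<delta>: "0 < norm (v - v')" by simp
    \<comment> \<open>Two vectors of norm at least \<open>m\<close> at distance at most
      \<open>norm d\<close> have directions closer than \<open>norm (v - v')\<close>.\<close>
    define m where "m = (norm d + 1) / norm (v - v')"
    have m: "0 < m" using \<delta> by (simp add: m_def add_nonneg_pos)
    obtain y where y: "y \<bullet> v = 0" "norm y = norm d + m" using perpendicular_exists[OF v, of "norm d + m"] m by auto
    obtain l l' where l: "0 < l" "0 < l'" "twist \<epsilon> (a + y - a) (?V (a + y)) = l *\<^sub>R v"
      "l' *\<^sub>R v' = l *\<^sub>R v + \<epsilon> *\<^sub>R (d \<times> ?V (a + y))" using rel[of "a + y"] by blast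
    have "norm y \<le> l" using hopf_twist_large[OF ee v y(1), of a] l v by simp
    moreover have dl: "norm (l' *\<^sub>R v' - l *\<^sub>R v) \<le> norm d"
      using norm_cross_le[of d "?V (a + y)"] n1 e by (auto simp: l(4))
    moreover have nl: "norm (l *\<^sub>R v) = l" "norm (l' *\<^sub>R v') = l'" using l(1,2) v v' by simp_all
    moreover have "norm (l *\<^sub>R v) \<le> norm (l' *\<^sub>R v') + norm (l' *\<^sub>R v' - l *\<^sub>R v)"
      using norm_triangle_ineq4[of "l' *\<^sub>R v'" "l' *\<^sub>R v' - l *\<^sub>R v"] by (simp only: diff_diff_eq2 add_diff_cancel_left')
    ultimately have "m \<le> norm (l' *\<^sub>R v')" "m \<le> norm (l *\<^sub>R v)"
      using y(2) norm_ge_zero[of d] by linarith+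
    then have "m * norm (sgn (l' *\<^sub>R v') - sgn (l *\<^sub>R v)) \<le> norm (l' *\<^sub>R v' - l *\<^sub>R v)"
      using m by (intro sgn_lipschitz) auto
    moreover have "sgn (l' *\<^sub>R v') = v'" "sgn (l *\<^sub>R v) = v" using l(1,2) v v' by (simp_all add: sgn_scaleR) (simp_all add: sgn_div_norm)
    ultimately have "m * norm (v - v') \<le> norm d" using dl by (simp add: norm_minus_commute)
    then show False using \<delta> by (simp add: m_def)
  qed
  have key: "d \<times> ?V q \<bullet> v = 0 \<Longrightarrow> d \<times> ?V q = 0" for q
  proof -
    assume 0: "d \<times> ?V q \<bullet> v = 0"
    obtain l l' where l: "l' *\<^sub>R v' = l *\<^sub>R v + \<epsilon> *\<^sub>R (d \<times> ?V q)" using rel[of q] by blast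
    then have eqd: "\<epsilon> *\<^sub>R (d \<times> ?V q) = (l' - l) *\<^sub>R v" using vv by (simp add: algebra_simps)
    have "(\<epsilon> *\<^sub>R (d \<times> ?V q)) \<bullet> v = 0" using 0 by simp
    then have "(l' - l) * (v \<bullet> v) = 0" unfolding eqd by (simp only: inner_scaleR_left)
    moreover have "v \<bullet> v = 1" using v by (simp add: norm_eq_1)
    ultimately have "l' - l = 0" by (simp only: mult_1_right)
    then show "d \<times> ?V q = 0" using eqd eps0 by simp
  qed
  have "d \<times> v = 0" using key[of a] hopf_at_center[OF v] by (simp add: dot_cross_self)
  then have dv: "d = (d \<bullet> v) *\<^sub>R v" by (rule parallel_imp_multiple[OF v])
  obtain y where y: "y \<bullet> v = 0" "norm y = 1" using perpendicular_exists[OF v, of 1] by auto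
  let ?T = "\<epsilon> *\<^sub>R (v \<times> y) + v"
  have Vy: "?V (a + y) = sgn ?T" by (rule hopf_on_plane[OF ee v y(1)])
  have "d \<times> ?V (a + y) \<bullet> v = 0"
    by (subst dv) (simp add: cross_mult_left dot_cross_self)
  then have "d \<times> sgn ?T = 0" using key[of "a + y"] Vy by simp
  moreover have "?T \<noteq> 0"
  proof
    assume "?T = 0"
    then have "?T \<bullet> v = 0" by simp
    then show False using v by (simp add: inner_add_left dot_cross_self norm_eq_1)
  qed
  ultimately have "d \<times> ?T = 0" by (simp add: sgn_div_norm cross_mult_right)
  then have "(d \<bullet> v) *\<^sub>R (v \<times> ?T) = 0" using dv cross_mult_left by metis
  moreover have "v \<times> ?T = - (\<epsilon> *\<^sub>R y)"
    using y v by (simp add: cross_add_right cross_mult_right triple_double_cross inner_commute norm_eq_1)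
  ultimately have "d \<bullet> v = 0" using eps0 y(2) by auto
  then have "d = 0" using dv by simp
  then show "a = a'" by (simp add: d_def)
qed

text \<open>The twisted vectors at \<open>q\<close> and \<open>q'\<close> are multiples of
  \<open>v\<close>, so their cross product vanishes. Its part quadratic in \<open>a\<close> is
  \<open>a \<bullet> (V q \<times> V q')\<close> times \<open>a\<close>, and the rest grows at most
  linearly in \<open>norm a\<close>, so this coefficient stays bounded.\<close>

lemma hopf_center_pair_bound:
  assumes e: "\<epsilon> = 1 \<or> \<epsilon> = -1" and v: "norm v = 1" and a: "1 \<le> norm a"
    and q: "1 + norm q \<le> M" "1 + norm q' \<le> M"
  defines "V \<equiv> hopf_field \<epsilon> a v"
  shows "\<bar>a \<bullet> (V q \<times> V q')\<bar> \<le> M * M + 2 * M"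
proof -
  have ee: "\<epsilon> * \<epsilon> = 1" using e by auto
  have n1: "norm (V q) = 1" for q using nondeg_unit[OF hopf_field_nondeg[OF ee v]] by (simp add: V_def)
  define y where "y q = V q + \<epsilon> *\<^sub>R (q \<times> V q)" for q
  have xy: "twist \<epsilon> (q - a) (V q) = y q - \<epsilon> *\<^sub>R (a \<times> V q)" for q
    by (simp add: twist_def y_def Cross3.left_diff_distrib algebra_simps)
  have abs_e: "\<bar>\<epsilon>\<bar> = 1" using e by auto
  have ny: "norm (y q) \<le> 1 + norm q" for q
    using norm_triangle_ineq[of "V q" "\<epsilon> *\<^sub>R (q \<times> V q)"] norm_cross_le[of q "V q"] n1[of q] abs_e by (simp add: y_def)
  have nA: "norm (a \<times> V q) \<le> norm a" for q using norm_cross_le[of a "V q"] n1 by simp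
  have M: "0 \<le> M" using q norm_ge_zero[of q] by linarith
  obtain l l' where "twist \<epsilon> (q - a) (V q) = l *\<^sub>R v" "twist \<epsilon> (q' - a) (V q') = l' *\<^sub>R v"
    unfolding V_def using hopf_twist[OF ee v] by metis
  then have "twist \<epsilon> (q - a) (V q) \<times> twist \<epsilon> (q' - a) (V q') = 0" by (simp add: cross_mult_left cross_mult_right)
  then have "(y q - \<epsilon> *\<^sub>R (a \<times> V q)) \<times> (y q' - \<epsilon> *\<^sub>R (a \<times> V q')) = 0" by (simp only: xy)
  moreover have "(y q - \<epsilon> *\<^sub>R (a \<times> V q)) \<times> (y q' - \<epsilon> *\<^sub>R (a \<times> V q'))
     = y q \<times> y q' - \<epsilon> *\<^sub>R (y q \<times> (a \<times> V q')) - \<epsilon> *\<^sub>R ((a \<times> V q) \<times> y q') + (\<epsilon> * \<epsilon>) *\<^sub>R ((a \<times> V q) \<times> (a \<times> V q'))"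
    by (simp only: Cross3.left_diff_distrib Cross3.right_diff_distrib cross_mult_left cross_mult_right scaleR_scaleR)
      (simp add: scaleR_diff_right)
  ultimately have "(a \<times> V q) \<times> (a \<times> V q') = \<epsilon> *\<^sub>R (y q \<times> (a \<times> V q')) + \<epsilon> *\<^sub>R ((a \<times> V q) \<times> y q') - y q \<times> y q'"
    unfolding ee by (simp add: algebra_simps)
  also have "norm \<dots> \<le> norm (\<epsilon> *\<^sub>R (y q \<times> (a \<times> V q'))) + norm (\<epsilon> *\<^sub>R ((a \<times> V q) \<times> y q')) + norm (y q \<times> y q')"
    by (intro norm_triangle_le_diff add_right_mono norm_triangle_ineq)
  also have "\<dots> \<le> M * norm a + norm a * M + M * M"
  proof (intro add_mono)
    have "norm (y q \<times> (a \<times> V q')) \<le> norm (y q) * norm (a \<times> V q')" by (rule norm_cross_le)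
    also have "\<dots> \<le> M * norm a" using ny[of q] nA[of q'] q(1) M by (intro mult_mono) auto
    finally show "norm (\<epsilon> *\<^sub>R (y q \<times> (a \<times> V q'))) \<le> M * norm a" by (simp add: abs_e)
    have "norm ((a \<times> V q) \<times> y q') \<le> norm (a \<times> V q) * norm (y q')" by (rule norm_cross_le)
    also have "\<dots> \<le> norm a * M" using ny[of q'] nA[of q] q(2) M by (intro mult_mono) auto
    finally show "norm (\<epsilon> *\<^sub>R ((a \<times> V q) \<times> y q')) \<le> norm a * M" by (simp add: abs_e)
    have "norm (y q \<times> y q') \<le> norm (y q) * norm (y q')" by (rule norm_cross_le)
    also have "\<dots> \<le> M * M" using ny[of q] ny[of q'] q M by (intro mult_mono) auto
    finally show "norm (y q \<times> y q') \<le> M * M" .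
  qed
  also have "(a \<times> V q) \<times> (a \<times> V q') = (a \<bullet> (V q \<times> V q')) *\<^sub>R a"
    unfolding vec_eq_iff forall_3 by (simp add: cross_components inner_vec_def sum_3 algebra_simps)
  finally have "\<bar>a \<bullet> (V q \<times> V q')\<bar> * norm a \<le> (2 * M) * norm a + M * M" by simp
  also have "\<dots> \<le> (2 * M) * norm a + (M * M) * norm a"
    using a M mult_left_mono[OF a, of "M * M"] by simp
  also have "\<dots> = (M * M + 2 * M) * norm a" by (simp add: algebra_simps)
  finally show ?thesis by (rule mult_right_le_imp_le) (use a in linarith)
qed

lemma cramer_identity:
  fixes a w1 w2 w3 :: "real^3"
  shows "(w1 \<bullet> (w2 \<times> w3)) *\<^sub>R a = (a \<bullet> (w2 \<times> w3)) *\<^sub>R w1 + (a \<bullet> (w3 \<times> w1)) *\<^sub>R w2 + (a \<bullet> (w1 \<times> w2)) *\<^sub>R w3"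
  unfolding vec_eq_iff forall_3 by (simp add: cross_components inner_vec_def sum_3 algebra_simps)

text \<open>The bounds for the three pairs of directions determine \<open>a\<close> by Cramer's rule
  as long as the determinant of the directions stays away from 0.\<close>

lemma hopf_center_bound:
  assumes e: "\<epsilon> = 1 \<or> \<epsilon> = -1" and v: "norm v = 1"
    and q: "1 + norm q1 \<le> M" "1 + norm q2 \<le> M" "1 + norm q3 \<le> M"
    and d: "0 < d" "d \<le> \<bar>hopf_field \<epsilon> a v q1 \<bullet> (hopf_field \<epsilon> a v q2 \<times> hopf_field \<epsilon> a v q3)\<bar>"
  shows "norm a \<le> max 1 (3 * (M * M + 2 * M) / d)"
proof (cases "1 \<le> norm a")
  case a: True
  have ee: "\<epsilon> * \<epsilon> = 1" using e by auto
  let ?w = "hopf_field \<epsilon> a v"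
  have n1: "norm (?w q) = 1" for q using nondeg_unit[OF hopf_field_nondeg[OF ee v]] .
  have "d * norm a \<le> \<bar>?w q1 \<bullet> (?w q2 \<times> ?w q3)\<bar> * norm a" using d by (intro mult_right_mono) auto
  also have "\<dots> = norm ((?w q1 \<bullet> (?w q2 \<times> ?w q3)) *\<^sub>R a)" by simp
  also have "\<dots> \<le> norm ((a \<bullet> (?w q2 \<times> ?w q3)) *\<^sub>R ?w q1) + norm ((a \<bullet> (?w q3 \<times> ?w q1)) *\<^sub>R ?w q2) + norm ((a \<bullet> (?w q1 \<times> ?w q2)) *\<^sub>R ?w q3)"
    unfolding cramer_identity[of "?w q1" "?w q2" "?w q3" a]
    by (intro norm_triangle_le add_right_mono norm_triangle_ineq)
  also have "\<dots> \<le> (M * M + 2 * M) + (M * M + 2 * M) + (M * M + 2 * M)"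
    using hopf_center_pair_bound[OF e v a q(2) q(3)] hopf_center_pair_bound[OF e v a q(3) q(1)] hopf_center_pair_bound[OF e v a q(1) q(2)]
    by (intro add_mono) (simp_all add: n1)
  finally have "norm a \<le> 3 * (M * M + 2 * M) / d" using d(1) by (simp add: field_simps)
  then show ?thesis by simp
qed simp

text \<open>If all directions were normal to some \<open>n\<close>, the fibers through 0 and through
  \<open>n \<times> V 0\<close> would be coplanar, hence equal, which forces
  \<open>n = 0\<close>.\<close>

lemma three_independent_directions:
  assumes V: "V \<in> nondeg_fibrations"
  obtains q1 q2 q3 where "V q1 \<bullet> (V q2 \<times> V q3) \<noteq> 0"
proof -
  obtain q q' where qq: "(q - q') \<bullet> (V q \<times> V q') \<noteq> 0" using two_fibers[OF V] by blast
  define n where "n = V q \<times> V q'"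
  have n0: "n \<noteq> 0" using qq by (auto simp: n_def)
  have "\<exists>p. V p \<bullet> n \<noteq> 0"
  proof (rule ccontr)
    assume "\<not> ?thesis"
    then have perp: "V p \<bullet> n = 0" for p by blast
    define e where "e = n \<times> V 0"
    have "(e - 0) \<bullet> (V e \<times> V 0) = 0"
    proof -
      have "n \<times> (V e \<times> V 0) = 0" using perp[of e] perp[of 0] by (simp add: triple_double_cross inner_commute)
      then have "(n \<times> (V e \<times> V 0)) \<bullet> V 0 = 0" by simp
      then show ?thesis unfolding e_def by (simp add: cross3_simps)
    qed
    then obtain t where t: "e = 0 + t *\<^sub>R V 0" using nondeg_skew[OF V] by blast
    have "e \<bullet> V 0 = 0" by (simp add: e_def dot_cross_self)
    then have "t = 0" using t nondeg_inner_self[OF V] by simp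
    then have "n \<times> V 0 = 0" using t e_def by simp
    then have "n = (n \<bullet> V 0) *\<^sub>R V 0" using parallel_imp_multiple[OF nondeg_unit[OF V]] by blast
    then show False using perp[of 0] n0 by (simp add: inner_commute)
  qed
  then show ?thesis using that unfolding n_def by blast
qed

lemma tendsto_nhdsin_point:
  assumes "V \<in> nondeg_fibrations"
  shows "((\<lambda>W. W q) \<longlongrightarrow> V q) (nhdsin fibration_space V)"
  by (rule tendsto_uniform_limitI[OF uniform_nhd[OF assms, of "norm q"]]) simp

lemma continuous_map_hopf:
  assumes e: "\<epsilon> * \<epsilon> = 1"
  shows "continuous_map (top_of_set (Sigma UNIV (\<lambda>_. sphere 0 1))) fibration_space (\<lambda>p. hopf_field \<epsilon> (fst p) (snd p))"
proof (rule continuous_map_into_fibration_space)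
  let ?S = "Sigma UNIV (\<lambda>_::real^3. sphere (0::real^3) 1)"
  fix p assume "p \<in> topspace (top_of_set ?S)"
  then have p: "p \<in> ?S" by simp
  show "hopf_field \<epsilon> (fst p) (snd p) \<in> nondeg_fibrations"
    by (rule hopf_field_nondeg[OF e]) (use p in auto)
  fix R
  show "uniform_limit (cball 0 R) (\<lambda>p. hopf_field \<epsilon> (fst p) (snd p)) (hopf_field \<epsilon> (fst p) (snd p)) (nhdsin (top_of_set ?S) p)"
    unfolding uniform_limit_iff
  proof (intro allI impI)
    fix d :: real assume d: "0 < d"
    let ?T = "Sigma ?S (\<lambda>_. cball 0 R)"
    have cu: "continuous_on ?T (\<lambda>x. untwist \<epsilon> (snd x - fst (fst x)) (snd (fst x)))"
      unfolding untwist_def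
      by (intro continuous_intros continuous_on_cross) (simp add: one_plus_self_pos less_imp_neq[symmetric])
    have nz: "untwist \<epsilon> (snd x - fst (fst x)) (snd (fst x)) \<noteq> 0" if "x \<in> ?T" for x
    proof -
      have "norm (snd (fst x)) = 1" using that by auto
      then have "snd (fst x) \<noteq> 0" by auto
      then show ?thesis by (rule untwist_nonzero[OF e])
    qed
    have c: "continuous_on ?T (\<lambda>x. hopf_field \<epsilon> (fst (fst x)) (snd (fst x)) (snd x))"
      unfolding hopf_field_def sgn_div_norm
      by (intro continuous_on_scaleR continuous_on_inverse continuous_on_norm cu) (use nz in auto)
    obtain X0 where X0: "p \<in> X0" "open X0"
      "\<forall>x\<in>X0 \<inter> ?S. \<forall>t\<in>cball 0 R. dist (hopf_field \<epsilon> (fst x) (snd x) t) (hopf_field \<epsilon> (fst p) (snd p) t) \<le> d / 2"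
      using continuous_on_prod_compactE[OF c compact_cball p half_gt_zero[OF d]] by auto
    have "openin (top_of_set ?S) (?S \<inter> X0)" using X0(2) by (rule openin_open_Int)
    moreover have "p \<in> ?S \<inter> X0" using p X0(1) by blast
    moreover have "\<forall>t\<in>cball 0 R. dist (hopf_field \<epsilon> (fst x) (snd x) t) (hopf_field \<epsilon> (fst p) (snd p) t) < d"
      if "x \<in> ?S \<inter> X0" for x
    proof
      fix t :: "real^3" assume "t \<in> cball 0 R"
      then have "dist (hopf_field \<epsilon> (fst x) (snd x) t) (hopf_field \<epsilon> (fst p) (snd p) t) \<le> d / 2" using X0(3) that by blast
      then show "dist (hopf_field \<epsilon> (fst x) (snd x) t) (hopf_field \<epsilon> (fst p) (snd p) t) < d" using d by linarith
    qed
    ultimately show "\<forall>\<^sub>F x in nhdsin (top_of_set ?S) p. \<forall>t\<in>cball 0 R. dist (hopf_field \<epsilon> (fst x) (snd x) t) (hopf_field \<epsilon> (fst p) (snd p) t) < d"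
      unfolding eventually_nhdsin by blast
  qed
qed

lemma Hausdorff_fibration_space: "Hausdorff_space fibration_space"
  by (rule metrizable_imp_Hausdorff_space[OF metrizable_fibration_space])

definition hopf_center :: "real^3 \<Rightarrow> (real^3 \<Rightarrow> real^3) \<Rightarrow> bool" where
  "hopf_center a V \<longleftrightarrow> (\<exists>v \<epsilon>. norm v = 1 \<and> (\<epsilon> = 1 \<or> \<epsilon> = -1) \<and> V = hopf_field \<epsilon> a v)"

lemma hopf_center_unique: "hopf_center a V \<Longrightarrow> hopf_center a' V \<Longrightarrow> a = a'"
  unfolding hopf_center_def using hopf_unique by blast

text \<open>The centers of the Hopf fibrations close to a given nondegenerate fibration stay bounded, so
  compactness applies.\<close>
lemma hopf_center_nhd:
  assumes V: "V \<in> nondeg_fibrations" and T: "open T" and cen: "\<And>a. hopf_center a V \<Longrightarrow> a \<in> T"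
  obtains U where "openin fibration_space U" "V \<in> U" "\<And>W a. W \<in> U \<Longrightarrow> hopf_center a W \<Longrightarrow> a \<in> T"
proof -
  obtain q1 q2 q3 where q: "V q1 \<bullet> (V q2 \<times> V q3) \<noteq> 0" using three_independent_directions[OF V] by blast
  define d where "d = \<bar>V q1 \<bullet> (V q2 \<times> V q3)\<bar> / 2"
  have d: "0 < d" "d < \<bar>V q1 \<bullet> (V q2 \<times> V q3)\<bar>" using q by (simp_all add: d_def)
  have "((\<lambda>W. W q2 \<times> W q3) \<longlongrightarrow> V q2 \<times> V q3) (nhdsin fibration_space V)"
    by (intro bounded_bilinear.tendsto[OF bilinear_conv_bounded_bilinear[THEN iffD1, OF bilinear_cross]] tendsto_nhdsin_point V)
  then have "((\<lambda>W. \<bar>W q1 \<bullet> (W q2 \<times> W q3)\<bar>) \<longlongrightarrow> \<bar>V q1 \<bullet> (V q2 \<times> V q3)\<bar>) (nhdsin fibration_space V)"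
    by (intro tendsto_rabs tendsto_inner tendsto_nhdsin_point V)
  then have "\<forall>\<^sub>F W in nhdsin fibration_space V. d < \<bar>W q1 \<bullet> (W q2 \<times> W q3)\<bar>" using d(2) by (rule order_tendstoD(1))
  then obtain U1 where U1: "openin fibration_space U1" "V \<in> U1" "\<And>W. W \<in> U1 \<Longrightarrow> d < \<bar>W q1 \<bullet> (W q2 \<times> W q3)\<bar>"
    using V unfolding eventually_nhdsin by auto
  define M where "M = 1 + norm q1 + norm q2 + norm q3"
  define K where "K = max 1 (3 * (M * M + 2 * M) / d)"
  \<comment> \<open>Parameters of the Hopf fibrations to be excluded: centers bounded by
    \<open>K\<close> but outside \<open>T\<close>. The set is compact, so for each sign the
    fibrations it parametrizes form a closed set, which is removed from \<open>U1\<close>.\<close>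
  define Z where "Z = Sigma (cball 0 K - T) (\<lambda>_::real^3. sphere (0::real^3) 1)"
  have "compact Z" unfolding Z_def by (intro compact_Times compact_diff T) auto
  define I where "I \<epsilon> = (\<lambda>p. hopf_field \<epsilon> (fst p) (snd p)) ` Z" for \<epsilon>
  have cl: "closedin fibration_space (I \<epsilon>)" if e: "\<epsilon> * \<epsilon> = 1" for \<epsilon>
  proof -
    have "Z \<subseteq> Sigma UNIV (\<lambda>_. sphere 0 1)" by (auto simp: Z_def)
    then have "compactin (top_of_set (Sigma UNIV (\<lambda>_. sphere 0 1))) Z"
      using \<open>compact Z\<close> by (simp add: compactin_subtopology)
    then have "compactin fibration_space (I \<epsilon>)"
      unfolding I_def using continuous_map_hopf[OF e] by (rule image_compactin)
    then show ?thesis by (rule compactin_imp_closedin[OF Hausdorff_fibration_space])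
  qed
  define U where "U = U1 - I 1 - I (-1)"
  have "openin fibration_space U" unfolding U_def by (intro openin_diff U1 cl) auto
  moreover have "V \<in> U"
  proof -
    have "V \<notin> I \<epsilon>" if "\<epsilon> = 1 \<or> \<epsilon> = -1" for \<epsilon>
    proof
      assume "V \<in> I \<epsilon>"
      then obtain a v where "a \<notin> T" "norm v = 1" "V = hopf_field \<epsilon> a v" by (auto simp: I_def Z_def)
      then show False using cen that unfolding hopf_center_def by blast
    qed
    then show ?thesis using U1(2) by (simp add: U_def)
  qed
  moreover have "a \<in> T" if W: "W \<in> U" and c: "hopf_center a W" for W a
  proof (rule ccontr)
    assume a: "a \<notin> T"
    obtain v \<epsilon> where v: "norm v = 1" "\<epsilon> = 1 \<or> \<epsilon> = -1" "W = hopf_field \<epsilon> a v" using c unfolding hopf_center_def by blast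
    have "W \<in> U1" using W by (simp add: U_def)
    then have "d \<le> \<bar>hopf_field \<epsilon> a v q1 \<bullet> (hopf_field \<epsilon> a v q2 \<times> hopf_field \<epsilon> a v q3)\<bar>"
      using less_imp_le[OF U1(3)] v(3) by blast
    then have "norm a \<le> K" unfolding K_def
      by (intro hopf_center_bound[OF v(2,1) _ _ _ d(1)]) (simp_all add: M_def)
    then have "(a, v) \<in> Z" using a v(1) by (simp add: Z_def)
    then have "W \<in> I \<epsilon>" unfolding I_def using v(3) by force
    then show False using W v(2) by (auto simp: U_def)
  qed
  ultimately show ?thesis using that by blast
qed

abbreviation hopf_fibrations :: "(real^3 \<Rightarrow> real^3) set" where
  "hopf_fibrations \<equiv> {V \<in> nondeg_fibrations. hopf_fibration V}"

lemma hopf_fibration_center: "hopf_fibration V \<longleftrightarrow> (\<exists>a. hopf_center a V)"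
  unfolding hopf_fibration_iff hopf_center_def by blast

text \<open>The case \<open>T = {}\<close> of \<open>hopf_center_nhd\<close>: a fibration without
  center has a neighborhood of such fibrations.\<close>

lemma closedin_hopf: "closedin fibration_space hopf_fibrations"
proof -
  have "openin fibration_space (nondeg_fibrations - hopf_fibrations)" (is "openin _ ?P")
    unfolding openin_subopen[of _ ?P]
  proof
    fix V assume "V \<in> ?P"
    then have V: "V \<in> nondeg_fibrations" "\<And>a. \<not> hopf_center a V" using hopf_fibration_center by blast+
    obtain U where U: "openin fibration_space U" "V \<in> U" "\<And>W a. W \<in> U \<Longrightarrow> hopf_center a W \<Longrightarrow> a \<in> {}"
      using hopf_center_nhd[OF V(1) open_empty] V(2) by blast
    have "U \<subseteq> ?P" using U(3) hopf_fibration_center openin_subset[OF U(1)] by auto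
    then show "\<exists>U. openin fibration_space U \<and> V \<in> U \<and> U \<subseteq> ?P" using U by blast
  qed
  then show ?thesis by (auto simp: closedin_def)
qed

definition center :: "(real^3 \<Rightarrow> real^3) \<Rightarrow> real^3" where
  "center V = (THE a. hopf_center a V)"

lemma center_eq: "hopf_center a V \<Longrightarrow> center V = a"
  unfolding center_def using hopf_center_unique by blast

lemma continuous_map_center: "continuous_map (subtopology fibration_space hopf_fibrations) euclidean center"
  unfolding continuous_map_def
proof (intro conjI allI impI)
  let ?A = "subtopology fibration_space hopf_fibrations"
  fix T :: "(real^3) set" assume "openin euclidean T"
  then have T: "open T" by simp
  let ?P = "{V \<in> topspace ?A. center V \<in> T}"
  show "openin ?A ?P" unfolding openin_subopen[of _ ?P]
  proof
    fix V assume "V \<in> ?P"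
    then have V: "V \<in> nondeg_fibrations" "hopf_fibration V" "center V \<in> T" by auto
    have "\<And>a. hopf_center a V \<Longrightarrow> a \<in> T" using V(3) center_eq by metis
    then obtain U where U: "openin fibration_space U" "V \<in> U" "\<And>W a. W \<in> U \<Longrightarrow> hopf_center a W \<Longrightarrow> a \<in> T"
      using hopf_center_nhd[OF V(1) T] by blast
    have "openin ?A (U \<inter> hopf_fibrations)" using U(1) by (auto simp: openin_subtopology)
    moreover have "V \<in> U \<inter> hopf_fibrations" using U(2) V by blast
    moreover have "U \<inter> hopf_fibrations \<subseteq> ?P"
    proof
      fix W assume W: "W \<in> U \<inter> hopf_fibrations"
      then obtain a where a: "hopf_center a W" using hopf_fibration_center by blast
      then have "center W \<in> T" using U(3) W center_eq[OF a] by blast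
      then show "W \<in> ?P" using W by simp
    qed
    ultimately show "\<exists>U. openin ?A U \<and> V \<in> U \<and> U \<subseteq> ?P" by blast
  qed
qed simp

lemma tendsto_nhdsin:
  assumes "continuous_map X euclidean f" "x \<in> topspace X"
  shows "(f \<longlongrightarrow> f x) (nhdsin X x)"
proof (rule topological_tendstoI)
  fix S assume "open S" "f x \<in> S"
  then have "openin X {y \<in> topspace X. f y \<in> S}" using assms(1) by (simp add: continuous_map_def)
  moreover have "x \<in> {y \<in> topspace X. f y \<in> S}" using assms(2) \<open>f x \<in> S\<close> by simp
  ultimately show "\<forall>\<^sub>F y in nhdsin X x. f y \<in> S" unfolding eventually_nhdsin by blast
qed

lemma filterlim_nhdsin:
  assumes "continuous_map X Y f" "x \<in> topspace X"
  shows "filterlim f (nhdsin Y (f x)) (nhdsin X x)"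
  unfolding filterlim_iff
proof (intro allI impI)
  fix P assume "eventually P (nhdsin Y (f x))"
  moreover have "f x \<in> topspace Y" using assms unfolding continuous_map_def by blast
  ultimately obtain S where S: "openin Y S" "f x \<in> S" "\<forall>y\<in>S. P y" unfolding eventually_nhdsin by blast
  then have "openin X {y \<in> topspace X. f y \<in> S}" using assms(1) by (simp add: continuous_map_def)
  then show "\<forall>\<^sub>F y in nhdsin X x. P (f y)" unfolding eventually_nhdsin using S assms(2) by blast
qed

lemma center_extension:
  obtains b :: "(real^3 \<Rightarrow> real^3) \<Rightarrow> real^3"
  where "\<And>V. V \<in> hopf_fibrations \<Longrightarrow> b V = center V"
    "\<And>V. V \<in> nondeg_fibrations \<Longrightarrow> (b \<longlongrightarrow> b V) (nhdsin fibration_space V)"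
proof -
  have "\<exists>g. continuous_map fibration_space euclideanreal g \<and> (\<forall>V\<in>hopf_fibrations. g V = center V \<bullet> i)" for i
  proof -
    have c: "continuous_map (subtopology fibration_space hopf_fibrations) euclideanreal ((\<lambda>x. x \<bullet> i) \<circ> center)"
    proof (rule continuous_map_compose[OF continuous_map_center])
      have "continuous_on UNIV (\<lambda>x. x \<bullet> i)" by (intro continuous_intros)
      then show "continuous_map euclidean euclideanreal (\<lambda>x. x \<bullet> i)" by simp
    qed
    have "is_interval (UNIV :: real set)" by simp
    from metrizable_imp_normal_space[OF metrizable_fibration_space] closedin_hopf this UNIV_not_empty c subset_UNIV
    show ?thesis
    proof (rule Tietze_extension_realinterval)
      fix g :: "(real^3 \<Rightarrow> real^3) \<Rightarrow> real"
      assume "continuous_map fibration_space euclideanreal g"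
        and "\<And>V. V \<in> hopf_fibrations \<Longrightarrow> g V = ((\<lambda>x. x \<bullet> i) \<circ> center) V"
      then show ?thesis by (intro exI[of _ g]) simp
    qed
  qed
  then have "\<forall>i. \<exists>g. continuous_map fibration_space euclideanreal g \<and> (\<forall>V\<in>hopf_fibrations. g V = center V \<bullet> i)" ..
  from choice[OF this] obtain g where
    g': "\<forall>i. continuous_map fibration_space euclideanreal (g i) \<and> (\<forall>V\<in>hopf_fibrations. g i V = center V \<bullet> i)" ..
  have g: "continuous_map fibration_space euclideanreal (g i)" for i using g'[rule_format, of i] ..
  have g_eq: "g i V = center V \<bullet> i" if "V \<in> hopf_fibrations" for i V
    using conjunct2[OF g'[rule_format, of i]] that by (rule bspec)
  define b where "b V = (\<Sum>i\<in>Basis. g i V *\<^sub>R i)" for V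
  have "b V = center V" if "V \<in> hopf_fibrations" for V
    using g_eq[OF that] by (simp add: b_def euclidean_representation)
  moreover have "(b \<longlongrightarrow> b V) (nhdsin fibration_space V)" if "V \<in> nondeg_fibrations" for V
    unfolding b_def by (intro tendsto_sum tendsto_scaleR tendsto_const tendsto_nhdsin g) (use that in simp)
  ultimately show ?thesis using that by blast
qed

section \<open>The deformation\<close>

lemma uniform_limit_shift:
  fixes W :: "'i \<Rightarrow> real^3 \<Rightarrow> real^3"
  assumes lim: "\<And>R. uniform_limit (cball 0 R) W V F" and b: "(b \<longlongrightarrow> b0) F" and V: "continuous_on UNIV V"
  shows "uniform_limit (cball 0 R) (\<lambda>i q. W i (q + b i)) (\<lambda>q. V (q + b0)) F"
  unfolding uniform_limit_iff
proof (intro allI impI)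
  fix e :: real assume e: "0 < e"
  define R' where "R' = R + norm b0 + 1"
  have "uniformly_continuous_on (cball 0 R') V"
    by (intro compact_uniformly_continuous continuous_on_subset[OF V]) auto
  then obtain d where d: "0 < d" "\<And>p q. p \<in> cball 0 R' \<Longrightarrow> q \<in> cball 0 R' \<Longrightarrow> dist p q < d \<Longrightarrow> dist (V p) (V q) < e / 2"
    using e unfolding uniformly_continuous_on_def by (meson half_gt_zero)
  have "\<forall>\<^sub>F i in F. dist (b i) b0 < min 1 d" using b d(1) by (intro tendstoD) auto
  moreover have "\<forall>\<^sub>F i in F. \<forall>q\<in>cball 0 R'. dist (W i q) (V q) < e / 2"
    by (rule uniform_limitD[OF lim half_gt_zero[OF e]])
  ultimately show "\<forall>\<^sub>F i in F. \<forall>q\<in>cball 0 R. dist (W i (q + b i)) (V (q + b0)) < e"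
  proof eventually_elim
    case (elim i)
    show ?case
    proof
      fix q :: "real^3" assume q: "q \<in> cball 0 R"
      have "norm (b i) < norm b0 + 1" using elim(1) norm_triangle_ineq2[of "b i" b0] by (simp add: dist_norm)
      then have 1: "q + b i \<in> cball 0 R'" "q + b0 \<in> cball 0 R'"
        using q norm_triangle_ineq[of q "b i"] norm_triangle_ineq[of q b0] by (simp_all add: R'_def)
      have "dist (V (q + b i)) (V (q + b0)) < e / 2" using elim(1) by (intro d(2) 1) simp
      moreover have "dist (W i (q + b i)) (V (q + b i)) < e / 2" using elim(2) 1(1) by blast
      ultimately show "dist (W i (q + b i)) (V (q + b0)) < e"
        using dist_triangle[of "W i (q + b i)" "V (q + b0)" "V (q + b i)"] by linarith
    qed
  qed
qed

definition hand :: "(real^3 \<Rightarrow> real^3) \<Rightarrow> real" where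
  "hand V = (THE \<epsilon>. handed_fibration V \<epsilon>)"

lemma hand: "V \<in> nondeg_fibrations \<Longrightarrow> handed_fibration V (hand V)"
  unfolding hand_def by (rule theI') (use handed_exists handed_unique in blast)

lemma hand_eq: "handed_fibration V \<epsilon> \<Longrightarrow> hand V = \<epsilon>"
  unfolding hand_def using handed_unique by blast

lemma hand_square: "V \<in> nondeg_fibrations \<Longrightarrow> hand V * hand V = 1"
  using hand handed_fibration.eps2 by blast

text \<open>The determinant at two fixed points depends continuously on the fibration and, where
  nonzero, has the sign of the handedness.\<close>

lemma hand_locally_constant:
  assumes V: "V \<in> nondeg_fibrations" and ev: "\<forall>\<^sub>F i in F. W i \<in> nondeg_fibrations"
    and lim: "\<And>q. ((\<lambda>i. W i q) \<longlongrightarrow> V q) F"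
  shows "\<forall>\<^sub>F i in F. hand (W i) = hand V"
proof -
  interpret handed_fibration V "hand V" by (rule hand[OF V])
  obtain q q' where q: "(q - q') \<bullet> (V q \<times> V q') \<noteq> 0" using two_fibers[OF V] by blast
  then have "0 < hand V * ((q - q') \<bullet> (V q \<times> V q'))"
    using handed[of q q'] eps by (auto simp: less_le)
  moreover have "((\<lambda>i. hand V * ((q - q') \<bullet> (W i q \<times> W i q'))) \<longlongrightarrow> hand V * ((q - q') \<bullet> (V q \<times> V q'))) F"
    by (intro tendsto_intros bounded_bilinear.tendsto[OF bilinear_conv_bounded_bilinear[THEN iffD1, OF bilinear_cross]] lim)
  ultimately have "\<forall>\<^sub>F i in F. 0 < hand V * ((q - q') \<bullet> (W i q \<times> W i q'))" by (rule order_tendstoD(1)[rotated])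
  with ev show ?thesis
  proof eventually_elim
    case (elim i)
    interpret Wi: handed_fibration "W i" "hand (W i)" by (rule hand[OF elim(1)])
    show ?case using Wi.handed[of q q'] elim(2) eps Wi.eps by auto
  qed
qed

definition model :: "((real^3 \<Rightarrow> real^3) \<Rightarrow> real^3) \<Rightarrow> (real^3 \<Rightarrow> real^3) \<Rightarrow> real^3 \<Rightarrow> real^3" where
  "model b V = cone_map (hand V) (\<lambda>q. V (q + b V))"

text \<open>The chosen \<open>W\<close> is unique by \<open>fibers_of_unique\<close>. It is the
  smoothed fibration seen from \<open>b V\<close>, and the argument \<open>q - b V\<close> moves it
  back.\<close>

definition deform :: "((real^3 \<Rightarrow> real^3) \<Rightarrow> real^3) \<Rightarrow> real \<Rightarrow> (real^3 \<Rightarrow> real^3) \<Rightarrow> real^3 \<Rightarrow> real^3" where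
  "deform b s V = (if V \<in> nondeg_fibrations \<and> s \<noteq> 0
     then (\<lambda>q. (SOME W. W \<in> nondeg_fibrations \<and> fibers_of (hand V) (smoothing s (model b V)) W) (q - b V))
     else V)"

lemma model_props:
  assumes V: "V \<in> nondeg_fibrations"
  shows "conic_nonexpansive (model b V)" "strict_map (model b V)"
    "fibers_of (hand V) (model b V) (\<lambda>q. V (q + b V))" "handed_fibration (\<lambda>q. V (q + b V)) (hand V)"
proof -
  interpret handed_fibration "\<lambda>q. V (q + b V)" "hand V" by (rule handed_translate[OF hand[OF V]])
  show "conic_nonexpansive (model b V)" "strict_map (model b V)" "fibers_of (hand V) (model b V) (\<lambda>q. V (q + b V))"
    using conic_G G_strict fibers_of_G by (simp_all add: model_def strict_map_def)
  show "handed_fibration (\<lambda>q. V (q + b V)) (hand V)" by (rule handed_fibration_axioms)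
qed

lemma deform_props:
  assumes V: "V \<in> nondeg_fibrations" and s: "0 \<le> s" "s \<le> 1"
  shows "deform b s V \<in> nondeg_fibrations"
    "fibers_of (hand V) (smoothing s (model b V)) (\<lambda>q. deform b s V (q + b V))"
proof -
  note m = model_props[OF V, of b]
  have "deform b s V \<in> nondeg_fibrations \<and> fibers_of (hand V) (smoothing s (model b V)) (\<lambda>q. deform b s V (q + b V))"
  proof (cases "s = 0")
    case True
    then show ?thesis using V m(3) smoothing_zero[OF m(1)] by (simp add: deform_def)
  next
    case False
    define W where "W = (SOME W. W \<in> nondeg_fibrations \<and> fibers_of (hand V) (smoothing s (model b V)) W)"
    have "\<exists>W. W \<in> nondeg_fibrations \<and> fibers_of (hand V) (smoothing s (model b V)) W"
      using smoothing_field_exists[OF m(1,2) _ s(2) hand_square[OF V]] s(1) False by auto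
    from someI_ex[OF this] have W: "W \<in> nondeg_fibrations" "fibers_of (hand V) (smoothing s (model b V)) W"
      unfolding W_def by blast+
    have d: "deform b s V = (\<lambda>q. W (q + (- b V)))" using V False by (simp add: deform_def W_def)
    show ?thesis using nondeg_translate[OF W(1), of "- b V"] W(2) by (simp add: d)
  qed
  then show "deform b s V \<in> nondeg_fibrations"
    "fibers_of (hand V) (smoothing s (model b V)) (\<lambda>q. deform b s V (q + b V))" by blast+
qed

text \<open>Seen from its center, a Hopf fibration has a map that smoothing leaves unchanged, and
  the map determines the fibration.\<close>

lemma deform_fixes_hopf:
  assumes V: "hopf_center (b V) V" "V \<in> nondeg_fibrations" and s: "0 \<le> s" "s \<le> 1"
  shows "deform b s V = V"
proof -
  obtain v \<epsilon> where v: "norm v = 1" and e: "\<epsilon> = 1 \<or> \<epsilon> = -1" and VV: "V = hopf_field \<epsilon> (b V) v"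
    using V(1) unfolding hopf_center_def by blast
  have ee: "\<epsilon> * \<epsilon> = 1" using e by auto
  have "handed_fibration V \<epsilon>" using hopf_handed[OF e v, of "b V"] VV by simp
  then have h: "hand V = \<epsilon>" by (rule hand_eq)
  have "(\<lambda>q. hopf_field \<epsilon> (b V) v (q + b V)) = hopf_field \<epsilon> 0 v" by (simp add: hopf_field_translate)
  then have tr: "(\<lambda>q. V (q + b V)) = hopf_field \<epsilon> 0 v" using VV by metis
  have "\<And>x. model b V x = norm x *\<^sub>R v" unfolding model_def h tr by (rule hopf_cone_map[OF e v])
  from smoothing_hopf[OF v this model_props(1,2)[OF V(2)] s] have "smoothing s (model b V) = model b V" .
  then have "(\<lambda>q. deform b s V (q + b V)) = (\<lambda>q. V (q + b V))"
    using deform_props(2)[OF V(2) s, of b] model_props(3)[OF V(2), of b] fibers_of_unique by metis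
  then have "deform b s V ((q - b V) + b V) = V ((q - b V) + b V)" for q by (rule fun_cong)
  then show ?thesis by (intro ext) simp
qed

lemma deform_one_hopf:
  assumes V: "V \<in> nondeg_fibrations"
  shows "hopf_fibration (deform b 1 V)"
proof -
  let ?W = "deform b 1 V"
  define v where "v = sgn (mollify 1 (model b V) 0)"
  have "mollify 1 (model b V) 0 \<noteq> 0" by (rule mollify_nonzero) (use model_props[OF V] in auto)
  then have v: "norm v = 1" by (simp add: v_def norm_sgn)
  interpret handed_fibration V "hand V" by (rule hand[OF V])
  have "fibers_of (hand V) (smoothing 1 (model b V)) (\<lambda>q. ?W (q + b V))" by (rule deform_props(2)[OF V]) auto
  then have "fibers_of (hand V) (\<lambda>x. norm x *\<^sub>R v) (\<lambda>q. ?W (q + b V))"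
    unfolding v_def smoothing_one_const[abs_def] .
  then have "?W ((q - b V) + b V) = hopf_field (hand V) 0 v (q - b V)" for q
    by (rule fibers_of_const[OF eps2 v, THEN iffD1, rule_format])
  then have "?W = hopf_field (hand V) (b V) v" by (intro ext) (simp add: hopf_field_def)
  then show ?thesis unfolding hopf_fibration_iff using v eps by blast
qed

text \<open>Locally uniform convergence of fields survives the translation to \<open>b V\<close>,
  passes to uniform convergence of the maps on the sphere, then to the smoothed maps, and from these
  back to the fields.\<close>

lemma continuous_map_deform:
  assumes b: "\<And>V. V \<in> nondeg_fibrations \<Longrightarrow> (b \<longlongrightarrow> b V) (nhdsin fibration_space V)"
  shows "continuous_map (prod_topology (top_of_set {0..1}) fibration_space) fibration_space (\<lambda>p. deform b (fst p) (snd p))"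
proof (rule continuous_map_into_fibration_space)
  let ?P = "prod_topology (top_of_set {0..1::real}) fibration_space"
  fix p assume p: "p \<in> topspace ?P"
  obtain s V where sV: "p = (s, V)" by (cases p)
  have s: "0 \<le> s" "s \<le> 1" and V: "V \<in> nondeg_fibrations" using p sV by auto
  show "deform b (fst p) (snd p) \<in> nondeg_fibrations" using deform_props(1)[OF V s] sV by simp
  fix R
  let ?F = "nhdsin ?P p"
  have evP: "\<forall>\<^sub>F x in ?F. x \<in> topspace ?P" unfolding eventually_nhdsin using p openin_topspace by blast
  have ev: "\<forall>\<^sub>F x in ?F. snd x \<in> nondeg_fibrations \<and> 0 \<le> fst x \<and> fst x \<le> 1"
    using evP by eventually_elim (auto simp: mem_Times_iff)
  have "continuous_map ?P euclidean fst"
    by (rule continuous_map_into_fulltopology[OF continuous_map_fst])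
  from tendsto_nhdsin[OF this p] have s_lim: "(fst \<longlongrightarrow> s) ?F" by (simp add: sV)
  from filterlim_nhdsin[OF continuous_map_snd p] have flim: "filterlim snd (nhdsin fibration_space V) ?F" by (simp add: sV)
  have V_lim: "uniform_limit (cball 0 r) snd V ?F" for r
    unfolding uniform_limit_iff
  proof (intro allI impI)
    fix e :: real assume "0 < e"
    from eventually_compose_filterlim[OF uniform_limitD[OF uniform_nhd[OF V] this] flim]
    show "\<forall>\<^sub>F x in ?F. \<forall>q\<in>cball 0 r. dist (snd x q) (V q) < e" .
  qed
  have b_lim: "((\<lambda>x. b (snd x)) \<longlongrightarrow> b V) ?F" by (rule filterlim_compose[OF b[OF V] flim])
  have tr_lim: "uniform_limit (cball 0 r) (\<lambda>x q. snd x (q + b (snd x))) (\<lambda>q. V (q + b V)) ?F" for r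
    by (rule uniform_limit_shift[OF V_lim b_lim nondeg_continuous[OF V]])
  have tr_point: "((\<lambda>x. snd x (q + b (snd x))) \<longlongrightarrow> V (q + b V)) ?F" for q
    by (rule tendsto_uniform_limitI[OF tr_lim[of "norm q"]]) simp
  have V_point: "((\<lambda>x. snd x q) \<longlongrightarrow> V q) ?F" for q
    by (rule tendsto_uniform_limitI[OF V_lim[of "norm q"]]) simp
  have "\<forall>\<^sub>F x in ?F. snd x \<in> nondeg_fibrations" using ev by eventually_elim simp
  \<comment> \<open>The sign has to be eventually constant, because convergence of maps and of
    fields is compared for one fixed \<open>\<epsilon>\<close>.\<close>
  then have hand_ev: "\<forall>\<^sub>F x in ?F. hand (snd x) = hand V" by (rule hand_locally_constant[OF V _ V_point])
  have "\<forall>\<^sub>F x in ?F. handed_fibration (\<lambda>q. snd x (q + b (snd x))) (hand V)"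
    using hand_ev ev by eventually_elim (metis model_props(4))
  then have "uniform_limit (sphere 0 1) (\<lambda>x. cone_map (hand V) (\<lambda>q. snd x (q + b (snd x)))) (model b V) ?F"
    unfolding model_def by (rule cone_map_uniform[OF model_props(4)[OF V]]) (rule tr_point)
  moreover have "\<forall>\<^sub>F x in ?F. \<forall>q\<in>sphere 0 1. cone_map (hand V) (\<lambda>q. snd x (q + b (snd x))) q = model b (snd x) q"
    using hand_ev by eventually_elim (simp add: model_def)
  ultimately have model_lim: "uniform_limit (sphere 0 1) (\<lambda>x. model b (snd x)) (model b V) ?F"
    by (simp add: uniform_limit_cong)
  have "uniform_limit (sphere 0 1) (\<lambda>x. smoothing (fst x) (model b (snd x))) (smoothing s (model b V)) ?F"
    by (rule smoothing_uniform_limit[OF model_props(1,2)[OF V] s _ s_lim model_lim])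
      (use ev in \<open>eventually_elim, use model_props(1) in blast\<close>)
  then have lim: "uniform_limit (cball 0 r) (\<lambda>x q. deform b (fst x) (snd x) (q + b (snd x))) (\<lambda>q. deform b s V (q + b V)) ?F" for r
  proof (rule fibers_of_uniform_limit[OF smoothing_conic[OF model_props(1,2)[OF V] s] deform_props(2)[OF V s], rotated 2])
    show "continuous_on UNIV (\<lambda>q. deform b s V (q + b V))"
      by (rule nondeg_continuous[OF nondeg_translate[OF deform_props(1)[OF V s]]])
    show "\<forall>\<^sub>F x in ?F. conic_nonexpansive (smoothing (fst x) (model b (snd x))) \<and>
       fibers_of (hand V) (smoothing (fst x) (model b (snd x))) (\<lambda>q. deform b (fst x) (snd x) (q + b (snd x)))"
      using hand_ev ev
    proof eventually_elim
      case (elim x)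
      then show ?case using smoothing_conic[OF model_props(1,2), of "snd x" "fst x"] deform_props(2)[of "snd x" "fst x" b] by metis
    qed
    show "\<bar>hand V\<bar> \<le> 1" using handed_fibration.eps[OF hand[OF V]] by auto
  qed
  have "uniform_limit (cball 0 R) (\<lambda>x q. deform b (fst x) (snd x) ((q + (- b (snd x))) + b (snd x))) (\<lambda>q. deform b s V ((q + (- b V)) + b V)) ?F"
    by (rule uniform_limit_shift[OF lim tendsto_minus[OF b_lim] nondeg_continuous[OF nondeg_translate[OF deform_props(1)[OF V s]]]])
  then show "uniform_limit (cball 0 R) (\<lambda>p. deform b (fst p) (snd p)) (deform b (fst p) (snd p)) ?F"
    by (simp add: sV)
qed

theorem theorem2p5:
  fixes X :: "(real^3 \<Rightarrow> real^3) topology" and A :: "(real^3 \<Rightarrow> real^3) set"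
  defines "X \<equiv> subtopology compact_open nondeg_fibrations"
      and "A \<equiv> {V \<in> nondeg_fibrations. hopf_fibration V}"
  shows "\<exists>r. r ` topspace X \<subseteq> A \<and> (\<forall>V\<in>A. r V = V) \<and>
             homotopic_with (\<lambda>h. \<forall>V\<in>A. h V = V) X X id r"
proof -
  obtain b where b: "\<And>V. V \<in> A \<Longrightarrow> b V = center V"
    "\<And>V. V \<in> nondeg_fibrations \<Longrightarrow> (b \<longlongrightarrow> b V) (nhdsin X V)"
    unfolding A_def X_def using center_extension by blast
  have fix_A: "deform b s V = V" if "V \<in> A" "0 \<le> s" "s \<le> 1" for V s
  proof (rule deform_fixes_hopf)
    have "\<exists>a. hopf_center a V" using that(1) unfolding A_def hopf_fibration_center by blast
    then show "hopf_center (b V) V" using b(1)[OF that(1)] center_eq by auto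
  qed (use that in \<open>auto simp: A_def\<close>)
  have "deform b 1 ` topspace X \<subseteq> A"
    using deform_props(1)[of _ 1 b] deform_one_hopf[of _ b] by (auto simp: A_def X_def)
  moreover have "\<forall>V\<in>A. deform b 1 V = V" using fix_A by simp
  moreover have "homotopic_with (\<lambda>h. \<forall>V\<in>A. h V = V) X X id (deform b 1)"
    unfolding homotopic_with_def
  proof (intro exI[of _ "\<lambda>p. deform b (fst p) (snd p)"] conjI allI ballI)
    show "continuous_map (prod_topology (top_of_set {0..1}) X) X (\<lambda>p. deform b (fst p) (snd p))"
      unfolding X_def using b(2) unfolding X_def by (rule continuous_map_deform)
    show "deform b (fst (0, V)) (snd (0::real, V)) = id V" for V by (simp add: deform_def)
    show "deform b (fst (1, V)) (snd (1::real, V)) = deform b 1 V" for V by simp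
    show "deform b (fst (t, V)) (snd (t, V)) = V" if "t \<in> {0..1}" "V \<in> A" for t :: real and V
      using fix_A[OF that(2)] that(1) by simp
  qed
  ultimately show ?thesis by blast
qed

end
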